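(* Let $(T,\mathcal{A},\mu)$ be a complete finite measure space, let $\varphi\colon T\times\mathbb{R}^n\times\mathbb{R}^m\to\overline{\mathbb{R}}$ be a normal integrand for which there exists $\nu\in L^1(T,\mathbb{R}_+)$ with $\varphi_t(v,w)\ge-\nu(t)$ for all $t\in T$, $v\in\mathbb{R}^n$, $w\in\mathbb{R}^m$, and let $E_\varphi(x,\mathbf{y}):=\int_T\varphi_t(x,\mathbf{y}(t))\,\mu(dt)$ on $\mathbb{R}^n\times L^1(T,\mathbb{R}^m)$. Let $p,q\in(1,\infty)$ with $1/p+1/q=1$, and let $(\bar x,\bar{\mathbf{y}})\in\mathbb{R}^n\times L^1(T,\mathbb{R}^m)$ be a $p$-robust local minimizer of $E_\varphi$. Then there exist sequences $\{x_k\}\subset\mathbb{R}^n$, $\{\mathbf{x}_k\}\subset L^p(T,\mathbb{R}^n)$, $\{\mathbf{x}_k^*\}\subset L^q(T,\mathbb{R}^n)$, $\{\mathbf{y}_k\}\subset L^1(T,\mathbb{R}^m)$, and $\{\mathbf{y}_k^*\}\subset L^\infty(T,\mathbb{R}^m)$ such that: (i) $(\mathbf{x}_k^*(t),\mathbf{y}_k^*(t))\in\widehat\partial\varphi_t(\mathbf{x}_k(t),\mathbf{y}_k(t))$ for a.e. $t\in T$ and all $k\in\mathbb{N}$; (ii) $\|\bar x-x_k\|\to0$, $\|\bar x-\mathbf{x}_k\|_p\to0$, and $\|\bar{\mathbf{y}}-\mathbf{y}_k\|_1\to0$ as $k\to\infty$; (iii) $\big\|\int_T\mathbf{x}_k^*(t)\,\mu(dt)\big\|\to0$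 and $\|\mathbf{y}_k^*\|_\infty\to0$ as $k\to\infty$; (iv) $\|\mathbf{x}_k^*\|_q\,\|\mathbf{x}_k-x_k\|_p\to0$ as $k\to\infty$; (v) $\int_T\big|\varphi_t(\mathbf{x}_k(t),\mathbf{y}_k(t))-\varphi_t(\bar x,\bar{\mathbf{y}}(t))\big|\,\mu(dt)\to0$ as $k\to\infty$.
   Context: $\overline{\mathbb{R}}=[-\infty,\infty]$; $\|\cdot\|$ is the Euclidean norm; $\mathbb{B}_r(\cdot)$ denotes a closed ball of radius $r$ (in $\mathbb{R}^n$ or in $L^1(T,\mathbb{R}^m)$). Boldface letters denote measurable functions on $T$; points $x\in\mathbb{R}^n$ are identified with constant functions, so $\|x-\mathbf{x}\|_p=(\int_T\|x-\mathbf{x}(t)\|^p\mu(dt))^{1/p}$. The integral of a measurable $\alpha\colon T\to\overline{\mathbb{R}}$ is $\int_T\max\{\alpha,0\}\,d\mu+\int_T\min\{\alpha,0\}\,d\mu$ with $\infty+(-\infty)=\infty$. Normal integrand: $\varphi$ is $\mathcal{A}\otimes\mathcal{B}(\mathbb{R}^{n+m})$-measurable and $\varphi_t:=\varphi(t,\cdot,\cdot)$ is lower semicontinuous for every $t\in T$. $\operatorname{dom}E_\varphi=\{(x,\mathbf{y})\mid E_\varphi(x,\mathbf{y})<\infty\}$. Regular subdifferential: for $\psi\colon\mathbb{R}^d\to\overline{\mathbb{R}}$ and $\bar z$ with $\psi(\bar z)$ finite, $\widehat\partial\psi(\bar z):=\{z^*\in\mathbb{R}^d\mid(z^*,-1)\in\widehat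 N((\bar z,\psi(\bar z));\operatorname{epi}\psi)\}$, where $\operatorname{epi}\psi=\{(z,\alpha)\mid\alpha\ge\psi(z)\}$ and $\widehat N(\bar u;\Omega):=\{u^*\mid\limsup_{u\to\bar u,\,u\in\Omega}\langle u^*,u-\bar u\rangle/\|u-\bar u\|\le0\}$ for $\bar u\in\Omega$; $\widehat\partial\psi(\bar z)=\emptyset$ if $\psi(\bar z)$ is not finite. $p$-stabilized infimum ($p\in[1,\infty)$): for $B\times C\subset\mathbb{R}^n\times L^1(T,\mathbb{R}^m)$, $$\wedge_{p,B\times C}E_\varphi:=\sup_{\varepsilon>0}\inf\Big\{\int_T\varphi_t(\mathbf{x}(t),\mathbf{y}(t))\,\mu(dt)\;\Big|\;x\in B,\ \mathbf{y}\in C,\ \mathbf{x}\in L^p(T,\mathbb{R}^n),\ \int_T\|\mathbf{x}(t)-x\|^p\mu(dt)\le\varepsilon\Big\}.$$ The infimum of $E_\varphi$ on $B\times C$ is $p$-robust if $\wedge_{p,B\times C}E_\varphi=\inf_{B\times C}E_\varphi\in\mathbb{R}$; in that case every minimizer of $E_\varphi$ on $B\times C$ is called a $p$-robust minimizer of $E_\varphi$ on $B\times C$. A pair $(x,\mathbf{y})\in\operatorname{dom}E_\varphi$ is a $p$-robust local minimizer of $E_\varphi$ if it is a $p$-robust minimizer of $E_\varphi$ on $\mathbb{B}_r(x)\times\mathbb{B}_r(\mathbf{y})$ for some $r>0$. *)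

theory Defs
  imports "HOL-Analysis.Analysis" "HOL-Probability.Essential_Supremum"
begin

text \<open>
  Elements of the Lebesgue spaces are represented by measurable functions, not by equivalence
  classes; over a complete measure space, changes on null sets do not matter below.
\<close>

definition Lp_space :: "real \<Rightarrow> 't measure \<Rightarrow> ('t \<Rightarrow> 'a::euclidean_space) set" where
  "Lp_space p M = {f \<in> borel_measurable M. integrable M (\<lambda>t. norm (f t) powr p)}"

definition Lp_norm :: "real \<Rightarrow> 't measure \<Rightarrow> ('t \<Rightarrow> 'a::euclidean_space) \<Rightarrow> real" where
  "Lp_norm p M f = (\<integral>t. norm (f t) powr p \<partial>M) powr (1 / p)"

definition Linf_space :: "'t measure \<Rightarrow> ('t \<Rightarrow> 'a::euclidean_space) set" where
  "Linf_space M = {f \<in> borel_measurable M. esssup M (\<lambda>t. ereal (norm (f t))) < \<infinity>}"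

text \<open>
  If the measure is zero, the essential supremum is \<open>-\<infinity>\<close>, and the conversion to
  \<open>real\<close> gives the expected norm \<open>0\<close>.
\<close>

definition Linf_norm :: "'t measure \<Rightarrow> ('t \<Rightarrow> 'a::euclidean_space) \<Rightarrow> real" where
  "Linf_norm M f = real_of_ereal (esssup M (\<lambda>t. ereal (norm (f t))))"

definition L1_cball :: "'t measure \<Rightarrow> ('t \<Rightarrow> 'a::euclidean_space) \<Rightarrow> real \<Rightarrow> ('t \<Rightarrow> 'a) set" where
  "L1_cball M y r = {z \<in> Lp_space 1 M. Lp_norm 1 M (\<lambda>t. z t - y t) \<le> r}"

text \<open>
  The integral of an extended-real-valued function as the integral of its positive part plus the
  integral of its negative part. The function \<open>e2ennreal\<close> maps negative numbers to \<open>0\<close>, so it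
  takes the positive part, and addition on \<open>ereal\<close> satisfies \<open>\<infinity> + (-\<infinity>) = \<infinity>\<close>, the
  convention used here.
\<close>

definition ext_integral :: "'t measure \<Rightarrow> ('t \<Rightarrow> ereal) \<Rightarrow> ereal" where
  "ext_integral M \<alpha> =
     enn2ereal (\<integral>\<^sup>+t. e2ennreal (\<alpha> t) \<partial>M) + (- enn2ereal (\<integral>\<^sup>+t. e2ennreal (- \<alpha> t) \<partial>M))"

definition lower_semicontinuous :: "('a::topological_space \<Rightarrow> ereal) \<Rightarrow> bool" where
  "lower_semicontinuous \<psi> \<longleftrightarrow> (\<forall>z. \<psi> z \<le> Liminf (at z) \<psi>)"

definition normal_integrand ::
  "'t measure \<Rightarrow> ('t \<Rightarrow> 'a::euclidean_space \<times> 'b::euclidean_space \<Rightarrow> ereal) \<Rightarrow> bool" where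
  "normal_integrand M \<phi> \<longleftrightarrow>
     (\<lambda>(t, z). \<phi> t z) \<in> borel_measurable (M \<Otimes>\<^sub>M borel) \<and>
     (\<forall>t\<in>space M. lower_semicontinuous (\<phi> t))"

definition extended_epigraph :: "('a \<Rightarrow> ereal) \<Rightarrow> ('a \<times> real) set" where
  "extended_epigraph \<psi> = {(z, \<alpha>). \<psi> z \<le> ereal \<alpha>}"

text \<open>
  At an isolated point of \<open>\<Omega>\<close> the upper limit below is \<open>-\<infinity>\<close>, and the cone is the whole space.
\<close>

definition regular_normal_cone :: "'a::euclidean_space \<Rightarrow> 'a set \<Rightarrow> 'a set" where
  "regular_normal_cone u \<Omega> =
     {u'. Limsup (at u within \<Omega>) (\<lambda>w. ereal (u' \<bullet> (w - u) / norm (w - u))) \<le> 0}"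

definition regular_subdifferential :: "('a::euclidean_space \<Rightarrow> ereal) \<Rightarrow> 'a \<Rightarrow> 'a set" where
  "regular_subdifferential \<psi> z =
     (if \<bar>\<psi> z\<bar> \<noteq> \<infinity>
      then {z'. (z', - 1) \<in> regular_normal_cone (z, real_of_ereal (\<psi> z)) (extended_epigraph \<psi>)}
      else {})"

definition integral_functional ::
  "'t measure \<Rightarrow> ('t \<Rightarrow> 'a::euclidean_space \<times> 'b::euclidean_space \<Rightarrow> ereal)
    \<Rightarrow> 'a \<Rightarrow> ('t \<Rightarrow> 'b) \<Rightarrow> ereal" where
  "integral_functional M \<phi> x y = ext_integral M (\<lambda>t. \<phi> t (x, y t))"

definition stabilized_infimum ::
  "real \<Rightarrow> 't measure \<Rightarrow> ('t \<Rightarrow> 'a::euclidean_space \<times> 'b::euclidean_space \<Rightarrow> ereal)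
    \<Rightarrow> 'a set \<Rightarrow> ('t \<Rightarrow> 'b) set \<Rightarrow> ereal" where
  "stabilized_infimum p M \<phi> B C =
     (SUP \<epsilon>\<in>{0<..}. Inf {ext_integral M (\<lambda>t. \<phi> t (\<xi> t, y t)) | x y \<xi>.
        x \<in> B \<and> y \<in> C \<and> \<xi> \<in> Lp_space p M \<and> (\<integral>t. norm (\<xi> t - x) powr p \<partial>M) \<le> \<epsilon>})"

definition robust_infimum ::
  "real \<Rightarrow> 't measure \<Rightarrow> ('t \<Rightarrow> 'a::euclidean_space \<times> 'b::euclidean_space \<Rightarrow> ereal)
    \<Rightarrow> 'a set \<Rightarrow> ('t \<Rightarrow> 'b) set \<Rightarrow> bool" where
  "robust_infimum p M \<phi> B C \<longleftrightarrow>
     stabilized_infimum p M \<phi> B C = (INF (x, y)\<in>B \<times> C. integral_functional M \<phi> x y) \<and>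
     \<bar>INF (x, y)\<in>B \<times> C. integral_functional M \<phi> x y\<bar> \<noteq> \<infinity>"

definition robust_minimizer ::
  "real \<Rightarrow> 't measure \<Rightarrow> ('t \<Rightarrow> 'a::euclidean_space \<times> 'b::euclidean_space \<Rightarrow> ereal)
    \<Rightarrow> 'a set \<Rightarrow> ('t \<Rightarrow> 'b) set \<Rightarrow> 'a \<Rightarrow> ('t \<Rightarrow> 'b) \<Rightarrow> bool" where
  "robust_minimizer p M \<phi> B C x y \<longleftrightarrow>
     robust_infimum p M \<phi> B C \<and> x \<in> B \<and> y \<in> C \<and>
     (\<forall>x'\<in>B. \<forall>y'\<in>C. integral_functional M \<phi> x y \<le> integral_functional M \<phi> x' y')"

definition robust_local_minimizer ::
  "real \<Rightarrow> 't measure \<Rightarrow> ('t \<Rightarrow> 'a::euclidean_space \<times> 'b::euclidean_space \<Rightarrow> ereal)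
    \<Rightarrow> 'a \<Rightarrow> ('t \<Rightarrow> 'b) \<Rightarrow> bool" where
  "robust_local_minimizer p M \<phi> x y \<longleftrightarrow>
     y \<in> Lp_space 1 M \<and> integral_functional M \<phi> x y < \<infinity> \<and>
     (\<exists>r>0. robust_minimizer p M \<phi> (cball x r) (L1_cball M y r) x y)"

end

theory Submission
  imports Defs
begin

text \<open>
Fix a small number \<open>\<tau> > 0\<close>. The point \<open>x\<close> and the first argument of the integrand are decoupled:
instead of \<open>\<integral> \<phi>\<^sub>t(x, y(t))\<close> one minimises \<open>\<integral> \<phi>\<^sub>t(\<xi>(t), y(t)) + K \<integral> \<parallel>\<xi>(t) - x\<parallel>\<^sup>p\<close> over \<open>x\<close>, \<open>\<xi>\<close> and \<open>y\<close>.
Robustness of the infimum says precisely that, for large \<open>K\<close>, the triple \<open>(xbar, xbar, ybar)\<close>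
minimises this penalised functional up to \<open>\<tau>\<^sup>3\<close> (\<open>robust_lower_bound\<close>).

The functional has no exact minimiser in general, so it is perturbed. The variational principle of
Borwein and Preiss (\<open>variational_principle\<close>) adds a series of multiples of the gauge
\<open>smooth_norm u = sqrt (1 + \<parallel>u\<parallel>\<^sup>2) - 1\<close>, integrated over the measure space, such that the perturbed functional has
a minimiser near the given triple. This gauge is differentiable and its gradients are bounded
by \<open>1\<close>. Hence the perturbation contributes an exact gradient of norm at most \<open>2 \<tau>\<close>, and an exact
Fermat rule replaces the fuzzy sum rule that the Ekeland principle would require.

Freezing \<open>x\<close>, minimality among functions turns into local minimality at almost every \<open>t\<close>
(\<open>AE_pointwise_local_minimizer\<close>): a change of \<open>y\<close> by at most a constant stays in the \<open>L\<^sup>1\<close> ball.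
The passage from functions to points needs a measurable choice of better points. As the integrand
is only lower semicontinuous, a countable dense set of candidates does not suffice; the choice is
made by \<open>AE_no_section_if_no_selection\<close>, which rests on a capacity argument for Souslin sets.
The Fermat rule then yields the subgradient \<open>(\<xi>', y')\<close> at almost every \<open>t\<close>, where \<open>y'\<close> consists only
of the perturbation gradient and \<open>\<xi>'\<close> is \<open>- K\<close> times the gradient of \<open>\<parallel>\<cdot>\<parallel>\<^sup>p\<close> at \<open>\<xi>(t) - x\<close>
up to such a term.

Freezing \<open>(\<xi>, y)\<close>, minimality in \<open>x\<close> makes the integral of the penalty gradient small
(\<open>penalty_gradient_bound\<close>), so the integral of \<open>\<xi>'\<close> is small. Using robustness with \<open>K / 2\<close> in
place of \<open>K\<close> gives \<open>K \<integral> \<parallel>\<xi> - x\<parallel>\<^sup>p \<le> 2 \<tau>\<^sup>3\<close>; since \<open>\<parallel>\<xi>'\<parallel>\<^sub>q\<^sup>q\<close> is essentially \<open>K\<^sup>q p\<^sup>q \<integral> \<parallel>\<xi> - x\<parallel>\<^sup>p\<close>, this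
bounds the product \<open>\<parallel>\<xi>'\<parallel>\<^sub>q \<parallel>\<xi> - x\<parallel>\<^sub>p\<close>. Finally let \<open>\<tau>\<close> run through a geometric sequence. The integrals of
the integrand never exceed their value at \<open>(xbar, ybar)\<close> and the points converge almost everywhere;
with lower semicontinuity this forces \<open>L\<^sup>1\<close> convergence of the values, as in Scheffe's lemma.
\<close>

section \<open>Measurable sections of sets with non-negligible projection\<close>

definition rects :: "'t measure \<Rightarrow> ('t \<times> 'a::topological_space) set set" where
  "rects M = {A \<times> F |A F. A \<in> sets M \<and> closed F}"

lemma rectsE:
  assumes "X \<in> rects M" obtains A F where "X = A \<times> F" "A \<in> sets M" "closed F"
  using assms unfolding rects_def by blast

text \<open>
The sections of these sets are closed and their projections are measurable, and both properties
survive decreasing intersections as long as the sections lie in a fixed compact set.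
\<close>

definition fin_rects :: "'t measure \<Rightarrow> ('t \<times> 'a::topological_space) set set" where
  "fin_rects M = {\<Union>R |R. finite R \<and> R \<subseteq> rects M}"

lemma fin_rects_rectangle:
  assumes "A \<in> sets M" "closed F" shows "A \<times> F \<in> fin_rects M"
proof -
  have "A \<times> F \<in> rects M" using assms unfolding rects_def by blast
  then show ?thesis unfolding fin_rects_def by (intro CollectI exI[of _ "{A \<times> F}"]) simp
qed

lemma fin_rects_UN:
  assumes "finite I" "\<And>i. i \<in> I \<Longrightarrow> H i \<in> fin_rects M"
  shows "(\<Union>i\<in>I. H i) \<in> fin_rects M"
proof -
  have "\<forall>i\<in>I. \<exists>R. H i = \<Union>R \<and> finite R \<and> R \<subseteq> rects M"
    using assms(2) unfolding fin_rects_def by blast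
  from bchoice[OF this] obtain R where R: "\<forall>i\<in>I. H i = \<Union>(R i) \<and> finite (R i) \<and> R i \<subseteq> rects M" ..
  have "finite (\<Union>i\<in>I. R i)" using assms(1) R by (intro finite_UN_I) auto
  moreover have "(\<Union>i\<in>I. R i) \<subseteq> rects M" using R by (intro UN_least) simp
  moreover have "(\<Union>i\<in>I. H i) = \<Union>(\<Union>i\<in>I. R i)"
  proof -
    have "(\<Union>i\<in>I. H i) = (\<Union>i\<in>I. \<Union>(R i))" using R by simp
    also have "\<dots> = \<Union>(\<Union>i\<in>I. R i)" by (rule set_eqI) (simp only: UN_iff Union_iff bex_simps, blast)
    finally show ?thesis .
  qed
  ultimately show ?thesis unfolding fin_rects_def by blast
qed

lemma fin_rects_Int:
  assumes "H \<in> fin_rects M" "H' \<in> fin_rects M" shows "H \<inter> H' \<in> fin_rects M"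
proof -
  obtain R where R: "finite R" "R \<subseteq> rects M" "H = \<Union>R"
    using assms(1) unfolding fin_rects_def by blast
  obtain R' where R': "finite R'" "R' \<subseteq> rects M" "H' = \<Union>R'"
    using assms(2) unfolding fin_rects_def by blast
  have rect: "X \<inter> Y \<in> rects M" if X: "X \<in> rects M" and Y: "Y \<in> rects M" for X Y
  proof -
    obtain A F B G where "X = A \<times> F" "Y = B \<times> G" "A \<in> sets M" "B \<in> sets M" "closed F" "closed G"
      using X Y by (elim rectsE) blast
    then have "X \<inter> Y = (A \<inter> B) \<times> (F \<inter> G)" "A \<inter> B \<in> sets M" "closed (F \<inter> G)" by auto
    then show ?thesis unfolding rects_def by blast
  qed
  have "finite {X \<inter> Y |X Y. X \<in> R \<and> Y \<in> R'}" 
    using finite_image_set2[of "\<lambda>X. X \<in> R" "\<lambda>Y. Y \<in> R'"] R(1) R'(1) by simp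
  moreover have "{X \<inter> Y |X Y. X \<in> R \<and> Y \<in> R'} \<subseteq> rects M" using R(2) R'(2) rect by blast
  moreover have "H \<inter> H' = \<Union>{X \<inter> Y |X Y. X \<in> R \<and> Y \<in> R'}" unfolding R(3) R'(3) by blast
  ultimately show ?thesis unfolding fin_rects_def by blast
qed

lemma fin_rects_INT_atMost:
  assumes "\<And>n. H n \<in> fin_rects M" shows "(\<Inter>n\<le>(k::nat). H n) \<in> fin_rects M"
proof (induction k)
  case (Suc k)
  have "(\<Inter>n\<le>Suc k. H n) = (\<Inter>n\<le>k. H n) \<inter> H (Suc k)" unfolding atMost_Suc by blast
  then show ?case using fin_rects_Int[OF Suc assms[of "Suc k"]] by metis
qed (use assms in simp)

lemma fin_rects_proj:
  assumes "H \<in> fin_rects M" shows "{t. \<exists>u\<in>F. (t, u) \<in> H} \<in> sets M"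
proof -
  obtain R where R: "finite R" "R \<subseteq> rects M" "H = \<Union>R"
    using assms unfolding fin_rects_def by blast
  have "{t. \<exists>u\<in>F. (t, u) \<in> X} \<in> sets M" if X: "X \<in> R" for X
  proof -
    obtain A G where AG: "X = A \<times> G" "A \<in> sets M" using X R(2) by (blast elim: rectsE)
    have "{t. \<exists>u\<in>F. (t, u) \<in> X} = (if F \<inter> G = {} then {} else A)" unfolding AG(1) by auto
    then show ?thesis using AG(2) by simp
  qed
  then have "(\<Union>X\<in>R. {t. \<exists>u\<in>F. (t, u) \<in> X}) \<in> sets M" using R(1) by blast
  moreover have "(\<Union>X\<in>R. {t. \<exists>u\<in>F. (t, u) \<in> X}) = {t. \<exists>u\<in>F. (t, u) \<in> H}" unfolding R(3) by blast
  ultimately show ?thesis by simp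
qed

lemma fin_rects_section_closed:
  assumes "H \<in> fin_rects M" shows "closed {u. (t, u) \<in> H}"
proof -
  obtain R where R: "finite R" "R \<subseteq> rects M" "H = \<Union>R"
    using assms unfolding fin_rects_def by blast
  have "closed {u. (t, u) \<in> X}" if X: "X \<in> R" for X
  proof -
    obtain A G where AG: "X = A \<times> G" "closed G" using X R(2) by (blast elim: rectsE)
    have "{u. (t, u) \<in> X} = (if t \<in> A then G else {})" unfolding AG(1) by auto
    then show ?thesis using AG(2) by simp
  qed
  then have "closed (\<Union>X\<in>R. {u. (t, u) \<in> X})" using R(1) by blast
  moreover have "(\<Union>X\<in>R. {u. (t, u) \<in> X}) = {u. (t, u) \<in> H}" unfolding R(3) by blast
  ultimately show ?thesis by simp
qed

text \<open>
The Souslin operation. The set \<open>D n s\<close> is only allowed to depend on the first \<open>n\<close> entries of \<open>s\<close>.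
Indexing by whole sequences rather than by finite words makes reindexing along a pairing function a
plain substitution.
\<close>

definition souslin_scheme :: "'t measure \<Rightarrow> (nat \<Rightarrow> (nat \<Rightarrow> nat) \<Rightarrow> ('t \<times> 'a::topological_space) set) \<Rightarrow>
    ('t \<times> 'a) set \<Rightarrow> bool" where
  "souslin_scheme M D S \<longleftrightarrow> (\<forall>n s. D n s \<in> fin_rects M) \<and>
      (\<forall>n s \<tau>. (\<forall>i<n. s i = \<tau> i) \<longrightarrow> D n s = D n \<tau>) \<and>
      S = {z. \<exists>s. \<forall>n. z \<in> D n s}"

lemma souslin_schemeD:
  assumes "souslin_scheme M D S"
  shows "D n s \<in> fin_rects M" "(\<And>i. i < n \<Longrightarrow> s i = \<tau> i) \<Longrightarrow> D n s = D n \<tau>"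
    "z \<in> S \<longleftrightarrow> (\<exists>s. \<forall>n. z \<in> D n s)"
  using assms unfolding souslin_scheme_def by simp_all

definition souslin :: "'t measure \<Rightarrow> ('t \<times> 'a::topological_space) set \<Rightarrow> bool" where
  "souslin M S \<longleftrightarrow> (\<exists>D. souslin_scheme M D S)"

lemma souslinI: "souslin_scheme M D S \<Longrightarrow> souslin M S"
  unfolding souslin_def by (rule exI[of _ D])

lemma souslin_rectangle:
  assumes "A \<in> sets M" "closed F" shows "souslin M (A \<times> F)"
  unfolding souslin_def souslin_scheme_def using fin_rects_rectangle[OF assms]
  by (intro exI[of _ "\<lambda>_ _. A \<times> F"]) simp

text \<open>
The first entry of the index sequence chooses the member of the union, the remaining ones
run its scheme.
\<close>

lemma souslin_UN:
  assumes "\<And>j::nat. souslin M (S j)" "\<And>j. S j \<subseteq> space M \<times> UNIV"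
  shows "souslin M (\<Union>j. S j)"
proof -
  have "\<forall>j. \<exists>D. souslin_scheme M D (S j)" using assms(1) unfolding souslin_def by simp
  from choice[OF this] obtain D where "\<forall>j. souslin_scheme M (D j) (S j)" ..
  then have sch: "souslin_scheme M (D j) (S j)" for j by simp
  note D = souslin_schemeD[OF sch]
  let ?E = "\<lambda>n s. case n of 0 \<Rightarrow> space M \<times> UNIV | Suc n \<Rightarrow> D (s 0) n (\<lambda>i. s (Suc i))"
  have 1: "?E n s \<in> fin_rects M" for n s
    using D(1) fin_rects_rectangle[of "space M" M UNIV] by (auto split: nat.split)
  have 2: "?E n s = ?E n \<tau>" if "\<forall>i<n. s i = \<tau> i" for n s \<tau>
  proof (cases n)
    case (Suc m)
    then show ?thesis using D(2)[of m "\<lambda>i. s (Suc i)" "\<lambda>i. \<tau> (Suc i)" "\<tau> 0"] that by simp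
  qed auto
  have 3: "(\<Union>j. S j) = {z. \<exists>s. \<forall>n. z \<in> ?E n s}"
  proof safe
    fix a b j assume z: "(a, b) \<in> S j"
    from z[unfolded D(3)] obtain s where s: "\<forall>n. (a, b) \<in> D j n s" ..
    have "\<forall>n. (a, b) \<in> ?E n (case_nat j s)"
      using s z assms(2)[of j] by (auto split: nat.split)
    then show "\<exists>s. \<forall>n. (a, b) \<in> ?E n s" by (rule exI[of _ "case_nat j s"])
  next
    fix a b s assume z: "\<forall>n. (a, b) \<in> ?E n s"
    have "(a, b) \<in> D (s 0) n (\<lambda>i. s (Suc i))" for n
      using z[rule_format, of "Suc n"] by simp
    then have "\<forall>n. (a, b) \<in> D (s 0) n (\<lambda>i. s (Suc i))" by (rule allI)
    then have "(a, b) \<in> S (s 0)" unfolding D(3) by (intro exI[of _ "\<lambda>i. s (Suc i)"])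
    then show "(a, b) \<in> (\<Union>j. S j)" by (rule UN_I[OF UNIV_I])
  qed
  have "souslin_scheme M ?E (\<Union>j. S j)" unfolding souslin_scheme_def using 1 2 3 by simp
  then show ?thesis by (rule souslinI)
qed

text \<open>
One index sequence carries countably many others through the pairing function. The pairing is
increasing in its second argument, which keeps the dependence on initial segments.
\<close>

lemma souslin_INT:
  assumes "\<And>j::nat. souslin M (S j)"
  shows "souslin M (\<Inter>j. S j)"
proof -
  have "\<forall>j. \<exists>D. souslin_scheme M D (S j)" using assms unfolding souslin_def by simp
  from choice[OF this] obtain D where "\<forall>j. souslin_scheme M (D j) (S j)" ..
  then have sch: "souslin_scheme M (D j) (S j)" for j by simp
  note D = souslin_schemeD[OF sch]
  let ?E = "\<lambda>N s. D (fst (prod_decode N)) (snd (prod_decode N)) (\<lambda>i. s (prod_encode (fst (prod_decode N), i)))"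
  have 2: "?E N s = ?E N \<tau>" if "\<forall>i<N. s i = \<tau> i" for N s \<tau>
  proof (rule D(2))
    fix i assume i: "i < snd (prod_decode N)"
    define j n where "j = fst (prod_decode N)" and "n = snd (prod_decode N)"
    have N: "N = prod_encode (j, n)" unfolding j_def n_def by simp
    have "strict_mono triangle" by (simp add: strict_mono_Suc_iff)
    then have "triangle (j + i) < triangle (j + n)"
      using i unfolding n_def by (simp add: strict_mono_less)
    then have "prod_encode (j, i) < N" unfolding N by (simp add: prod_encode_def)
    then show "s (prod_encode (fst (prod_decode N), i)) = \<tau> (prod_encode (fst (prod_decode N), i))"
      using that unfolding j_def by blast
  qed
  have 3: "(\<Inter>j. S j) = {z. \<exists>s. \<forall>n. z \<in> ?E n s}"
  proof (intro set_eqI iffI)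
    fix z assume "z \<in> (\<Inter>j. S j)"
    then have "\<forall>j. \<exists>s. \<forall>n. z \<in> D j n s" using D(3) by simp
    from choice[OF this] obtain c where "\<forall>j n. z \<in> D j n (c j)" ..
    then have c: "z \<in> D j n (c j)" for j n by simp
    let ?c = "\<lambda>N. c (fst (prod_decode N)) (snd (prod_decode N))"
    have "\<forall>N. z \<in> ?E N ?c" using c by simp
    then show "z \<in> {z. \<exists>s. \<forall>n. z \<in> ?E n s}" by (intro CollectI exI[of _ ?c])
  next
    fix z assume "z \<in> {z. \<exists>s. \<forall>n. z \<in> ?E n s}"
    then obtain s where "\<forall>N. z \<in> ?E N s" unfolding mem_Collect_eq ..
    then have s: "z \<in> ?E N s" for N by (rule spec)
    have "z \<in> D j n (\<lambda>i. s (prod_encode (j, i)))" for j n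
      using s[of "prod_encode (j, n)"] by simp
    then have "z \<in> S j" for j
      unfolding D(3) by (intro exI[of _ "\<lambda>i. s (prod_encode (j, i))"] allI)
    then show "z \<in> (\<Inter>j. S j)" by simp
  qed
  have "souslin_scheme M ?E (\<Inter>j. S j)" unfolding souslin_scheme_def using D(1) 2 3 by simp
  then show ?thesis by (rule souslinI)
qed

lemma souslin_Int:
  assumes "souslin M S" "souslin M S'" shows "souslin M (S \<inter> S')"
proof -
  have "souslin M (\<Inter>j::nat. if j = 0 then S else S')" using assms by (intro souslin_INT) auto
  moreover have "(\<Inter>j::nat. if j = 0 then S else S') = S \<inter> S'" by (auto split: if_splits)
  ultimately show ?thesis by simp
qed

lemma souslin_Un:
  assumes "souslin M S" "souslin M S'" "S \<subseteq> space M \<times> UNIV" "S' \<subseteq> space M \<times> UNIV"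
  shows "souslin M (S \<union> S')"
proof -
  have "souslin M (\<Union>j::nat. if j = 0 then S else S')" using assms by (intro souslin_UN) auto
  moreover have "(\<Union>j::nat. if j = 0 then S else S') = S \<union> S'" by (auto split: if_splits)
  ultimately show ?thesis by simp
qed

text \<open>
The sets that are Souslin together with their complements form a sigma-algebra. It contains
the products with a closed factor because open sets of a Euclidean space are sigma-compact.
\<close>

lemma souslin_sets_pair:
  fixes S :: "('t \<times> 'a::euclidean_space) set"
  assumes "S \<in> sets (M \<Otimes>\<^sub>M borel)"
  shows "souslin M S"
proof -
  let ?\<Omega> = "space M \<times> (UNIV :: 'a set)"
  define \<C> where "\<C> = {S. S \<subseteq> ?\<Omega> \<and> souslin M S \<and> souslin M (?\<Omega> - S)}"
  have compl: "?\<Omega> - S \<in> \<C>" if "S \<in> \<C>" for S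
    using that unfolding \<C>_def by (auto simp: double_diff)
  have un: "(\<Union>i::nat. S i) \<in> \<C>" if "\<And>i. S i \<in> \<C>" for S
  proof -
    have "?\<Omega> - (\<Union>i::nat. S i) = (\<Inter>i. ?\<Omega> - S i)" by auto
    then show ?thesis using that souslin_UN[of M S] souslin_INT[of M "\<lambda>i. ?\<Omega> - S i"]
      unfolding \<C>_def by auto
  qed
  have emp: "{} \<in> \<C>"
    using souslin_rectangle[of "{}" M UNIV] souslin_rectangle[of "space M" M UNIV]
    unfolding \<C>_def by auto
  have closed_C: "space M \<times> F \<in> \<C>" if "closed F" for F
  proof -
    obtain \<D> where \<D>: "countable \<D>" "\<And>C. C \<in> \<D> \<Longrightarrow> compact C" "\<Union>\<D> = - F"
      using open_Union_compact_subsets[of "- F"] \<open>closed F\<close> by (metis open_Compl range_subsetD countableI_type countable_image[of UNIV] UNIV_I image_iff)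
    have ins: "insert {} \<D> \<noteq> {}" "countable (insert {} \<D>)" using \<D>(1) by auto
    define C where "C = from_nat_into (insert {} \<D>)"
    have rC: "range C = insert {} \<D>" unfolding C_def using ins by (rule range_from_nat_into)
    have C: "compact (C i)" for i
      using \<D>(2) rC by (metis compact_empty insertE rangeI)
    have eq: "?\<Omega> - space M \<times> F = (\<Union>i. space M \<times> C i)"
    proof -
      have "(\<Union>i. C i) = - F" using \<D>(3) rC by simp
      then show ?thesis by blast
    qed
    have "souslin M (\<Union>i. space M \<times> C i)"
      by (intro souslin_UN souslin_rectangle) (use C in \<open>auto intro: compact_imp_closed\<close>)
    then show ?thesis unfolding \<C>_def using eq souslin_rectangle[of "space M" M F] that by auto
  qed
  have borel_C: "space M \<times> B \<in> \<C>" if "B \<in> sets borel" for B :: "'a set"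
  proof -
    have "B \<in> sigma_sets UNIV (Collect closed)"
      using that by (simp add: borel_eq_closed)
    then show ?thesis
    proof (induction rule: sigma_sets.induct)
      case (Compl a)
      have "space M \<times> (UNIV - a) = ?\<Omega> - space M \<times> a" by auto
      then show ?case using compl[OF Compl(2)] by simp
    next
      case (Union a)
      have "space M \<times> (\<Union>i. a i) = (\<Union>i. space M \<times> a i)" by auto
      then show ?case using un Union by simp
    qed (use emp closed_C in auto)
  qed
  have rect: "A \<times> B \<in> \<C>" if "A \<in> sets M" "B \<in> sets borel" for A and B :: "'a set"
  proof -
    have A: "A \<subseteq> space M" using that(1) by (rule sets.sets_into_space)
    have e1: "A \<times> B = (A \<times> UNIV) \<inter> (space M \<times> B)" using A by auto
    have e2: "?\<Omega> - A \<times> B = ((space M - A) \<times> UNIV) \<union> (?\<Omega> - space M \<times> B)" by auto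
    have "souslin M (A \<times> (UNIV::'a set))" "souslin M ((space M - A) \<times> (UNIV::'a set))"
      using that(1) by (auto intro!: souslin_rectangle)
    then show ?thesis
      using borel_C[OF that(2)] A souslin_Int[of M "A \<times> UNIV" "space M \<times> B"]
        souslin_Un[of M "(space M - A) \<times> UNIV" "?\<Omega> - space M \<times> B"]
      unfolding \<C>_def e1[symmetric] e2[symmetric] by auto
  qed
  have "S \<in> sigma_sets (space M \<times> space borel) {a \<times> b |a b. a \<in> sets M \<and> b \<in> sets (borel :: 'a measure)}"
    using assms by (simp add: sets_pair_measure)
  then have "S \<in> \<C>"
    by (induction rule: sigma_sets.induct) (use emp compl un rect in auto)
  then show ?thesis unfolding \<C>_def by blast
qed

text \<open>
The outer measure of \<open>E\<close> exceeds \<open>c\<close>.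
\<close>

definition outer_gt :: "'t measure \<Rightarrow> ennreal \<Rightarrow> 't set \<Rightarrow> bool" where
  "outer_gt M c E \<longleftrightarrow> (\<forall>A\<in>sets M. E \<subseteq> A \<longrightarrow> c < emeasure M A)"

text \<open>
Continuity of the outer measure along increasing sequences of arbitrary sets: covers \<open>A n\<close> of
\<open>E n\<close> of measure at most \<open>c\<close> can be replaced by the increasing covers \<open>\<Inter>m. A (n + m)\<close>.
\<close>

lemma outer_gt_incseq:
  assumes "incseq E" "outer_gt M c (\<Union>n. E n)"
  shows "\<exists>n. outer_gt M c (E n)"
proof (rule ccontr)
  assume "\<nexists>n. outer_gt M c (E n)"
  then have "\<forall>n. \<exists>A. A \<in> sets M \<and> E n \<subseteq> A \<and> emeasure M A \<le> c"
    unfolding outer_gt_def by (meson not_le)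
  from choice[OF this] obtain A where A: "\<forall>n. A n \<in> sets M \<and> E n \<subseteq> A n \<and> emeasure M (A n) \<le> c" ..
  define B where "B n = (\<Inter>m. A (n + m))" for n
  have B: "B n \<in> sets M" for n unfolding B_def using A by (intro sets.countable_INT) auto
  have EB: "E n \<subseteq> B n" for n
    unfolding B_def using A incseqD[OF assms(1), of n] by (meson INT_greatest le_add1 subset_trans)
  have "B n \<subseteq> B (Suc n)" for n
  proof
    fix t assume "t \<in> B n"
    then have "t \<in> A (n + Suc m)" for m unfolding B_def by blast
    then show "t \<in> B (Suc n)" unfolding B_def by simp
  qed
  then have "incseq B" by (rule incseq_SucI)
  then have "emeasure M (\<Union>n. B n) = (SUP n. emeasure M (B n))"
    using B by (intro SUP_emeasure_incseq[symmetric]) auto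
  also have "\<dots> \<le> c"
  proof (rule SUP_least)
    fix n
    have "B n \<subseteq> A n" unfolding B_def by (metis INT_lower UNIV_I add.right_neutral)
    then have "emeasure M (B n) \<le> emeasure M (A n)" using A by (intro emeasure_mono) auto
    then show "emeasure M (B n) \<le> c" using A order_trans by blast
  qed
  finally have le: "emeasure M (\<Union>n. B n) \<le> c" .
  have "(\<Union>n. B n) \<in> sets M" using B by blast
  moreover have "(\<Union>n. E n) \<subseteq> (\<Union>n. B n)" using EB by (intro UN_mono) auto
  ultimately have "c < emeasure M (\<Union>n. B n)" using assms(2) unfolding outer_gt_def by blast
  then show False using le by simp
qed

lemma compact_bounded_sequences: "compact {s :: nat \<Rightarrow> nat. \<forall>i. s i \<le> m i}"
proof -
  have "compactin (product_topology (\<lambda>i. euclidean) UNIV) (PiE UNIV (\<lambda>i::nat. {..m i}))"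
    by (subst compactin_PiE) (auto intro: finite_imp_compact)
  moreover have "PiE UNIV (\<lambda>i::nat. {..m i}) = {s. \<forall>i. s i \<le> m i}"
    by (auto simp: PiE_def)
  ultimately show ?thesis by (simp add: euclidean_product_topology)
qed

lemma closed_finitely_determined:
  fixes P :: "(nat \<Rightarrow> nat) \<Rightarrow> bool"
  assumes "\<And>s \<tau>. (\<And>i. i < n \<Longrightarrow> s i = \<tau> i) \<Longrightarrow> P s = P \<tau>"
  shows "closed {s. P s}"
proof -
  have "open {s. \<not> P s}"
  proof (subst open_subopen, intro ballI)
    fix \<tau> assume \<tau>: "\<tau> \<in> {s. \<not> P s}"
    let ?U = "\<Inter>i<n. (\<lambda>s. s i) -` {\<tau> i}"
    have "open ((\<lambda>s :: nat \<Rightarrow> nat. s i) -` {\<tau> i})" for i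
      by (rule open_vimage[OF open_discrete]) (rule continuous_on_product_coordinates)
    then have "open ?U" by (intro open_INT) auto
    moreover have "\<tau> \<in> ?U" by simp
    moreover have "?U \<subseteq> {s. \<not> P s}"
    proof
      fix s assume "s \<in> ?U"
      then have "s i = \<tau> i" if "i < n" for i using that by auto
      then have "P s = P \<tau>" by (rule assms)
      then show "s \<in> {s. \<not> P s}" using \<tau> by simp
    qed
    ultimately show "\<exists>U. open U \<and> \<tau> \<in> U \<and> U \<subseteq> {s. \<not> P s}" by blast
  qed
  then show ?thesis by (simp add: closed_def Collect_neg_eq)
qed

text \<open>
Choquet's capacitability argument for the outer measure of the projection. Bounding the entries of
the index sequence by \<open>m 0, m 1, \<dots>\<close>, one at a time, keeps the outer measure above \<open>c\<close>. The bounded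
index sequences form a compact set, so the part of \<open>S\<close> that they generate is a decreasing intersection of
finite unions of rectangles.
\<close>

lemma souslin_capacity:
  assumes "souslin M S" "outer_gt M c (fst ` S)" "S \<subseteq> space M \<times> K"
  shows "\<exists>H. (\<forall>k. H k \<in> fin_rects M) \<and> decseq H \<and> (\<Inter>k. H k) \<subseteq> S \<and>
    (\<forall>k. c \<le> emeasure M {t. \<exists>u\<in>K. (t, u) \<in> H k})"
proof -
  obtain D where "souslin_scheme M D S" using assms(1) unfolding souslin_def ..
  note D = souslin_schemeD[OF this]
  define T where "T m k = {z. \<exists>s. (\<forall>i<k. s i \<le> m i) \<and> (\<forall>n. z \<in> D n s)}" for m :: "nat \<Rightarrow> nat" and k
  \<comment> \<open>\<open>T m k\<close> is the part of \<open>S\<close> generated by sequences whose first \<open>k\<close> entries are bounded by \<open>m\<close>.\<close>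
  have T_cong: "T m k = T m' k" if "\<And>i. i < k \<Longrightarrow> m i = m' i" for m m' k
    unfolding T_def using that by simp
  have T0: "T m 0 = S" for m unfolding T_def using D(3) by auto
  have T_Suc: "T m k = (\<Union>j. T (m(k := j)) (Suc k))" for m k
    unfolding T_def by (auto simp: less_Suc_eq)
  have T_inc: "incseq (\<lambda>j. T (m(k := j)) (Suc k))" for m k
  proof (rule incseq_SucI, rule subsetI)
    fix n z assume "z \<in> T (m(k := n)) (Suc k)"
    then obtain s where s: "\<forall>i<Suc k. s i \<le> (m(k := n)) i" "\<forall>n. z \<in> D n s"
      unfolding T_def by blast
    have "s i \<le> (m(k := Suc n)) i" if "i < Suc k" for i
      using s(1)[rule_format, OF that] by (cases "i = k") simp_all
    then show "z \<in> T (m(k := Suc n)) (Suc k)" using s(2) unfolding T_def by blast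
  qed
  have "\<exists>M'. \<forall>k. outer_gt M c (fst ` T (M' k) k) \<and> (\<forall>i<k. M' (Suc k) i = M' k i)"
  proof (rule dependent_nat_choice)
    show "\<exists>m. outer_gt M c (fst ` T m 0)" using assms(2) T0 by simp
  next
    fix m k assume m: "outer_gt M c (fst ` T m k)"
    have un: "fst ` T m k = (\<Union>j. fst ` T (m(k := j)) (Suc k))" by (subst T_Suc) (rule image_UN)
    have inc: "incseq (\<lambda>j. fst ` T (m(k := j)) (Suc k))"
      using T_inc[of m k] unfolding incseq_def by (simp add: image_mono)
    from outer_gt_incseq[OF inc m[unfolded un]]
    obtain j where "outer_gt M c (fst ` T (m(k := j)) (Suc k))" ..
    then show "\<exists>m'. outer_gt M c (fst ` T m' (Suc k)) \<and> (\<forall>i<k. m' i = m i)"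
      by (intro exI[of _ "m(k := j)"]) simp
  qed
  then obtain M' where M': "\<And>k. outer_gt M c (fst ` T (M' k) k)" "\<And>k i. i < k \<Longrightarrow> M' (Suc k) i = M' k i"
    by blast
  define m where "m i = M' (Suc i) i" for i
  have "M' k i = m i" if "i < k" for i k
    using that unfolding m_def
  proof (induction k)
    case (Suc k)
    then show ?case using M'(2)[of i k] by (cases "i = k") auto
  qed simp
  then have m: "outer_gt M c (fst ` T m k)" for k
    using M'(1)[of k] T_cong[of k "M' k" m] by simp
  define H where "H k = (\<Union>s\<in>PiE {..<k} (\<lambda>i. {..m i}). \<Inter>n\<le>k. D n s)" for k
  have H_rect: "H k \<in> fin_rects M" for k
    unfolding H_def by (intro fin_rects_UN fin_rects_INT_atMost D(1) finite_PiE) auto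
  have restr: "D n (restrict s {..<k}) = D n s" if "n \<le> k" for n k s
    using that by (intro D(2)) simp
  have HI: "z \<in> H k" if "\<And>i. i < k \<Longrightarrow> s i \<le> m i" "\<And>n. n \<le> k \<Longrightarrow> z \<in> D n s" for z k s
  proof -
    have "restrict s {..<k} \<in> PiE {..<k} (\<lambda>i. {..m i})" using that(1) by auto
    moreover have "z \<in> (\<Inter>n\<le>k. D n (restrict s {..<k}))" using that(2) restr by simp
    ultimately show ?thesis unfolding H_def by (rule UN_I[of "restrict s {..<k}"])
  qed
  have HD: "\<exists>s. (\<forall>i. s i \<le> m i) \<and> (\<forall>n\<le>k. z \<in> D n s)" if z: "z \<in> H k" for z k
  proof -
    from z obtain s where s: "s \<in> PiE {..<k} (\<lambda>i. {..m i})" "z \<in> (\<Inter>n\<le>k. D n s)"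
      unfolding H_def by blast
    let ?\<tau> = "\<lambda>i. if i < k then s i else 0"
    have "D n ?\<tau> = D n s" if "n \<le> k" for n using that by (intro D(2)) simp
    then have "\<forall>n\<le>k. z \<in> D n ?\<tau>" using s(2) by simp
    moreover have "\<forall>i. ?\<tau> i \<le> m i" using s(1) by (auto simp: PiE_def Pi_def)
    ultimately show ?thesis by (intro exI[of _ ?\<tau>] conjI)
  qed
  have H_dec: "decseq H"
  proof (rule decseq_SucI, rule subsetI)
    fix k z assume "z \<in> H (Suc k)"
    from HD[OF this] obtain s where "\<forall>i. s i \<le> m i" "\<forall>n\<le>Suc k. z \<in> D n s" by blast
    then show "z \<in> H k" by (intro HI[of k s]) auto
  qed
  \<comment> \<open>Koenig's lemma, in the form of compactness of the set of index sequences below \<open>m\<close>.\<close>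
  have H_S: "(\<Inter>k. H k) \<subseteq> S"
  proof
    fix z assume z: "z \<in> (\<Inter>k. H k)"
    let ?B = "{s. \<forall>i. s i \<le> m i}"
    have "?B \<inter> (\<Inter>n\<in>UNIV. {s. z \<in> D n s}) \<noteq> {}"
    proof (rule compact_imp_fip_image[OF compact_bounded_sequences])
      fix n show "closed {s. z \<in> D n s}"
        by (rule closed_finitely_determined[of n]) (use D(2) in metis)
    next
      fix I' :: "nat set" assume "finite I'"
      then obtain k where k: "\<forall>n\<in>I'. n \<le> k" using finite_nat_set_iff_bounded_le by blast
      obtain s where "\<forall>i. s i \<le> m i" "\<forall>n\<le>k. z \<in> D n s" using HD[of z k] z by blast
      then have "s \<in> ?B \<inter> (\<Inter>n\<in>I'. {s. z \<in> D n s})" using k by blast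
      then show "?B \<inter> (\<Inter>n\<in>I'. {s. z \<in> D n s}) \<noteq> {}" by blast
    qed
    then obtain s where "s \<in> ?B \<inter> (\<Inter>n\<in>UNIV. {s. z \<in> D n s})" by (meson ex_in_conv)
    then have "\<forall>n. z \<in> D n s" by simp
    then show "z \<in> S" unfolding D(3) by (rule exI[of _ s])
  qed
  have "c \<le> emeasure M {t. \<exists>u\<in>K. (t, u) \<in> H k}" for k
  proof -
    have "fst ` T m k \<subseteq> {t. \<exists>u\<in>K. (t, u) \<in> H k}"
    proof
      fix t assume "t \<in> fst ` T m k"
      then obtain u where tu: "(t, u) \<in> T m k" by force
      then obtain s where s: "\<forall>i<k. s i \<le> m i" "\<forall>n. (t, u) \<in> D n s" unfolding T_def by blast
      have "(t, u) \<in> S" unfolding D(3) using s(2) by (rule exI[of _ s])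
      then have "u \<in> K" using assms(3) by blast
      moreover have "(t, u) \<in> H k" using s by (intro HI[of k s]) auto
      ultimately show "t \<in> {t. \<exists>u\<in>K. (t, u) \<in> H k}" by auto
    qed
    then have "c < emeasure M {t. \<exists>u\<in>K. (t, u) \<in> H k}"
      by (rule m[unfolded outer_gt_def, rule_format, OF fin_rects_proj[OF H_rect]])
    then show ?thesis by (rule less_imp_le)
  qed
  then show ?thesis using H_rect H_dec H_S by (intro exI[of _ H] conjI allI)
qed

text \<open>
The usual notion for set-valued maps. A compact-valued map is selected from by repeatedly
passing to the minimisers of continuous functions, which preserves it.
\<close>

definition weakly_measurable :: "'t measure \<Rightarrow> ('t \<Rightarrow> 'a::topological_space set) \<Rightarrow> bool" where
  "weakly_measurable M S \<longleftrightarrow> (\<forall>F. closed F \<longrightarrow> {t \<in> space M. S t \<inter> F \<noteq> {}} \<in> sets M)"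

lemma weakly_measurable_minimizers:
  fixes l :: "'a::t2_space \<Rightarrow> real"
  assumes "\<And>t. compact (S t)" "weakly_measurable M S" "continuous_on UNIV l"
  defines "S' \<equiv> \<lambda>t. {u \<in> S t. \<forall>v\<in>S t. l u \<le> l v}"
  shows "compact (S' t)" "S t \<noteq> {} \<Longrightarrow> S' t \<noteq> {}" "weakly_measurable M S'"
proof -
  have cl: "closed {u. l u \<le> c}" for c
    using continuous_closed_vimage[of "{..c}" l] assms(3)
    by (auto simp: vimage_def continuous_on_eq_continuous_at)
  have "S' t = S t \<inter> (\<Inter>v\<in>S t. {u. l u \<le> l v})" unfolding S'_def by blast
  then show "compact (S' t)" using assms(1)[of t] cl
    by (auto intro!: compact_Int_closed closed_INT)
  show "S' t \<noteq> {}" if "S t \<noteq> {}"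
    using continuous_attains_inf[OF assms(1) that, of l] continuous_on_subset[OF assms(3)]
    unfolding S'_def by blast
  show "weakly_measurable M S'"
    unfolding weakly_measurable_def
  proof (intro allI impI)
    fix F :: "'a set" assume F: "closed F"
    define W where "W F = {t \<in> space M. S t \<inter> F \<noteq> {}}" for F
    have W: "W F \<in> sets M" if "closed F" for F
      using assms(2) that unfolding weakly_measurable_def W_def by blast
    \<comment> \<open>The minimum over \<open>S t \<inter> F\<close> exceeds the one over \<open>S t\<close> iff a rational number separates them.\<close>
    have "{t \<in> space M. S' t \<inter> F \<noteq> {}} = W F - (\<Union>c\<in>\<rat>. W {u. l u \<le> c} - W (F \<inter> {u. l u \<le> c}))"
    proof (intro equalityI subsetI)
      fix t assume "t \<in> {t \<in> space M. S' t \<inter> F \<noteq> {}}"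
      then obtain u where u: "t \<in> space M" "u \<in> S t" "u \<in> F" "\<And>v. v \<in> S t \<Longrightarrow> l u \<le> l v"
        unfolding S'_def by blast
      have "t \<in> W (F \<inter> {u. l u \<le> c})" if t: "t \<in> W {u. l u \<le> c}" for c
      proof -
        obtain v where "v \<in> S t" "l v \<le> c" using t unfolding W_def by blast
        then have "l u \<le> c" using u(4)[of v] by simp
        then show ?thesis using u(1-3) unfolding W_def by blast
      qed
      then show "t \<in> W F - (\<Union>c\<in>\<rat>. W {u. l u \<le> c} - W (F \<inter> {u. l u \<le> c}))"
        using u unfolding W_def by blast
    next
      fix t assume t: "t \<in> W F - (\<Union>c\<in>\<rat>. W {u. l u \<le> c} - W (F \<inter> {u. l u \<le> c}))"
      have "S t \<inter> F \<noteq> {}" "t \<in> space M" using t unfolding W_def by blast+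
      moreover have "compact (S t \<inter> F)" using assms(1) F by (rule compact_Int_closed)
      ultimately obtain u where u: "u \<in> S t \<inter> F" "\<And>v. v \<in> S t \<inter> F \<Longrightarrow> l u \<le> l v"
        using continuous_attains_inf[of "S t \<inter> F" l] continuous_on_subset[OF assms(3)] by blast
      have "l u \<le> l v" if v: "v \<in> S t" for v
      proof (rule ccontr)
        assume "\<not> l u \<le> l v"
        then obtain c where c: "c \<in> \<rat>" "l v < c" "c < l u" using Rats_dense_in_real[of "l v" "l u"] by auto
        have "t \<in> W {u. l u \<le> c}" using v c(2) \<open>t \<in> space M\<close> unfolding W_def by force
        then have "t \<in> W (F \<inter> {u. l u \<le> c})" using t c(1) by blast
        then obtain w where "w \<in> S t \<inter> F" "l w \<le> c" unfolding W_def by blast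
        then show False using u(2)[of w] c(3) by simp
      qed
      then have "u \<in> S' t" using u(1) unfolding S'_def by blast
      then show "t \<in> {t \<in> space M. S' t \<inter> F \<noteq> {}}" using u(1) \<open>t \<in> space M\<close> by blast
    qed
    also have "\<dots> \<in> sets M"
      using F cl by (intro sets.Diff W sets.countable_UN''[OF countable_rat] closed_Int)
    finally show "{t \<in> space M. S' t \<inter> F \<noteq> {}} \<in> sets M" .
  qed
qed

text \<open>
The lexicographically smallest point: minimising all coordinates in turn leaves a single point.
\<close>

lemma weakly_measurable_selection:
  fixes S :: "'t \<Rightarrow> 'a::euclidean_space set"
  assumes "\<And>t. compact (S t)" "weakly_measurable M S"
  shows "\<exists>u\<in>borel_measurable M. \<forall>t\<in>space M. S t \<noteq> {} \<longrightarrow> u t \<in> S t"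
proof -
  define narrowed where "narrowed B S' \<longleftrightarrow>
      (\<forall>t. compact (S' t)) \<and> (\<forall>t. S' t \<subseteq> S t) \<and> (\<forall>t. S t \<noteq> {} \<longrightarrow> S' t \<noteq> {}) \<and> weakly_measurable M S' \<and>
      (\<forall>t. \<forall>u\<in>S' t. \<forall>v\<in>S' t. \<forall>b\<in>B. u \<bullet> b = v \<bullet> b)" for B S'
  have "\<exists>S'. narrowed B S'" if "finite B" for B
    using that
  proof (induction B)
    case empty
    have "narrowed {} S" unfolding narrowed_def using assms by simp
    then show ?case by (rule exI[of _ S])
  next
    case (insert b B)
    from insert.IH obtain S' where "narrowed B S'" ..
    then have S': "\<And>t. compact (S' t)" "\<And>t. S' t \<subseteq> S t" "\<And>t. S t \<noteq> {} \<Longrightarrow> S' t \<noteq> {}"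
      "weakly_measurable M S'" "\<And>t u v b. u \<in> S' t \<Longrightarrow> v \<in> S' t \<Longrightarrow> b \<in> B \<Longrightarrow> u \<bullet> b = v \<bullet> b"
      unfolding narrowed_def by blast+
    define S'' where "S'' t = {u \<in> S' t. \<forall>v\<in>S' t. u \<bullet> b \<le> v \<bullet> b}" for t
    have "continuous_on UNIV (\<lambda>u. u \<bullet> b)" by (intro continuous_intros)
    note min = weakly_measurable_minimizers[OF S'(1,4) this, folded S''_def]
    have sub: "S'' t \<subseteq> S' t" for t unfolding S''_def by blast
    have "u \<bullet> b' = v \<bullet> b'" if "u \<in> S'' t" "v \<in> S'' t" "b' \<in> insert b B" for t u v b'
    proof (cases "b' = b")
      case True
      have "u \<bullet> b \<le> v \<bullet> b" "v \<bullet> b \<le> u \<bullet> b" using that(1,2) unfolding S''_def by blast+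
      then show ?thesis using True by simp
    next
      case False
      then show ?thesis using S'(5)[of u t v b'] sub that by blast
    qed
    moreover have "S'' t \<subseteq> S t" for t using sub S'(2) by (rule subset_trans)
    moreover have "S'' t \<noteq> {}" if "S t \<noteq> {}" for t using S'(3)[OF that] by (rule min(2))
    ultimately have "narrowed (insert b B) S''" unfolding narrowed_def using min(1,3) by blast
    then show ?case by (rule exI[of _ S''])
  qed
  from this[OF finite_Basis] obtain S' where "narrowed Basis S'" ..
  then have S': "\<And>t. compact (S' t)" "\<And>t. S' t \<subseteq> S t" "\<And>t. S t \<noteq> {} \<Longrightarrow> S' t \<noteq> {}"
      "weakly_measurable M S'" "\<And>t u v b. u \<in> S' t \<Longrightarrow> v \<in> S' t \<Longrightarrow> b \<in> Basis \<Longrightarrow> u \<bullet> b = v \<bullet> b"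
    unfolding narrowed_def by blast+
  have uniq: "u = v" if "u \<in> S' t" "v \<in> S' t" for t u v
    by (rule euclidean_eqI) (rule S'(5)[OF that])
  define u where "u t = (if S' t \<noteq> {} then SOME v. v \<in> S' t else 0)" for t
  have u: "u t \<in> S' t" if "S' t \<noteq> {}" for t
    using that unfolding u_def by (simp add: some_in_eq)
  have "u \<in> borel_measurable M"
  proof (rule borel_measurableI)
    fix U :: "'a set" assume U: "open U"
    define W where "W F = {t \<in> space M. S' t \<inter> F \<noteq> {}}" for F
    have W: "W F \<in> sets M" if "closed F" for F
      using S'(4) that unfolding weakly_measurable_def W_def by blast
    have "u -` U \<inter> space M = (W UNIV - W (- U)) \<union> (if 0 \<in> U then space M - W UNIV else {})"
    proof (intro set_eqI)
      fix t
      show "t \<in> u -` U \<inter> space M \<longleftrightarrow> t \<in> (W UNIV - W (- U)) \<union> (if 0 \<in> U then space M - W UNIV else {})"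
      proof (cases "S' t = {}")
        case True
        then show ?thesis unfolding W_def u_def by simp
      next
        case False
        then have "S' t = {u t}" using u[OF False] uniq by blast
        then show ?thesis unfolding W_def by auto
      qed
    qed
    also have "\<dots> \<in> sets M" using W[of UNIV] W[of "- U"] U by auto
    finally show "u -` U \<inter> space M \<in> sets M" .
  qed
  moreover have "\<forall>t\<in>space M. S t \<noteq> {} \<longrightarrow> u t \<in> S t" using u S'(2,3) by blast
  ultimately show ?thesis by blast
qed

text \<open>
A weak form of the measurable selection theorem of Aumann. If the projection of \<open>S\<close> is not negligible, a
subset of \<open>S\<close> with compact sections still has a projection of positive measure, and a measurable
selection of it is a measurable partial section of \<open>S\<close>.
\<close>

lemma AE_no_section_if_no_selection:
  fixes S :: "('t \<times> 'a::euclidean_space) set"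
  assumes "finite_measure M" "S \<in> sets (M \<Otimes>\<^sub>M borel)" "S \<subseteq> space M \<times> K" "compact K"
    and no_sel: "\<And>A u. A \<in> sets M \<Longrightarrow> u \<in> borel_measurable M \<Longrightarrow> (\<And>t. t \<in> A \<Longrightarrow> (t, u t) \<in> S) \<Longrightarrow> emeasure M A = 0"
  shows "AE t in M. \<forall>u. (t, u) \<notin> S"
proof -
  interpret finite_measure M by fact
  have not_big: "\<not> outer_gt M c (fst ` S)" if c: "c > 0" for c
  proof
    assume "outer_gt M c (fst ` S)"
    from souslin_capacity[OF souslin_sets_pair[OF assms(2)] this assms(3)]
    obtain H where H: "\<And>k. H k \<in> fin_rects M" "decseq H" "(\<Inter>k. H k) \<subseteq> S"
      "\<And>k. c \<le> emeasure M {t. \<exists>u\<in>K. (t, u) \<in> H k}" by blast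
    define S' where "S' t = K \<inter> (\<Inter>k. {u. (t, u) \<in> H k})" for t
    have comp: "compact (S' t)" for t
      unfolding S'_def using assms(4) fin_rects_section_closed[OF H(1)]
      by (intro compact_Int_closed closed_INT) auto
    have meet: "{t. S' t \<inter> F \<noteq> {}} = (\<Inter>k. {t. \<exists>u\<in>K \<inter> F. (t, u) \<in> H k})" if F: "closed F" for F
    proof (intro equalityI subsetI)
      fix t assume t: "t \<in> (\<Inter>k. {t. \<exists>u\<in>K \<inter> F. (t, u) \<in> H k})"
      have "(K \<inter> F) \<inter> (\<Inter>k\<in>UNIV. {u. (t, u) \<in> H k}) \<noteq> {}"
      proof (rule compact_imp_fip_image)
        show "compact (K \<inter> F)" using assms(4) F by (rule compact_Int_closed)
        show "closed {u. (t, u) \<in> H k}" for k by (rule fin_rects_section_closed[OF H(1)])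
        fix I' :: "nat set" assume "finite I'"
        then obtain k where k: "\<forall>n\<in>I'. n \<le> k" using finite_nat_set_iff_bounded_le by blast
        obtain u where u: "u \<in> K \<inter> F" "(t, u) \<in> H k" using t by blast
        have "u \<in> (\<Inter>n\<in>I'. {u. (t, u) \<in> H n})"
          using u(2) k decseqD[OF H(2)] by blast
        then show "K \<inter> F \<inter> (\<Inter>n\<in>I'. {u. (t, u) \<in> H n}) \<noteq> {}" using u(1) by blast
      qed
      then show "t \<in> {t. S' t \<inter> F \<noteq> {}}" unfolding S'_def by blast
    qed (auto simp: S'_def)
    have meas: "{t. S' t \<inter> F \<noteq> {}} \<in> sets M" if F: "closed F" for F
      unfolding meet[OF F] using fin_rects_proj[OF H(1)] by (intro sets.countable_INT) auto
    have sp: "{t. S' t \<inter> F \<noteq> {}} \<subseteq> space M" if F: "closed F" for F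
      using meas[OF F] by (rule sets.sets_into_space)
    have "{t \<in> space M. S' t \<inter> F \<noteq> {}} = {t. S' t \<inter> F \<noteq> {}}" if "closed F" for F
      using sp[OF that] by blast
    then have "weakly_measurable M S'" unfolding weakly_measurable_def using meas by simp
    from weakly_measurable_selection[OF comp this]
    obtain u where u: "u \<in> borel_measurable M" "\<And>t. t \<in> space M \<Longrightarrow> S' t \<noteq> {} \<Longrightarrow> u t \<in> S' t"
      by blast
    define A where "A = {t. S' t \<noteq> {}}"
    have A: "A \<in> sets M" "A \<subseteq> space M" using meas[of UNIV] sp[of UNIV] unfolding A_def by auto
    have "emeasure M A = 0"
    proof (rule no_sel[OF A(1) u(1)])
      fix t assume t: "t \<in> A"
      then have "u t \<in> S' t" using u(2)[of t] A(2) unfolding A_def by blast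
      then have "(t, u t) \<in> (\<Inter>k. H k)" unfolding S'_def by blast
      then show "(t, u t) \<in> S" using H(3) by blast
    qed
    moreover have "c \<le> emeasure M A"
    proof -
      have eq: "A = (\<Inter>k. {t. \<exists>u\<in>K. (t, u) \<in> H k})" using meet[of UNIV] unfolding A_def by simp
      have "(INF k. emeasure M {t. \<exists>u\<in>K. (t, u) \<in> H k}) = emeasure M A"
        unfolding eq
      proof (rule INF_emeasure_decseq)
        show "range (\<lambda>k. {t. \<exists>u\<in>K. (t, u) \<in> H k}) \<subseteq> sets M" using fin_rects_proj[OF H(1)] by auto
        show "decseq (\<lambda>k. {t. \<exists>u\<in>K. (t, u) \<in> H k})"
          using decseqD[OF H(2)] unfolding decseq_def by blast
      qed simp
      moreover have "c \<le> (INF k. emeasure M {t. \<exists>u\<in>K. (t, u) \<in> H k})"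
        by (intro INF_greatest H(4))
      ultimately show ?thesis by simp
    qed
    ultimately show False using c by simp
  qed
  have "\<forall>j. \<exists>A. A \<in> sets M \<and> fst ` S \<subseteq> A \<and> emeasure M A \<le> ennreal (1 / Suc j)"
    using not_big[of "ennreal (1 / Suc j)" for j] unfolding outer_gt_def
    by (metis ennreal_less_zero_iff not_le zero_less_divide_1_iff of_nat_0_less_iff zero_less_Suc)
  from choice[OF this] obtain A where A: "\<forall>j. A j \<in> sets M \<and> fst ` S \<subseteq> A j \<and> emeasure M (A j) \<le> ennreal (1 / Suc j)" ..
  let ?N = "\<Inter>j. A j"
  have N: "?N \<in> sets M" using A by (intro sets.countable_INT) auto
  have "emeasure M ?N \<le> ennreal (1 / Suc j)" for j
  proof -
    have "emeasure M ?N \<le> emeasure M (A j)" using A by (intro emeasure_mono) auto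
    then show ?thesis using A order_trans by blast
  qed
  moreover have "(\<lambda>j. ennreal (1 / Suc j)) \<longlonglongrightarrow> ennreal 0"
    by (intro tendsto_ennrealI LIMSEQ_Suc lim_1_over_n)
  ultimately have "emeasure M ?N \<le> ennreal 0"
    by (intro LIMSEQ_le_const[of "\<lambda>j. ennreal (1 / Suc j)"]) auto
  then have "?N \<in> null_sets M" using N by (intro null_setsI) auto
  moreover have "{t \<in> space M. \<not> (\<forall>u. (t, u) \<notin> S)} \<subseteq> fst ` S" by force
  then have "{t \<in> space M. \<not> (\<forall>u. (t, u) \<notin> S)} \<subseteq> ?N" using A by blast
  ultimately show ?thesis by (rule AE_I')
qed

section \<open>A smooth variational principle\<close>

lemma liminf_add_ennreal_le:
  fixes a b :: "nat \<Rightarrow> ennreal"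
  shows "liminf a + liminf b \<le> liminf (\<lambda>n. a n + b n)"
proof -
  have inc: "incseq (\<lambda>n. INF m\<in>{n..}. c m)" for c :: "nat \<Rightarrow> ennreal"
    unfolding incseq_def by (auto intro!: INF_superset_mono)
  have "liminf a + liminf b = (SUP n. (INF m\<in>{n..}. a m) + (INF m\<in>{n..}. b m))"
    unfolding liminf_SUP_INF by (rule ennreal_SUP_add[symmetric]) (rule inc)+
  also have "\<dots> \<le> (SUP n. INF m\<in>{n..}. a m + b m)"
    by (intro SUP_mono' INF_greatest add_mono INF_lower) auto
  finally show ?thesis unfolding liminf_SUP_INF .
qed

lemma liminf_mult_ennreal_le:
  fixes a :: "nat \<Rightarrow> ennreal"
  shows "c * liminf a \<le> liminf (\<lambda>n. c * a n)"
proof -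
  have "c * liminf a = (SUP n. c * (INF m\<in>{n..}. a m))"
    unfolding liminf_SUP_INF by (rule SUP_mult_left_ennreal)
  also have "\<dots> \<le> (SUP n. INF m\<in>{n..}. c * a m)"
    by (intro SUP_mono' INF_greatest mult_left_mono INF_lower) auto
  finally show ?thesis unfolding liminf_SUP_INF .
qed

lemma liminf_weighted_sum_ennreal_le:
  fixes a :: "nat \<Rightarrow> ennreal" and b :: "nat \<Rightarrow> nat \<Rightarrow> ennreal"
  shows "liminf a + (\<Sum>i<N. c i * liminf (b i)) \<le> liminf (\<lambda>n. a n + (\<Sum>i<N. c i * b i n))"
proof (induction N)
  case (Suc N)
  have "liminf a + (\<Sum>i<Suc N. c i * liminf (b i))
      = (liminf a + (\<Sum>i<N. c i * liminf (b i))) + c N * liminf (b N)"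
    by (simp add: add.assoc)
  also have "\<dots> \<le> liminf (\<lambda>n. a n + (\<Sum>i<N. c i * b i n)) + liminf (\<lambda>n. c N * b N n)"
    by (intro add_mono Suc liminf_mult_ennreal_le)
  also have "\<dots> \<le> liminf (\<lambda>n. (a n + (\<Sum>i<N. c i * b i n)) + c N * b N n)"
    by (rule liminf_add_ennreal_le)
  finally show ?case by (simp add: add.assoc)
qed simp

text \<open>
Each step adds a multiple of the gauge centred at the current point \<open>Z n\<close> and moves to a point that is
almost optimal for the new function and not worse than \<open>Z n\<close>. The values \<open>g n (Z n)\<close> decrease, whereas \<open>Z n\<close> is
\<open>\<eta> n\<close>-optimal for \<open>g n\<close>; therefore \<open>\<delta> n * H (Z m) (Z n) \<le> \<eta> n\<close> for all later points. The assumption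
\<open>complete\<close> combines completeness with lower semicontinuity along such sequences.
\<close>

lemma variational_principle:
  fixes G :: "'z \<Rightarrow> ennreal" and H :: "'z \<Rightarrow> 'z \<Rightarrow> ennreal" and \<delta> \<eta> :: "nat \<Rightarrow> real"
  assumes z0: "z0 \<in> D" "\<And>u. u \<in> D \<Longrightarrow> G z0 \<le> G u + ennreal (\<eta> 0)" "G z0 < \<infinity>"
    and \<eta>: "\<And>n. 0 < \<eta> n" "\<eta> \<longlonglongrightarrow> 0"
    and H_refl: "\<And>z. z \<in> D \<Longrightarrow> H z z = 0"
    and complete: "\<And>Z. (\<And>n. Z n \<in> D) \<Longrightarrow>
        (\<And>m n. n \<le> m \<Longrightarrow> ennreal (\<delta> n) * H (Z m) (Z n) \<le> ennreal (\<eta> n)) \<Longrightarrow>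
        \<exists>z\<in>D. G z \<le> liminf (\<lambda>n. G (Z n)) \<and> (\<forall>i. H z (Z i) \<le> liminf (\<lambda>n. H (Z n) (Z i)))"
  obtains Z z where "\<And>n. Z n \<in> D" "z \<in> D"
    "G z + (\<Sum>n. ennreal (\<delta> n) * H z (Z n)) \<le> G z0" "ennreal (\<delta> 0) * H z z0 \<le> ennreal (\<eta> 0)"
    "\<And>u. u \<in> D \<Longrightarrow> G z + (\<Sum>n. ennreal (\<delta> n) * H z (Z n)) \<le> G u + (\<Sum>n. ennreal (\<delta> n) * H u (Z n))"
proof -
  \<comment> \<open>A state consists of the current function and the current point.\<close>
  define P where "P n s \<longleftrightarrow> snd s \<in> D \<and> (\<forall>u\<in>D. fst s (snd s) \<le> fst s u + ennreal (\<eta> n)) \<and>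
     fst s (snd s) < \<infinity> \<and> (n = 0 \<longrightarrow> s = (G, z0))" for n :: nat and s :: "('z \<Rightarrow> ennreal) \<times> 'z"
  define Q where "Q n s s' \<longleftrightarrow> fst s' = (\<lambda>u. fst s u + ennreal (\<delta> n) * H u (snd s)) \<and>
     fst s' (snd s') \<le> fst s (snd s)" for n :: nat and s s' :: "('z \<Rightarrow> ennreal) \<times> 'z"
  have "\<exists>f. \<forall>n. P n (f n) \<and> Q n (f n) (f (Suc n))"
  proof (rule dependent_nat_choice)
    show "\<exists>s. P 0 s" unfolding P_def using z0 by (intro exI[of _ "(G, z0)"]) simp
  next
    fix s n assume s: "P n s"
    define g where "g = (\<lambda>u. fst s u + ennreal (\<delta> n) * H u (snd s))"
    have gz: "g (snd s) = fst s (snd s)" unfolding g_def using s H_refl unfolding P_def by simp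
    have "(INF u\<in>D. g u) \<le> g (snd s)" using s unfolding P_def by (intro INF_lower) simp
    also have "\<dots> < \<infinity>" using gz s unfolding P_def by simp
    finally have fin: "(INF u\<in>D. g u) < top" unfolding infinity_ennreal_def .
    have "(INF u\<in>D. g u) < (INF u\<in>D. g u) + ennreal (\<eta> (Suc n))"
      using \<eta>(1)[of "Suc n"] ennreal_add_left_cancel_less[of "INF u\<in>D. g u" 0 "ennreal (\<eta> (Suc n))"]
        less_imp_neq[OF fin] by (simp only: add_0_right ennreal_less_zero_iff) simp
    then obtain u0 where u0: "u0 \<in> D" "g u0 < (INF u\<in>D. g u) + ennreal (\<eta> (Suc n))"
      unfolding INF_less_iff by blast
    define z' where "z' = (if g u0 \<le> g (snd s) then u0 else snd s)"
    have z': "z' \<in> D" "g z' \<le> g u0" "g z' \<le> g (snd s)"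
      unfolding z'_def using u0(1) s unfolding P_def by auto
    have "g z' \<le> g u + ennreal (\<eta> (Suc n))" if "u \<in> D" for u
    proof -
      have "g z' \<le> (INF u\<in>D. g u) + ennreal (\<eta> (Suc n))" using z'(2) u0(2) by simp
      also have "\<dots> \<le> g u + ennreal (\<eta> (Suc n))" by (intro add_mono INF_lower that order_refl)
      finally show ?thesis .
    qed
    moreover have "g z' < \<infinity>" using z'(3) gz s unfolding P_def by (auto intro: le_less_trans)
    ultimately have "P (Suc n) (g, z') \<and> Q n s (g, z')"
      unfolding P_def Q_def fst_conv snd_conv using z'(1) z'(3)[unfolded gz] g_def by blast
    then show "\<exists>s'. P (Suc n) s' \<and> Q n s s'" by (rule exI[of _ "(g, z')"])
  qed
  then obtain f where f: "\<And>n. P n (f n)" "\<And>n. Q n (f n) (f (Suc n))" by blast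
  define Z where "Z n = snd (f n)" for n
  define g where "g N u = G u + (\<Sum>i<N. ennreal (\<delta> i) * H u (Z i))" for N u
  have fg: "fst (f n) = g n" for n
  proof (induction n)
    case 0 show ?case using f(1)[of 0] unfolding P_def g_def by simp
  next
    case (Suc n)
    then show ?case using f(2)[of n] unfolding Q_def g_def Z_def by (simp add: fun_eq_iff add.assoc)
  qed
  have Z_D: "Z n \<in> D" and near: "\<And>u. u \<in> D \<Longrightarrow> g n (Z n) \<le> g n u + ennreal (\<eta> n)"
    and fin: "g n (Z n) < \<infinity>" and dec: "g (Suc n) (Z (Suc n)) \<le> g n (Z n)" for n
    using f(1)[of n] f(2)[of n] unfolding P_def Q_def fg[symmetric] Z_def by blast+
  have Z0: "Z 0 = z0" using f(1)[of 0] unfolding P_def Z_def by simp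
  have val: "g m (Z m) \<le> g n (Z n)" if "n \<le> m" for m n
    using decseqD[OF decseq_SucI[of "\<lambda>n. g n (Z n)", OF dec] that] .
  have g_mono: "g N u \<le> g N' u" if "N \<le> N'" for N N' u
    unfolding g_def using that by (intro add_left_mono sum_mono2) auto
  have cauchy: "ennreal (\<delta> n) * H (Z m) (Z n) \<le> ennreal (\<eta> n)" if "n \<le> m" for m n
  proof (cases "n = m")
    case True then show ?thesis using H_refl[OF Z_D] by simp
  next
    case False
    then have nm: "Suc n \<le> m" using that by simp
    have "g n (Z m) + ennreal (\<delta> n) * H (Z m) (Z n) = g (Suc n) (Z m)"
      unfolding g_def by (simp add: add.assoc)
    also have "\<dots> \<le> g m (Z m)" by (rule g_mono[OF nm])
    also have "\<dots> \<le> g n (Z n)" by (rule val[OF that])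
    also have "\<dots> \<le> g n (Z m) + ennreal (\<eta> n)" by (rule near[OF Z_D])
    finally have le: "g n (Z m) + ennreal (\<delta> n) * H (Z m) (Z n) \<le> g n (Z m) + ennreal (\<eta> n)" .
    have "g n (Z m) < \<infinity>"
      using g_mono[OF that, of "Z m"] fin[of m] by (rule le_less_trans)
    then show ?thesis using le by (auto simp: ennreal_add_left_cancel_le)
  qed
  obtain z where z: "z \<in> D" "G z \<le> liminf (\<lambda>n. G (Z n))" "\<And>i. H z (Z i) \<le> liminf (\<lambda>n. H (Z n) (Z i))"
    using complete[OF Z_D cauchy] by blast
  have gz: "g N z \<le> g n (Z n)" for N n
  proof -
    have "g N z \<le> liminf (\<lambda>m. G (Z m)) + (\<Sum>i<N. ennreal (\<delta> i) * liminf (\<lambda>m. H (Z m) (Z i)))"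
      unfolding g_def by (intro add_mono sum_mono mult_left_mono z) auto
    also have "\<dots> \<le> liminf (\<lambda>m. g N (Z m))"
      unfolding g_def by (rule liminf_weighted_sum_ennreal_le)
    also have "\<dots> \<le> liminf (\<lambda>m. g n (Z n))"
    proof (rule Liminf_mono)
      show "\<forall>\<^sub>F m in sequentially. g N (Z m) \<le> g n (Z n)"
        using eventually_ge_at_top[of "max N n"]
      proof eventually_elim
        case (elim m)
        then show ?case using g_mono[of N m "Z m"] val[of n m] by simp
      qed
    qed
    also have "\<dots> = g n (Z n)" by (simp add: Liminf_const)
    finally show ?thesis .
  qed
  define ginf where "ginf u = G u + (\<Sum>n. ennreal (\<delta> n) * H u (Z n))" for u
  have ginf: "ginf u = (SUP N. g N u)" for u
    unfolding ginf_def g_def suminf_eq_SUP by (subst ennreal_SUP_add_right) auto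
  have ginf_z: "ginf z \<le> g n (Z n)" for n unfolding ginf by (intro SUP_least gz)
  have min: "ginf z \<le> ginf u" if u: "u \<in> D" for u
  proof -
    have "ginf z \<le> ginf u + ennreal (\<eta> n)" for n
    proof -
      have "ginf z \<le> g n u + ennreal (\<eta> n)" using ginf_z near[OF u] order_trans by blast
      also have "\<dots> \<le> ginf u + ennreal (\<eta> n)" unfolding ginf by (intro add_mono SUP_upper) auto
      finally show ?thesis .
    qed
    moreover have "(\<lambda>n. ginf u + ennreal (\<eta> n)) \<longlonglongrightarrow> ginf u + ennreal 0"
      by (intro tendsto_add tendsto_ennrealI \<eta>(2) tendsto_const)
    ultimately have "ginf z \<le> ginf u + ennreal 0"
      by (intro LIMSEQ_le_const[of "\<lambda>n. ginf u + ennreal (\<eta> n)"]) auto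
    then show ?thesis by simp
  qed
  have g0: "g 0 (Z 0) = G z0" unfolding g_def Z0 by simp
  have first: "ennreal (\<delta> 0) * H z z0 \<le> ennreal (\<eta> 0)"
  proof -
    have "G z + ennreal (\<delta> 0) * H z z0 = g 1 z" unfolding g_def using Z0 by simp
    also have "\<dots> \<le> G z0" using gz[of 1 0] g0 by simp
    also have "\<dots> \<le> G z + ennreal (\<eta> 0)" by (rule z0(2)[OF z(1)])
    finally have le: "G z + ennreal (\<delta> 0) * H z z0 \<le> G z + ennreal (\<eta> 0)" .
    have "G z \<le> G z0" using gz[of 0 0] g0 unfolding g_def by simp
    then have "G z < \<infinity>" using z0(3) by (rule le_less_trans)
    then show ?thesis using le by (auto simp: ennreal_add_left_cancel_le)
  qed
  show thesis
    using that[of Z z] Z_D z(1) ginf_z[of 0] g0 first min unfolding ginf_def by simp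
qed

section \<open>Calculus of the gauge and of powers of the norm\<close>

text \<open>
Like \<open>norm u\<close> for large \<open>u\<close> and like half its square near \<open>0\<close>; on a finite measure space, small integrals of
\<open>smooth_norm\<close> still control the \<open>L\<^sup>1\<close> norm.
\<close>

definition smooth_norm :: "'a::real_inner \<Rightarrow> real" where
  "smooth_norm u = sqrt (1 + (norm u)\<^sup>2) - 1"

definition smooth_norm_grad :: "'a::real_inner \<Rightarrow> 'a" where
  "smooth_norm_grad u = u /\<^sub>R sqrt (1 + (norm u)\<^sup>2)"

lemma smooth_norm_nonneg [simp]: "0 \<le> smooth_norm u"
  unfolding smooth_norm_def by simp

lemma smooth_norm_zero [simp]: "smooth_norm 0 = 0"
  unfolding smooth_norm_def by simp

lemma continuous_on_smooth_norm [continuous_intros]: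
  "continuous_on A f \<Longrightarrow> continuous_on A (\<lambda>x. smooth_norm (f x))"
  unfolding smooth_norm_def by (intro continuous_intros)

lemma tendsto_smooth_norm: "(f \<longlongrightarrow> l) F \<Longrightarrow> ((\<lambda>x. smooth_norm (f x)) \<longlongrightarrow> smooth_norm l) F"
  unfolding smooth_norm_def by (intro tendsto_intros)

lemma borel_measurable_smooth_norm [measurable]:
  fixes f :: "'t \<Rightarrow> 'a::euclidean_space"
  shows "f \<in> borel_measurable M \<Longrightarrow> (\<lambda>t. smooth_norm (f t)) \<in> borel_measurable M"
  by (rule measurable_compose[of f], assumption, rule borel_measurable_continuous_onI)
    (intro continuous_intros)

lemma borel_measurable_smooth_norm_grad [measurable]:
  fixes f :: "'t \<Rightarrow> 'a::euclidean_space"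
  shows "f \<in> borel_measurable M \<Longrightarrow> (\<lambda>t. smooth_norm_grad (f t)) \<in> borel_measurable M"
proof (rule measurable_compose[of f], assumption, rule borel_measurable_continuous_onI)
  have "1 + (norm u)\<^sup>2 \<noteq> 0" for u :: 'a
    using zero_le_power2[of "norm u"] by linarith
  then show "continuous_on UNIV (smooth_norm_grad :: 'a \<Rightarrow> 'a)"
    unfolding smooth_norm_grad_def by (intro continuous_intros) auto
qed

lemma norm_smooth_norm_grad_le: "norm (smooth_norm_grad u) \<le> 1"
proof -
  have "norm u \<le> sqrt (1 + (norm u)\<^sup>2)" by (rule real_le_rsqrt) simp
  moreover have "0 < sqrt (1 + (norm u)\<^sup>2)" by (simp add: add_pos_nonneg)
  ultimately show ?thesis unfolding smooth_norm_grad_def by (simp add: divide_simps)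
qed

text \<open>
\<open>smooth_norm u + 1\<close> is the norm of the pair \<open>(1, u)\<close>, whence the Lipschitz constant \<open>1\<close>.
\<close>

lemma smooth_norm_add_le: "smooth_norm (u + d) \<le> smooth_norm u + norm d"
proof -
  have eq: "sqrt (1 + (norm w)\<^sup>2) = norm (1 :: real, w)" for w :: 'a
    by (simp add: norm_Pair)
  have "norm (1 :: real, u + d) \<le> norm (1 :: real, u) + norm (0 :: real, d)"
    using norm_triangle_ineq[of "(1 :: real, u)" "(0, d)"] by simp
  then show ?thesis unfolding smooth_norm_def eq by (simp add: norm_Pair)
qed

text \<open>
The remainder is uniform in \<open>u\<close>, so that infinite series of such functions can be expanded
term by term, without a theorem on differentiation of series.
\<close>

lemma smooth_norm_quadratic_bound:
  "smooth_norm (u + d) \<le> smooth_norm u + smooth_norm_grad u \<bullet> d + (norm d)\<^sup>2 / 2"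
proof -
  define a b where "a = sqrt (1 + (norm (u + d))\<^sup>2)" and "b = sqrt (1 + (norm u)\<^sup>2)"
  have b: "1 \<le> b" unfolding b_def by simp
  have "a\<^sup>2 - b\<^sup>2 = 2 * (u \<bullet> d) + (norm d)\<^sup>2"
  proof -
    have "a\<^sup>2 = 1 + (norm (u + d))\<^sup>2" "b\<^sup>2 = 1 + (norm u)\<^sup>2"
      unfolding a_def b_def by (simp_all add: add_nonneg_nonneg)
    then show ?thesis
      by (simp add: power2_norm_eq_inner inner_add_left inner_add_right inner_commute)
  qed
  moreover have "0 \<le> (a - b)\<^sup>2" by simp
  ultimately have "2 * b * (a - b) \<le> 2 * (u \<bullet> d) + (norm d)\<^sup>2"
    by (simp add: power2_eq_square algebra_simps)
  then have "a - b \<le> (2 * (u \<bullet> d) + (norm d)\<^sup>2) / (2 * b)"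
    using b by (simp add: field_simps)
  also have "\<dots> = (u \<bullet> d) / b + (norm d)\<^sup>2 / (2 * b)" using b by (simp add: field_simps)
  also have "\<dots> \<le> (u \<bullet> d) / b + (norm d)\<^sup>2 / 2"
    using b by (intro add_left_mono divide_left_mono) auto
  finally show ?thesis
    unfolding smooth_norm_def smooth_norm_grad_def a_def b_def by (simp add: inverse_eq_divide)
qed

text \<open>
From \<open>(norm u)\<^sup>2 = a\<^sup>2 + 2 * a\<close> with \<open>a = smooth_norm u\<close> and the inequality of the arithmetic and geometric means;
\<open>s\<close> is chosen of the order of the square root of \<open>a\<close>.
\<close>

lemma norm_le_smooth_norm:
  assumes "0 < s" shows "norm u \<le> (1 + 1 / s) * smooth_norm u + s / 2"
proof -
  define a where "a = smooth_norm u"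
  have a: "0 \<le> a" unfolding a_def by simp
  have "(1 + a)\<^sup>2 = 1 + (norm u)\<^sup>2" unfolding a_def smooth_norm_def by (simp add: add_nonneg_nonneg)
  then have n: "(norm u)\<^sup>2 = a\<^sup>2 + 2 * a" by (simp add: power2_eq_square algebra_simps)
  have "2 * a = 4 * ((a / s) * (s / 2))" using assms by simp
  also have "\<dots> \<le> (a / s + s / 2)\<^sup>2"
    using zero_le_power2[of "a / s - s / 2"] by (simp only: power2_sum power2_diff)
  finally have "2 * a \<le> (a / s + s / 2)\<^sup>2" .
  moreover have "0 \<le> 2 * a * (a / s + s / 2)" using a assms by simp
  ultimately have "a\<^sup>2 + 2 * a \<le> a\<^sup>2 + (a / s + s / 2)\<^sup>2 + 2 * a * (a / s + s / 2)"
    by linarith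
  also have "\<dots> = (a + (a / s + s / 2))\<^sup>2" by (simp add: power2_sum)
  finally have "(norm u)\<^sup>2 \<le> (a + (a / s + s / 2))\<^sup>2" using n by simp
  moreover have "0 \<le> a + (a / s + s / 2)" using a assms by simp
  ultimately have "norm u \<le> a + (a / s + s / 2)" by (rule power2_le_imp_le)
  then show ?thesis unfolding a_def by (simp add: algebra_simps)
qed

definition norm_powr_grad :: "real \<Rightarrow> 'a::real_inner \<Rightarrow> 'a" where
  "norm_powr_grad p u = (p * norm u powr (p - 2)) *\<^sub>R u"

lemma norm_norm_powr_grad:
  assumes "1 < p" shows "norm (norm_powr_grad p u) = p * norm u powr (p - 1)"
proof (cases "u = 0")
  case False
  then have "norm u powr (p - 1) = norm u powr (p - 2) * norm u"
    using powr_add[of "norm u" "p - 2" 1] by simp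
  then show ?thesis unfolding norm_powr_grad_def using assms by (simp add: mult.assoc)
qed (simp add: norm_powr_grad_def)

lemma borel_measurable_norm_powr_grad [measurable]:
  fixes f :: "'t \<Rightarrow> 'a::euclidean_space"
  shows "f \<in> borel_measurable M \<Longrightarrow> (\<lambda>t. norm_powr_grad p (f t)) \<in> borel_measurable M"
  unfolding norm_powr_grad_def by measurable

lemma has_derivative_norm_powr:
  fixes u :: "'a::real_inner"
  assumes "1 < p"
  shows "((\<lambda>x. norm x powr p) has_derivative (\<lambda>d. norm_powr_grad p u \<bullet> d)) (at u)"
proof (cases "u = 0")
  case False
  have "((\<lambda>x. norm x powr p) has_derivative
      (\<lambda>d. (d \<bullet> sgn u) * (p * norm u powr (p - 1)))) (at u)"
    using has_derivative_norm[OF False] False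
    by (auto intro!: derivative_eq_intros simp: powr_diff field_simps)
  moreover have "(d \<bullet> sgn u) * (p * norm u powr (p - 1)) = norm_powr_grad p u \<bullet> d" for d
    using False unfolding norm_powr_grad_def sgn_div_norm
    by (simp add: powr_diff power2_eq_square inner_commute field_simps)
  ultimately show ?thesis by simp
next
  case True
  have "norm d powr p / norm d = norm d powr (p - 1)" for d :: 'a
    by (cases "d = 0") (simp_all add: powr_diff)
  moreover have "((\<lambda>d::'a. norm d powr (p - 1)) \<longlongrightarrow> 0) (at 0)"
    using assms by (auto intro!: tendsto_eq_intros)
  ultimately show ?thesis
    unfolding True has_derivative_at by (simp add: norm_powr_grad_def bounded_linear_inner_right)
qed

lemma powr_diff_le:
  fixes a b c p :: real
  assumes "1 < p" "0 \<le> a" "0 \<le> b" "a \<le> c" "b \<le> c"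
  shows "\<bar>a powr p - b powr p\<bar> \<le> p * c powr (p - 1) * \<bar>a - b\<bar>"
proof -
  have *: "y powr p - x powr p \<le> p * c powr (p - 1) * (y - x)" if "0 \<le> x" "x < y" "y \<le> c" for x y
  proof -
    have cont: "continuous_on {x..y} (\<lambda>t. t powr p)"
      using that(1) assms(1) by (intro continuous_on_powr' continuous_intros) auto
    have deriv: "((\<lambda>t. t powr p) has_derivative (\<lambda>d. p * z powr (p - 1) * d)) (at z)" if "x < z" "z < y" for z
      using has_real_derivative_powr[of z p] that \<open>0 \<le> x\<close> unfolding has_field_derivative_def by simp
    obtain z where z: "x < z" "z < y" "y powr p - x powr p = (p * z powr (p - 1)) * (y - x)"
      by (rule mvt[OF \<open>x < y\<close> cont deriv])
    have "z powr (p - 1) \<le> c powr (p - 1)" using z that assms(1) by (intro powr_mono2) auto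
    then have "(p * z powr (p - 1)) * (y - x) \<le> (p * c powr (p - 1)) * (y - x)"
      using that assms(1) by (intro mult_right_mono mult_left_mono) auto
    then show ?thesis using z(3) by simp
  qed
  have mono: "x powr p \<le> y powr p" if "0 \<le> x" "x \<le> y" for x y
    using that assms(1) by (intro powr_mono2) auto
  show ?thesis
    using *[of a b] *[of b a] mono[of a b] mono[of b a] assms by (cases a b rule: linorder_cases) auto
qed

text \<open>
The Fermat rule: the negative gradient of a smooth function supporting from below is a regular
subgradient. The function \<open>\<theta>\<close> may be any differentiable upper bound for the increments of the
smooth part; for the perturbation series this is the quadratic bound.
\<close>

lemma regular_subdifferential_if_supported:
  fixes \<psi> :: "'a::euclidean_space \<Rightarrow> ereal" and \<theta> :: "'a \<Rightarrow> real"
  assumes "\<bar>\<psi> z\<bar> \<noteq> \<infinity>" and "0 < \<rho>"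
    and supp: "\<And>d. norm d \<le> \<rho> \<Longrightarrow> \<psi> z \<le> \<psi> (z + d) + ereal (\<theta> d)"
    and \<theta>: "\<theta> 0 = 0" "(\<theta> has_derivative (\<lambda>d. g \<bullet> d)) (at 0)"
  shows "- g \<in> regular_subdifferential \<psi> z"
proof -
  define r where "r = real_of_ereal (\<psi> z)"
  have r: "\<psi> z = ereal r" unfolding r_def using assms(1) by (simp add: ereal_real)
  have "Limsup (at (z, r) within extended_epigraph \<psi>)
      (\<lambda>w. ereal ((- g, - 1) \<bullet> (w - (z, r)) / norm (w - (z, r)))) \<le> 0"
  proof (rule ereal_le_epsilon2)
    fix e :: real assume e: "0 < e"
    then obtain \<epsilon> where \<epsilon>: "0 < \<epsilon>" "\<And>d. norm d < \<epsilon> \<Longrightarrow> \<bar>\<theta> d - g \<bullet> d\<bar> \<le> e * norm d"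
      using \<theta>(2)[unfolded has_derivative_at_alt] \<theta>(1) by auto
    have "\<forall>\<^sub>F w in at (z, r) within extended_epigraph \<psi>.
        ereal ((- g, - 1) \<bullet> (w - (z, r)) / norm (w - (z, r))) \<le> ereal e"
      unfolding eventually_at
    proof (intro exI[of _ "min \<epsilon> \<rho>"] conjI ballI impI)
      show "0 < min \<epsilon> \<rho>" using \<epsilon>(1) assms(2) by simp
      fix w assume w: "w \<in> extended_epigraph \<psi>" "w \<noteq> (z, r) \<and> dist w (z, r) < min \<epsilon> \<rho>"
      obtain d \<alpha> where d: "w = (z + d, \<alpha>)"
        by (metis add_diff_cancel_left' diff_add_cancel add.commute prod.collapse)
      have n: "norm (w - (z, r)) < min \<epsilon> \<rho>" "0 < norm (w - (z, r))" using w(2) by (auto simp: dist_norm)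
      have dn: "norm d \<le> norm (w - (z, r))"
        using norm_fst_le[of d "\<alpha> - r"] unfolding d by simp
      have "\<psi> (z + d) \<le> ereal \<alpha>" using w(1) unfolding d extended_epigraph_def by simp
      then have "ereal r \<le> ereal \<alpha> + ereal (\<theta> d)"
        using supp[of d] dn n(1) r by (metis add_right_mono less_eq_real_def min_less_iff_conj order_trans le_less_trans)
      then have "r - \<alpha> \<le> \<theta> d" by simp
      moreover have "\<bar>\<theta> d - g \<bullet> d\<bar> \<le> e * norm d" using \<epsilon>(2)[of d] dn n(1) by simp
      moreover have "e * norm d \<le> e * norm (w - (z, r))" using dn e by simp
      moreover have "(- g, - 1) \<bullet> (w - (z, r)) = r - \<alpha> - g \<bullet> d" unfolding d by simp
      ultimately have "(- g, - 1) \<bullet> (w - (z, r)) \<le> e * norm (w - (z, r))" by linarith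
      then show "ereal ((- g, - 1) \<bullet> (w - (z, r)) / norm (w - (z, r))) \<le> ereal e"
        using n(2) by (simp add: divide_simps)
    qed
    from Limsup_bounded[OF this]
    show "Limsup (at (z, r) within extended_epigraph \<psi>)
      (\<lambda>w. ereal ((- g, - 1) \<bullet> (w - (z, r)) / norm (w - (z, r)))) \<le> 0 + ereal e" by simp
  qed
  then show ?thesis
    unfolding regular_subdifferential_def regular_normal_cone_def using assms(1) r_def by simp
qed

lemma powr_add_le:
  fixes a b p :: real
  assumes "0 \<le> a" "0 \<le> b" "0 \<le> p"
  shows "(a + b) powr p \<le> 2 powr p * (a powr p + b powr p)"
proof -
  have "(a + b) powr p \<le> (2 * max a b) powr p" using assms by (intro powr_mono2) auto
  also have "\<dots> = 2 powr p * max a b powr p" using assms by (simp add: powr_mult)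
  also have "max a b powr p \<le> a powr p + b powr p" by (simp add: max_def)
  finally show ?thesis by simp
qed

lemma norm_add_powr_le:
  fixes u v :: "'a::real_normed_vector"
  assumes "0 \<le> p"
  shows "norm (u + v) powr p \<le> 2 powr p * (norm u powr p + norm v powr p)"
proof -
  have "norm (u + v) powr p \<le> (norm u + norm v) powr p"
    using assms by (intro powr_mono2 norm_triangle_ineq) auto
  also have "\<dots> \<le> 2 powr p * (norm u powr p + norm v powr p)" using assms by (intro powr_add_le) auto
  finally show ?thesis .
qed

lemma powr_minus_one_le:
  fixes c p :: real
  assumes "1 < p" "0 \<le> c" shows "c powr (p - 1) \<le> 1 + c powr p"
proof (cases "c \<le> 1")
  case True
  then have "c powr (p - 1) \<le> 1" using assms by (intro powr_le1) auto
  then show ?thesis by (simp add: add_increasing2)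
next
  case False
  then have "c powr (p - 1) \<le> c powr p" using assms by (intro powr_mono) auto
  then show ?thesis by simp
qed

context finite_measure
begin

lemma integrable_norm_add_powr:
  fixes U V :: "'a \<Rightarrow> 'c::euclidean_space"
  assumes [measurable]: "U \<in> borel_measurable M" "V \<in> borel_measurable M" and "0 \<le> p"
    and "integrable M (\<lambda>t. norm (U t) powr p)" "integrable M (\<lambda>t. norm (V t) powr p)"
  shows "integrable M (\<lambda>t. norm (U t + V t) powr p)"
  by (rule Bochner_Integration.integrable_bound[where f = "\<lambda>t. 2 powr p * (norm (U t) powr p + norm (V t) powr p)"])
    (use assms norm_add_powr_le[OF assms(3)] in \<open>auto intro!: AE_I2\<close>)

lemma integrable_norm_powr_grad:
  fixes U :: "'a \<Rightarrow> 'c::euclidean_space"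
  assumes [measurable]: "U \<in> borel_measurable M" and p: "1 < p"
    and int: "integrable M (\<lambda>t. norm (U t) powr p)"
  shows "integrable M (\<lambda>t. norm_powr_grad p (U t))"
proof (rule Bochner_Integration.integrable_bound[where f = "\<lambda>t. p * (1 + norm (U t) powr p)"])
  show "AE t in M. norm (norm_powr_grad p (U t)) \<le> norm (p * (1 + norm (U t) powr p))"
    using p powr_minus_one_le[OF p, of "norm (U t)" for t]
    by (intro AE_I2) (simp add: norm_norm_powr_grad abs_mult)
qed (use int in auto)

text \<open>
Differentiation under the integral sign. By the mean value theorem the difference quotients are
dominated by a multiple of \<open>1 + \<parallel>U\<parallel>\<^sup>p + \<parallel>v\<parallel>\<^sup>p\<close>.
\<close>

lemma tendsto_norm_powr_difference_quotient:
  fixes U :: "'a \<Rightarrow> 'c::euclidean_space"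
  assumes [measurable]: "U \<in> borel_measurable M" and p: "1 < p"
    and int: "integrable M (\<lambda>t. norm (U t) powr p)"
  shows "(\<lambda>n. real (Suc n) * ((\<integral>t. norm (U t - (1 / real (Suc n)) *\<^sub>R v) powr p \<partial>M) - (\<integral>t. norm (U t) powr p \<partial>M)))
      \<longlonglongrightarrow> - ((\<integral>t. norm_powr_grad p (U t) \<partial>M) \<bullet> v)"
proof -
  let ?s = "\<lambda>n. 1 / real (Suc n)"
  let ?Q = "\<lambda>n t. real (Suc n) * (norm (U t - ?s n *\<^sub>R v) powr p - norm (U t) powr p)"
  let ?B = "\<lambda>t. p * (1 + 2 powr p * (norm (U t) powr p + norm v powr p)) * norm v"
  have intv: "integrable M (\<lambda>t. norm (U t - ?s n *\<^sub>R v) powr p)" for n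
    using integrable_norm_add_powr[of U "\<lambda>_. - (?s n *\<^sub>R v)" p] p int by simp
  have lim: "(\<lambda>n. ?Q n t) \<longlonglongrightarrow> - (norm_powr_grad p (U t) \<bullet> v)" for t
  proof -
    let ?\<psi> = "\<lambda>s::real. norm (U t - s *\<^sub>R v) powr p"
    have "((\<lambda>s::real. U t - s *\<^sub>R v) has_derivative (\<lambda>h. - (h *\<^sub>R v))) (at 0)"
      by (auto intro!: derivative_eq_intros)
    moreover have "((\<lambda>x. norm x powr p) has_derivative (\<lambda>d. norm_powr_grad p (U t) \<bullet> d)) (at (U t - 0 *\<^sub>R v))"
      using has_derivative_norm_powr[OF p, of "U t"] by simp
    ultimately have "(?\<psi> has_derivative (\<lambda>h. norm_powr_grad p (U t) \<bullet> (- (h *\<^sub>R v)))) (at 0)"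
      by (rule has_derivative_compose)
    moreover have "(\<lambda>h. norm_powr_grad p (U t) \<bullet> (- (h *\<^sub>R v))) = (*) (- (norm_powr_grad p (U t) \<bullet> v))"
      by (auto simp: fun_eq_iff)
    ultimately have "(?\<psi> has_field_derivative - (norm_powr_grad p (U t) \<bullet> v)) (at 0)"
      unfolding has_field_derivative_def by simp
    then have "((\<lambda>s. (?\<psi> s - ?\<psi> 0) / (s - 0)) \<longlongrightarrow> - (norm_powr_grad p (U t) \<bullet> v)) (at 0)"
      unfolding has_field_derivative_iff by simp
    moreover have "filterlim ?s (at 0) sequentially"
      using LIMSEQ_Suc[OF lim_1_over_n] by (auto simp: filterlim_at intro!: always_eventually)
    ultimately have "(\<lambda>n. (?\<psi> (?s n) - ?\<psi> 0) / (?s n - 0)) \<longlonglongrightarrow> - (norm_powr_grad p (U t) \<bullet> v)"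
      by (rule filterlim_compose)
    then show ?thesis by (simp add: field_simps)
  qed
  have bound: "norm (?Q n t) \<le> ?B t" for n t
  proof -
    have "norm (?s n *\<^sub>R v) \<le> norm v" by (simp add: divide_le_eq mult_left_le_one_le field_simps)
    then have "norm (U t - ?s n *\<^sub>R v) \<le> norm (U t) + norm v"
      using norm_triangle_ineq4[of "U t" "?s n *\<^sub>R v"] by linarith
    then have "\<bar>norm (U t - ?s n *\<^sub>R v) powr p - norm (U t) powr p\<bar>
        \<le> p * (norm (U t) + norm v) powr (p - 1) * \<bar>norm (U t - ?s n *\<^sub>R v) - norm (U t)\<bar>"
      by (intro powr_diff_le p) auto
    also have "\<dots> \<le> p * (1 + 2 powr p * (norm (U t) powr p + norm v powr p)) * (?s n * norm v)"
    proof (intro mult_mono)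
      have "(norm (U t) + norm v) powr (p - 1) \<le> 1 + (norm (U t) + norm v) powr p"
        by (rule powr_minus_one_le[OF p]) simp
      also have "\<dots> \<le> 1 + 2 powr p * (norm (U t) powr p + norm v powr p)"
        using p by (intro add_left_mono powr_add_le) auto
      finally show "(norm (U t) + norm v) powr (p - 1) \<le> 1 + 2 powr p * (norm (U t) powr p + norm v powr p)" .
      have "\<bar>norm (U t - ?s n *\<^sub>R v) - norm (U t)\<bar> \<le> norm (?s n *\<^sub>R v)"
        using norm_triangle_ineq3[of "U t - ?s n *\<^sub>R v" "U t"] by simp
      then show "\<bar>norm (U t - ?s n *\<^sub>R v) - norm (U t)\<bar> \<le> ?s n * norm v" by simp
    qed (use p in auto)
    finally have "real (Suc n) * \<bar>norm (U t - ?s n *\<^sub>R v) powr p - norm (U t) powr p\<bar>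
       \<le> real (Suc n) * (p * (1 + 2 powr p * (norm (U t) powr p + norm v powr p)) * (?s n * norm v))"
      by (intro mult_left_mono) auto
    also have "\<dots> = ?B t" by simp
    finally show ?thesis by (simp add: abs_mult)
  qed
  have "(\<lambda>n. \<integral>t. ?Q n t \<partial>M) \<longlonglongrightarrow> (\<integral>t. - (norm_powr_grad p (U t) \<bullet> v) \<partial>M)"
  proof (rule integral_dominated_convergence[where w = ?B])
    show "integrable M ?B" using int by simp
  qed (use lim bound in \<open>auto intro!: AE_I2\<close>)
  moreover have "(\<integral>t. ?Q n t \<partial>M) = real (Suc n) *
      ((\<integral>t. norm (U t - ?s n *\<^sub>R v) powr p \<partial>M) - (\<integral>t. norm (U t) powr p \<partial>M))" for n
    using intv[of n] int by simp
  moreover have "(\<integral>t. - (norm_powr_grad p (U t) \<bullet> v) \<partial>M) = - ((\<integral>t. norm_powr_grad p (U t) \<partial>M) \<bullet> v)"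
    using integrable_norm_powr_grad[OF assms] by simp
  ultimately show ?thesis by simp
qed

text \<open>
First order condition for \<open>K * \<integral> \<parallel>U - v\<parallel>\<^sup>p + L * \<parallel>v\<parallel>\<close> at a local minimum \<open>v = 0\<close>: the gradient of the
first term has norm at most \<open>L\<close>.
\<close>

lemma norm_integral_norm_powr_grad_le:
  fixes U :: "'a \<Rightarrow> 'c::euclidean_space"
  assumes [measurable]: "U \<in> borel_measurable M" and p: "1 < p"
    and int: "integrable M (\<lambda>t. norm (U t) powr p)"
    and K: "0 < K" and \<rho>: "0 < \<rho>"
    and min: "\<And>v. norm v \<le> \<rho> \<Longrightarrow>
      K * (\<integral>t. norm (U t) powr p \<partial>M) \<le> K * (\<integral>t. norm (U t - v) powr p \<partial>M) + L * norm v"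
  shows "norm (K *\<^sub>R (\<integral>t. norm_powr_grad p (U t) \<partial>M)) \<le> L"
proof -
  define W where "W = K *\<^sub>R (\<integral>t. norm_powr_grad p (U t) \<partial>M)"
  have dir: "W \<bullet> v \<le> L * norm v" if v: "norm v \<le> \<rho>" for v
  proof -
    let ?I = "\<lambda>v. \<integral>t. norm (U t - v) powr p \<partial>M"
    have "- (L * norm v) \<le> K * (real (Suc n) * (?I ((1 / real (Suc n)) *\<^sub>R v) - (\<integral>t. norm (U t) powr p \<partial>M)))" for n
    proof -
      define s where "s = 1 / real (Suc n)"
      have s: "0 < s" "s \<le> 1" "real (Suc n) = 1 / s" unfolding s_def by simp_all
      have "norm (s *\<^sub>R v) \<le> \<rho>" using s v mult_left_le_one_le[of "norm v" s] by simp
      from min[OF this] have "- (L * norm v) * s \<le> K * (?I (s *\<^sub>R v) - (\<integral>t. norm (U t) powr p \<partial>M))"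
        using s by (simp add: algebra_simps)
      then show ?thesis unfolding s_def[symmetric] s(3) using s(1) by (simp add: field_simps)
    qed
    moreover have "(\<lambda>n. K * (real (Suc n) * (?I ((1 / real (Suc n)) *\<^sub>R v) - (\<integral>t. norm (U t) powr p \<partial>M))))
        \<longlonglongrightarrow> K * (- ((\<integral>t. norm_powr_grad p (U t) \<partial>M) \<bullet> v))"
      by (intro tendsto_mult tendsto_const tendsto_norm_powr_difference_quotient assms(1) p int)
    ultimately have "- (L * norm v) \<le> K * (- ((\<integral>t. norm_powr_grad p (U t) \<partial>M) \<bullet> v))"
      by (intro LIMSEQ_le_const) auto
    then show ?thesis unfolding W_def by simp
  qed
  show ?thesis
  proof (cases "W = 0")
    case True
    obtain b :: 'c where b: "b \<in> Basis" using nonempty_Basis by blast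
    have "0 \<le> L * norm (\<rho> *\<^sub>R b)" using dir[of "\<rho> *\<^sub>R b"] True b \<rho> by simp
    then have "0 \<le> L" using b \<rho> by (simp add: zero_le_mult_iff)
    then have "norm W \<le> L" using True by simp
    then show ?thesis unfolding W_def .
  next
    case False
    have "W \<bullet> ((\<rho> / norm W) *\<^sub>R W) \<le> L * norm ((\<rho> / norm W) *\<^sub>R W)"
      using False \<rho> by (intro dir) simp
    then have "\<rho> * norm W \<le> L * \<rho>"
      using False \<rho> by (simp add: dot_square_norm power2_eq_square)
    then have "norm W \<le> L" using \<rho> by simp
    then show ?thesis unfolding W_def .
  qed
qed

text \<open>
Integration of \<open>norm_le_smooth_norm\<close> with \<open>s = \<tau>\<close>.
\<close>

lemma norm_integral_le_smooth_norm:
  fixes U :: "'a \<Rightarrow> 'c::euclidean_space"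
  assumes [measurable]: "U \<in> borel_measurable M" and "0 < \<tau>"
    and "(\<integral>\<^sup>+t. ennreal (smooth_norm (U t)) \<partial>M) \<le> ennreal (\<tau>\<^sup>2)"
  shows "(\<integral>\<^sup>+t. ennreal (norm (U t)) \<partial>M) \<le> ennreal (\<tau>\<^sup>2 + \<tau> + \<tau> / 2 * measure M (space M))"
proof -
  have "(\<integral>\<^sup>+t. ennreal (norm (U t)) \<partial>M)
      \<le> (\<integral>\<^sup>+t. ennreal (1 + 1 / \<tau>) * ennreal (smooth_norm (U t)) + ennreal (\<tau> / 2) \<partial>M)"
  proof (rule nn_integral_mono)
    fix t
    have "ennreal (norm (U t)) \<le> ennreal ((1 + 1 / \<tau>) * smooth_norm (U t) + \<tau> / 2)"
      by (intro ennreal_leI norm_le_smooth_norm assms(2))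
    also have "\<dots> = ennreal ((1 + 1 / \<tau>) * smooth_norm (U t)) + ennreal (\<tau> / 2)"
      using assms(2) by (intro ennreal_plus) auto
    also have "ennreal ((1 + 1 / \<tau>) * smooth_norm (U t)) = ennreal (1 + 1 / \<tau>) * ennreal (smooth_norm (U t))"
      using assms(2) by (intro ennreal_mult) auto
    finally show "ennreal (norm (U t)) \<le> ennreal (1 + 1 / \<tau>) * ennreal (smooth_norm (U t)) + ennreal (\<tau> / 2)" .
  qed
  also have "\<dots> = ennreal (1 + 1 / \<tau>) * (\<integral>\<^sup>+t. ennreal (smooth_norm (U t)) \<partial>M) + ennreal (\<tau> / 2) * emeasure M (space M)"
    by (simp add: nn_integral_add nn_integral_cmult)
  also have "\<dots> \<le> ennreal (1 + 1 / \<tau>) * ennreal (\<tau>\<^sup>2) + ennreal (\<tau> / 2) * ennreal (measure M (space M))"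
    unfolding emeasure_eq_measure by (intro add_mono mult_left_mono assms(3)) auto
  also have "\<dots> = ennreal ((1 + 1 / \<tau>) * \<tau>\<^sup>2 + \<tau> / 2 * measure M (space M))"
  proof -
    have "ennreal (1 + 1 / \<tau>) * ennreal (\<tau>\<^sup>2) = ennreal ((1 + 1 / \<tau>) * \<tau>\<^sup>2)"
      "ennreal (\<tau> / 2) * ennreal (measure M (space M)) = ennreal (\<tau> / 2 * measure M (space M))"
      using assms(2) by (intro ennreal_mult[symmetric]; simp)+
    then show ?thesis using assms(2) by (subst ennreal_plus) auto
  qed
  also have "(1 + 1 / \<tau>) * \<tau>\<^sup>2 = \<tau>\<^sup>2 + \<tau>" using assms(2) by (simp add: field_simps power2_eq_square)
  finally show ?thesis .
qed

lemma norm_snd_integral_le_smooth_norm: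
  fixes Y :: "'a \<Rightarrow> 'b::euclidean_space \<times> 'c::euclidean_space"
  assumes Y: "Y \<in> borel_measurable M" and z: "(\<lambda>t. (x, y t)) \<in> borel_measurable M" and \<tau>: "0 < \<tau>"
    and le: "(\<integral>\<^sup>+t. ennreal (smooth_norm (Y t - (x, y t))) \<partial>M) \<le> ennreal (\<tau>\<^sup>2)"
  shows "(\<integral>\<^sup>+t. ennreal (norm (snd (Y t) - y t)) \<partial>M) \<le> ennreal (\<tau>\<^sup>2 + \<tau> + \<tau> / 2 * measure M (space M))"
proof -
  have "(\<integral>\<^sup>+t. ennreal (norm (snd (Y t) - y t)) \<partial>M) \<le> (\<integral>\<^sup>+t. ennreal (norm (Y t - (x, y t))) \<partial>M)"
    using norm_snd_le[of "snd (Y t) - y t" "fst (Y t) - x" for t]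
    by (intro nn_integral_mono ennreal_leI) (simp add: minus_prod_def)
  also note norm_integral_le_smooth_norm[OF borel_measurable_diff[OF Y z] \<tau> le]
  finally show ?thesis .
qed

end

text \<open>
The weights add up to \<open>2 * d\<close>, which bounds both the Lipschitz constant and the gradient.
\<close>

definition perturbation :: "real \<Rightarrow> (nat \<Rightarrow> 'c::euclidean_space) \<Rightarrow> 'c \<Rightarrow> ennreal" where
  "perturbation d U u = (\<Sum>n. ennreal (d * (1 / 2) ^ n * smooth_norm (u - U n)))"

definition perturbation_grad :: "real \<Rightarrow> (nat \<Rightarrow> 'c::euclidean_space) \<Rightarrow> 'c \<Rightarrow> 'c" where
  "perturbation_grad d U u = (\<Sum>n. (d * (1 / 2) ^ n) *\<^sub>R smooth_norm_grad (u - U n))"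

lemma geometric_weights_sums: "(\<lambda>n. d * (1 / 2 :: real) ^ n) sums (2 * d)"
  using sums_mult[OF geometric_sums[of "1 / 2 :: real"], of d] by (simp add: mult.commute)

lemma perturbation_grad_sums:
  assumes "0 \<le> d"
  shows "(\<lambda>n. (d * (1 / 2) ^ n) *\<^sub>R smooth_norm_grad (u - U n)) sums perturbation_grad d U u"
    and "norm (perturbation_grad d U u) \<le> 2 * d"
proof -
  have bound: "norm ((d * (1 / 2) ^ n) *\<^sub>R smooth_norm_grad (u - U n)) \<le> d * (1 / 2) ^ n" for n
    using assms norm_smooth_norm_grad_le[of "u - U n"] by (simp add: abs_mult mult_left_le)
  have sumw: "summable (\<lambda>n. d * (1 / 2 :: real) ^ n)" using geometric_weights_sums by (rule sums_summable)
  have sumn: "summable (\<lambda>n. norm ((d * (1 / 2) ^ n) *\<^sub>R smooth_norm_grad (u - U n)))"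
    by (rule summable_comparison_test'[OF sumw, of 0]) (use bound in simp)
  show "(\<lambda>n. (d * (1 / 2) ^ n) *\<^sub>R smooth_norm_grad (u - U n)) sums perturbation_grad d U u"
    unfolding perturbation_grad_def by (rule summable_sums[OF summable_norm_cancel[OF sumn]])
  have "norm (perturbation_grad d U u) \<le> (\<Sum>n. norm ((d * (1 / 2) ^ n) *\<^sub>R smooth_norm_grad (u - U n)))"
    unfolding perturbation_grad_def by (rule summable_norm[OF sumn])
  also have "\<dots> \<le> (\<Sum>n. d * (1 / 2) ^ n)" by (rule suminf_le[OF bound sumn sumw])
  also have "\<dots> = 2 * d" using geometric_weights_sums by (rule sums_unique[symmetric])
  finally show "norm (perturbation_grad d U u) \<le> 2 * d" .
qed

lemma perturbation_add_le:
  assumes "0 \<le> d" shows "perturbation d U (u + v) \<le> perturbation d U u + ennreal (2 * d * norm v)"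
proof -
  have "perturbation d U (u + v)
      \<le> (\<Sum>n. ennreal (d * (1 / 2) ^ n * smooth_norm (u - U n)) + ennreal (d * (1 / 2) ^ n * norm v))"
    unfolding perturbation_def
  proof (rule suminf_le)
    fix n
    have "d * (1 / 2) ^ n * smooth_norm (u + v - U n) \<le> d * (1 / 2) ^ n * (smooth_norm (u - U n) + norm v)"
      using assms smooth_norm_add_le[of "u - U n" v] by (intro mult_left_mono) (simp_all add: algebra_simps)
    then have "ennreal (d * (1 / 2) ^ n * smooth_norm (u + v - U n))
       \<le> ennreal (d * (1 / 2) ^ n * smooth_norm (u - U n) + d * (1 / 2) ^ n * norm v)"
      by (intro ennreal_leI) (simp add: distrib_left)
    also have "\<dots> = ennreal (d * (1 / 2) ^ n * smooth_norm (u - U n)) + ennreal (d * (1 / 2) ^ n * norm v)"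
      using assms by (intro ennreal_plus) auto
    finally show "ennreal (d * (1 / 2) ^ n * smooth_norm (u + v - U n))
       \<le> ennreal (d * (1 / 2) ^ n * smooth_norm (u - U n)) + ennreal (d * (1 / 2) ^ n * norm v)" .
  qed auto
  also have "\<dots> = perturbation d U u + (\<Sum>n. ennreal (d * (1 / 2) ^ n * norm v))"
    unfolding perturbation_def by (rule suminf_add[symmetric]) auto
  also have "(\<Sum>n. ennreal (d * (1 / 2) ^ n * norm v)) = ennreal (2 * d * norm v)"
    using assms sums_mult2[OF geometric_weights_sums, of d "norm v"]
    by (intro suminf_ennreal_eq) auto
  finally show ?thesis .
qed

lemma perturbation_quadratic_bound:
  assumes "0 \<le> d" "perturbation d U u = ennreal s" "0 \<le> s"
  defines "s' \<equiv> \<lambda>v. s + perturbation_grad d U u \<bullet> v + d * (norm v)\<^sup>2"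
  shows "perturbation d U (u + v) \<le> ennreal (s' v)" and "0 \<le> s' v"
proof -
  let ?w = "\<lambda>n. d * (1 / 2 :: real) ^ n"
  let ?b = "\<lambda>n. ?w n * smooth_norm (u - U n) + (?w n *\<^sub>R smooth_norm_grad (u - U n)) \<bullet> v + ?w n * ((norm v)\<^sup>2 / 2)"
  have "summable (\<lambda>n. ?w n * smooth_norm (u - U n))"
    using assms(1,2) unfolding perturbation_def by (intro summable_suminf_not_top) auto
  moreover have "(\<Sum>n. ?w n * smooth_norm (u - U n)) = s"
  proof -
    have "ennreal (\<Sum>n. ?w n * smooth_norm (u - U n)) = ennreal s"
      using assms(1,2) calculation unfolding perturbation_def by (subst suminf_ennreal2[symmetric]) auto
    then show ?thesis
      using assms(1,3) calculation by (subst (asm) ennreal_inj) (auto intro!: suminf_nonneg)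
  qed
  ultimately have "(\<lambda>n. ?w n * smooth_norm (u - U n)) sums s" by (simp add: sums_iff)
  moreover have "(\<lambda>n. (?w n *\<^sub>R smooth_norm_grad (u - U n)) \<bullet> v) sums (perturbation_grad d U u \<bullet> v)"
    by (rule bounded_linear.sums[OF bounded_linear_inner_left perturbation_grad_sums(1)[OF assms(1)]])
  moreover have "(\<lambda>n. ?w n * ((norm v)\<^sup>2 / 2)) sums (d * (norm v)\<^sup>2)"
    using sums_mult2[OF geometric_weights_sums, of d "(norm v)\<^sup>2 / 2"] by simp
  ultimately have b: "?b sums s' v" unfolding s'_def by (intro sums_add)
  have le: "?w n * smooth_norm (u + v - U n) \<le> ?b n" for n
  proof -
    have "?w n * smooth_norm (u + v - U n)
        \<le> ?w n * (smooth_norm (u - U n) + smooth_norm_grad (u - U n) \<bullet> v + (norm v)\<^sup>2 / 2)"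
      using assms(1) smooth_norm_quadratic_bound[of "u - U n" v]
      by (intro mult_left_mono) (simp_all add: algebra_simps)
    then show ?thesis by (simp add: distrib_left)
  qed
  have nonneg: "0 \<le> ?b n" for n
    by (rule order_trans[OF _ le[of n]]) (use assms(1) in simp)
  have "perturbation d U (u + v) \<le> (\<Sum>n. ennreal (?b n))"
    unfolding perturbation_def by (intro suminf_le ennreal_leI le) auto
  also have "\<dots> = ennreal (s' v)" by (rule suminf_ennreal_eq[OF nonneg b])
  finally show "perturbation d U (u + v) \<le> ennreal (s' v)" .
  show "0 \<le> s' v" by (rule sums_le[OF nonneg sums_zero b])
qed

section \<open>The penalised functional and its perturbed minimisers\<close>

lemma convergent_if_smooth_norm_increments_le:
  fixes u :: "nat \<Rightarrow> 'c::euclidean_space"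
  assumes "\<And>n. smooth_norm (u (Suc n) - u n) \<le> B * (1 / 4) ^ n"
  shows "convergent u"
proof -
  have B: "0 \<le> B" using order_trans[OF smooth_norm_nonneg assms[of 0]] by simp
  have bound: "norm (u (Suc n) - u n) \<le> (2 * B + 1) * (1 / 2) ^ n" for n
  proof -
    define s where "s = (1 / 2 :: real) ^ n"
    have s: "0 < s" "s \<le> 1" "(1 / 4 :: real) ^ n = s * s"
      unfolding s_def by (simp_all add: power_le_one flip: power_mult_distrib)
    have "norm (u (Suc n) - u n) \<le> (1 + 1 / s) * smooth_norm (u (Suc n) - u n) + s / 2"
      by (rule norm_le_smooth_norm[OF s(1)])
    also have "\<dots> \<le> (1 + 1 / s) * (B * (s * s)) + s / 2"
      using assms[of n] s by (intro add_mono mult_left_mono) auto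
    also have "\<dots> = B * s * s + B * s + s / 2" using s(1) by (simp add: field_simps)
    also have "\<dots> \<le> B * s + B * s + s"
      using s B by (intro add_mono mult_left_le) auto
    finally show ?thesis unfolding s_def[symmetric] by (simp add: algebra_simps)
  qed
  have "summable (\<lambda>n. (2 * B + 1) * (1 / 2 :: real) ^ n)"
    by (intro summable_mult summable_geometric) simp
  then have "summable (\<lambda>n. u (Suc n) - u n)"
    by (rule summable_comparison_test'[where N = 0]) (rule bound)
  then have "convergent (\<lambda>n. \<Sum>i<n. u (Suc i) - u i)" by (simp add: summable_iff_convergent)
  then have "convergent (\<lambda>n. u n - u 0)" by (simp only: sum_lessThan_telescope)
  then have "convergent (\<lambda>n. (u n - u 0) + u 0)" by (intro convergent_add convergent_const)
  then show ?thesis by simp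
qed

text \<open>
The factor between the rates \<open>(1 / 8) ^ n\<close> and \<open>(1 / 4) ^ n\<close> makes the weighted sum of the increments integrable.
\<close>

lemma AE_convergent_if_smooth_norm_increments_le:
  fixes Y :: "nat \<Rightarrow> 't \<Rightarrow> 'c::euclidean_space"
  assumes [measurable]: "\<And>n. Y n \<in> borel_measurable M"
    and "\<And>n. (\<integral>\<^sup>+t. ennreal (smooth_norm (Y (Suc n) t - Y n t)) \<partial>M) \<le> ennreal (c * (1 / 8) ^ n)"
    and c: "0 \<le> c"
  shows "AE t in M. convergent (\<lambda>n. Y n t)"
proof -
  let ?h = "\<lambda>n t. smooth_norm (Y (Suc n) t - Y n t)"
  have sum: "summable (\<lambda>n. c * (1 / 2 :: real) ^ n)"
    by (intro summable_mult summable_geometric) simp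
  have "(\<integral>\<^sup>+t. (\<Sum>n. ennreal (4 ^ n * ?h n t)) \<partial>M) = (\<Sum>n. \<integral>\<^sup>+t. ennreal (4 ^ n * ?h n t) \<partial>M)"
    by (intro nn_integral_suminf) measurable
  also have "\<dots> \<le> (\<Sum>n. ennreal (c * (1 / 2) ^ n))"
  proof (rule suminf_le)
    fix n
    have "(\<integral>\<^sup>+t. ennreal (4 ^ n * ?h n t) \<partial>M) = ennreal (4 ^ n) * (\<integral>\<^sup>+t. ennreal (?h n t) \<partial>M)"
      by (simp add: ennreal_mult nn_integral_cmult)
    also have "\<dots> \<le> ennreal (4 ^ n) * ennreal (c * (1 / 8) ^ n)"
      by (intro mult_left_mono assms(2)) simp
    also have "\<dots> = ennreal (c * (1 / 2) ^ n)"
    proof -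
      have "(4::real) ^ n * (c * (1 / 8) ^ n) = c * (4 * (1 / 8)) ^ n"
        by (simp only: power_mult_distrib) simp
      then show ?thesis using c by (simp flip: ennreal_mult)
    qed
    finally show "(\<integral>\<^sup>+t. ennreal (4 ^ n * ?h n t) \<partial>M) \<le> ennreal (c * (1 / 2) ^ n)" .
  qed auto
  also have "\<dots> = ennreal (\<Sum>n. c * (1 / 2) ^ n)"
    using c sum by (intro suminf_ennreal2) auto
  finally have "(\<integral>\<^sup>+t. (\<Sum>n. ennreal (4 ^ n * ?h n t)) \<partial>M) \<noteq> \<infinity>"
    by (auto simp: top_unique)
  then have "AE t in M. (\<Sum>n. ennreal (4 ^ n * ?h n t)) \<noteq> \<infinity>"
    by (intro nn_integral_PInf_AE) measurable
  then show ?thesis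
  proof eventually_elim
    case (elim t)
    define S where "S = (\<Sum>n. ennreal (4 ^ n * ?h n t))"
    have "S < top" using elim unfolding S_def[symmetric] by (simp add: less_top)
    then obtain B where B: "0 \<le> B" "S = ennreal B" using less_top_ennreal[of S] by auto
    have "?h n t \<le> B * (1 / 4) ^ n" for n
    proof -
      have "ennreal (4 ^ n * ?h n t) \<le> ennreal B"
        using sum_le_suminf[of "\<lambda>n. ennreal (4 ^ n * ?h n t)" "{n}"]
        unfolding S_def[symmetric] B(2) by simp
      then have "4 ^ n * ?h n t \<le> B" using B(1) by simp
      then show ?thesis by (simp add: field_simps power_divide)
    qed
    then show ?case by (rule convergent_if_smooth_norm_increments_le)
  qed
qed

lemma lower_semicontinuous_liminf:
  assumes "lower_semicontinuous \<psi>" "Z \<longlonglongrightarrow> z"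
  shows "\<psi> z \<le> liminf (\<lambda>n. \<psi> (Z n))"
  unfolding le_Liminf_iff
proof (intro allI impI)
  fix y assume y: "y < \<psi> z"
  have "\<psi> z \<le> Liminf (at z) \<psi>" using assms(1) unfolding lower_semicontinuous_def by simp
  then have "\<forall>\<^sub>F w in at z. y < \<psi> w" using y unfolding le_Liminf_iff by blast
  then have "\<forall>\<^sub>F w in nhds z. y < \<psi> w"
    unfolding eventually_at_filter by (rule eventually_mono) (use y in auto)
  then show "\<forall>\<^sub>F n in sequentially. y < \<psi> (Z n)"
    using assms(2) by (rule eventually_compose_filterlim)
qed

lemma tendsto_norm_powr:
  assumes "(g \<longlongrightarrow> l) F" "1 < p" shows "((\<lambda>n. norm (g n) powr p) \<longlongrightarrow> norm l powr p) F"
  using assms(2) by (intro tendsto_powr2 tendsto_norm assms(1) tendsto_const) auto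

lemma borel_measurable_fst_snd [measurable (raw)]:
  fixes h :: "'s \<Rightarrow> 'a::euclidean_space \<times> 'b::euclidean_space"
  assumes "h \<in> borel_measurable N"
  shows "(\<lambda>s. fst (h s)) \<in> borel_measurable N" "(\<lambda>s. snd (h s)) \<in> borel_measurable N"
  by (rule measurable_compose[OF assms borel_measurable_continuous_onI], intro continuous_intros)+

lemma perturbation_measurable [measurable (raw)]:
  fixes h :: "'s \<Rightarrow> 'c::euclidean_space"
  assumes [measurable]: "\<And>n. (\<lambda>s. U s n) \<in> borel_measurable N" "h \<in> borel_measurable N"
  shows "(\<lambda>s. perturbation d (U s) (h s)) \<in> borel_measurable N"
  unfolding perturbation_def by measurable

lemma perturbation_grad_measurable [measurable (raw)]:
  fixes h :: "'s \<Rightarrow> 'c::euclidean_space"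
  assumes [measurable]: "\<And>n. (\<lambda>s. U s n) \<in> borel_measurable N" "h \<in> borel_measurable N"
  shows "(\<lambda>s. perturbation_grad d (U s) (h s)) \<in> borel_measurable N"
  unfolding perturbation_grad_def by measurable

lemma ennreal_mult_leD:
  assumes "ennreal a * g \<le> ennreal b" "0 < a" shows "g \<le> ennreal (b / a)"
proof -
  have "g = ennreal (1 / a) * (ennreal a * g)"
    using assms(2) by (simp add: mult.assoc[symmetric] ennreal_mult[symmetric])
  also have "\<dots> \<le> ennreal (1 / a) * ennreal b" by (intro mult_left_mono assms(1)) simp
  also have "\<dots> = ennreal (b / a)" using assms(2) by (simp add: ennreal_mult'[symmetric])
  finally show ?thesis .
qed

text \<open>
Pairs \<open>(\<xi>(t), y(t))\<close> are handled as a single function \<open>Y\<close> into the product space. The integrand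
is nonnegative here; the original one is shifted later.
\<close>

locale penalized_problem = finite_measure M for M :: "'t measure" +
  fixes f :: "'t \<Rightarrow> 'a::euclidean_space \<times> 'b::euclidean_space \<Rightarrow> ennreal"
    and p K r :: real and xbar :: 'a and ybar :: "'t \<Rightarrow> 'b"
  assumes f_measurable: "(\<lambda>(t, w). f t w) \<in> borel_measurable (M \<Otimes>\<^sub>M borel)"
    and f_lsc: "\<And>t W w. t \<in> space M \<Longrightarrow> W \<longlonglongrightarrow> w \<Longrightarrow> f t w \<le> liminf (\<lambda>n. f t (W n))"
    and p: "1 < p" and K: "0 < K" and r: "0 < r"
    and ybar [measurable]: "ybar \<in> borel_measurable M"
begin

definition feasible :: "('a \<times> ('t \<Rightarrow> 'a \<times> 'b)) set" where
  "feasible = {(x, Y). norm (x - xbar) \<le> r \<and> Y \<in> borel_measurable M \<and>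
     (\<integral>\<^sup>+t. ennreal (norm (snd (Y t) - ybar t)) \<partial>M) \<le> ennreal r}"

definition penalized :: "'a \<Rightarrow> 't \<Rightarrow> 'a \<times> 'b \<Rightarrow> ennreal" where
  "penalized x t w = f t w + ennreal (K * norm (fst w - x) powr p)"

definition objective :: "'a \<times> ('t \<Rightarrow> 'a \<times> 'b) \<Rightarrow> ennreal" where
  "objective z = (\<integral>\<^sup>+t. penalized (fst z) t (snd z t) \<partial>M)"

text \<open>
The triangle inequality fails, but the completeness assumption of the variational
principle holds: if the gauges of successive differences decay geometrically, the points
converge almost everywhere.
\<close>

definition gauge :: "'a \<times> ('t \<Rightarrow> 'a \<times> 'b) \<Rightarrow> 'a \<times> ('t \<Rightarrow> 'a \<times> 'b) \<Rightarrow> ennreal" where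
  "gauge z z' = ennreal (smooth_norm (fst z - fst z')) +
     (\<integral>\<^sup>+t. ennreal (smooth_norm (snd z t - snd z' t)) \<partial>M)"

lemma f_comp_measurable [measurable (raw)]:
  assumes "g \<in> N \<rightarrow>\<^sub>M M" "h \<in> borel_measurable N"
  shows "(\<lambda>s. f (g s) (h s)) \<in> borel_measurable N"
  using measurable_compose[OF measurable_Pair[OF assms(1) assms(2)] f_measurable] by simp

lemma penalized_measurable [measurable (raw)]:
  assumes [measurable]: "g \<in> N \<rightarrow>\<^sub>M M" "h \<in> borel_measurable N"
  shows "(\<lambda>s. penalized x (g s) (h s)) \<in> borel_measurable N"
  unfolding penalized_def by measurable

lemma penalized_lsc:
  assumes "t \<in> space M" "X \<longlonglongrightarrow> x" "W \<longlonglongrightarrow> w"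
  shows "penalized x t w \<le> liminf (\<lambda>n. penalized (X n) t (W n))"
proof -
  have "(\<lambda>n. ennreal (K * norm (fst (W n) - X n) powr p)) \<longlonglongrightarrow> ennreal (K * norm (fst w - x) powr p)"
    using assms(2,3) p by (intro tendsto_ennrealI tendsto_mult tendsto_const tendsto_norm_powr tendsto_diff tendsto_fst)
  then have "liminf (\<lambda>n. ennreal (K * norm (fst (W n) - X n) powr p)) = ennreal (K * norm (fst w - x) powr p)"
    by (intro lim_imp_Liminf) auto
  then have "penalized x t w \<le> liminf (\<lambda>n. f t (W n)) + liminf (\<lambda>n. ennreal (K * norm (fst (W n) - X n) powr p))"
    unfolding penalized_def using f_lsc[OF assms(1,3)] by (intro add_mono) auto
  also have "\<dots> \<le> liminf (\<lambda>n. penalized (X n) t (W n))"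
    unfolding penalized_def by (rule liminf_add_ennreal_le)
  finally show ?thesis .
qed

text \<open>
Almost everywhere convergence and Fatou's lemma give all three semicontinuity statements.
\<close>

lemma feasible_complete:
  assumes Z: "\<And>n. Z n \<in> feasible"
    and gauge: "\<And>n. gauge (Z (Suc n)) (Z n) \<le> ennreal (c * (1 / 8) ^ n)" and c: "0 \<le> c"
  shows "\<exists>z\<in>feasible. objective z \<le> liminf (\<lambda>n. objective (Z n)) \<and>
     (\<forall>i. gauge z (Z i) \<le> liminf (\<lambda>n. gauge (Z n) (Z i)))"
proof -
  define X Y where "X n = fst (Z n)" and "Y n = snd (Z n)" for n
  have [measurable]: "Y n \<in> borel_measurable M" and X_le: "norm (X n - xbar) \<le> r"
    and Y_le: "(\<integral>\<^sup>+t. ennreal (norm (snd (Y n t) - ybar t)) \<partial>M) \<le> ennreal r" for n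
    using Z[of n] unfolding feasible_def X_def Y_def by (auto simp: case_prod_beta)
  have g: "ennreal (smooth_norm (X (Suc n) - X n)) \<le> ennreal (c * (1 / 8) ^ n)"
      "(\<integral>\<^sup>+t. ennreal (smooth_norm (Y (Suc n) t - Y n t)) \<partial>M) \<le> ennreal (c * (1 / 8) ^ n)" for n
    using gauge[of n] order_trans[OF _ gauge[of n]] unfolding gauge_def X_def Y_def
    by (simp_all add: add_increasing add_increasing2)
  have "smooth_norm (X (Suc n) - X n) \<le> c * (1 / 4) ^ n" for n
  proof -
    have "smooth_norm (X (Suc n) - X n) \<le> c * (1 / 8) ^ n" using g(1)[of n] c by simp
    also have "\<dots> \<le> c * (1 / 4) ^ n" using c by (intro mult_left_mono power_mono) auto
    finally show ?thesis .
  qed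
  then have "convergent X" by (rule convergent_if_smooth_norm_increments_le)
  then obtain x where x: "X \<longlonglongrightarrow> x" unfolding convergent_def by blast
  define Y' where "Y' t = lim (\<lambda>n. Y n t)" for t
  have [measurable]: "Y' \<in> borel_measurable M" unfolding Y'_def by (rule borel_measurable_lim_metric) measurable
  have lim: "AE t in M. (\<lambda>n. Y n t) \<longlonglongrightarrow> Y' t"
    using AE_convergent_if_smooth_norm_increments_le[OF _ g(2) c]
    unfolding Y'_def by (auto simp: convergent_LIMSEQ_iff)
  have fatou: "(\<integral>\<^sup>+t. F t \<partial>M) \<le> liminf (\<lambda>n. \<integral>\<^sup>+t. F' n t \<partial>M)"
    if "\<And>n. F' n \<in> borel_measurable M" and le: "AE t in M. F t \<le> liminf (\<lambda>n. F' n t)"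
    for F :: "'t \<Rightarrow> ennreal" and F'
  proof -
    have "(\<integral>\<^sup>+t. F t \<partial>M) \<le> (\<integral>\<^sup>+t. liminf (\<lambda>n. F' n t) \<partial>M)" by (rule nn_integral_mono_AE[OF le])
    also have "\<dots> \<le> liminf (\<lambda>n. \<integral>\<^sup>+t. F' n t \<partial>M)" by (rule nn_integral_liminf[OF that(1)])
    finally show ?thesis .
  qed
  have cont: "a \<le> liminf (\<lambda>n. ennreal (b n))" if "b \<longlonglongrightarrow> b'" "a = ennreal b'" for a b b'
  proof -
    have "liminf (\<lambda>n. ennreal (b n)) = ennreal b'"
      using that(1) by (intro lim_imp_Liminf tendsto_ennrealI) auto
    then show ?thesis using that(2) by simp
  qed
  have "norm (x - xbar) \<le> r"
    by (rule LIMSEQ_le_const2[of "\<lambda>n. norm (X n - xbar)"]) (use x X_le in \<open>auto intro!: tendsto_intros\<close>)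
  moreover have "(\<integral>\<^sup>+t. ennreal (norm (snd (Y' t) - ybar t)) \<partial>M) \<le> ennreal r"
  proof -
    have "(\<integral>\<^sup>+t. ennreal (norm (snd (Y' t) - ybar t)) \<partial>M) \<le> liminf (\<lambda>n. \<integral>\<^sup>+t. ennreal (norm (snd (Y n t) - ybar t)) \<partial>M)"
    proof (rule fatou)
      show "AE t in M. ennreal (norm (snd (Y' t) - ybar t)) \<le> liminf (\<lambda>n. ennreal (norm (snd (Y n t) - ybar t)))"
        using lim by eventually_elim (rule cont, auto intro!: tendsto_intros)
    qed measurable
    also have "\<dots> \<le> liminf (\<lambda>n::nat. ennreal r)" using Y_le by (intro Liminf_mono) auto
    finally show ?thesis by (simp add: Liminf_const)
  qed
  ultimately have "(x, Y') \<in> feasible" unfolding feasible_def by simp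
  moreover have "objective (x, Y') \<le> liminf (\<lambda>n. objective (Z n))"
  proof -
    have "objective (x, Y') \<le> liminf (\<lambda>n. \<integral>\<^sup>+t. penalized (X n) t (Y n t) \<partial>M)"
      unfolding objective_def fst_conv snd_conv
    proof (rule fatou)
      show "AE t in M. penalized x t (Y' t) \<le> liminf (\<lambda>n. penalized (X n) t (Y n t))"
        using lim AE_space by eventually_elim (rule penalized_lsc[OF _ x])
    qed measurable
    then show ?thesis unfolding objective_def X_def Y_def .
  qed
  moreover have "gauge (x, Y') (Z i) \<le> liminf (\<lambda>n. gauge (Z n) (Z i))" for i
  proof -
    have "gauge (x, Y') (Z i) \<le> liminf (\<lambda>n. ennreal (smooth_norm (X n - X i))) +
        liminf (\<lambda>n. \<integral>\<^sup>+t. ennreal (smooth_norm (Y n t - Y i t)) \<partial>M)"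
      unfolding gauge_def fst_conv snd_conv X_def[symmetric] Y_def[symmetric]
    proof (rule add_mono)
      show "ennreal (smooth_norm (x - X i)) \<le> liminf (\<lambda>n. ennreal (smooth_norm (X n - X i)))"
        by (rule cont[OF tendsto_smooth_norm[OF tendsto_diff[OF x tendsto_const]] refl])
      show "(\<integral>\<^sup>+t. ennreal (smooth_norm (Y' t - Y i t)) \<partial>M)
          \<le> liminf (\<lambda>n. \<integral>\<^sup>+t. ennreal (smooth_norm (Y n t - Y i t)) \<partial>M)"
      proof (rule fatou)
        show "AE t in M. ennreal (smooth_norm (Y' t - Y i t)) \<le> liminf (\<lambda>n. ennreal (smooth_norm (Y n t - Y i t)))"
          using lim by eventually_elim (rule cont[OF tendsto_smooth_norm[OF tendsto_diff[OF _ tendsto_const]] refl])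
      qed measurable
    qed
    also have "\<dots> \<le> liminf (\<lambda>n. gauge (Z n) (Z i))"
      unfolding gauge_def X_def Y_def by (rule liminf_add_ennreal_le)
    finally show ?thesis .
  qed
  ultimately show ?thesis by blast
qed

text \<open>
The gauge terms of the variational principle, moved under the integral sign.
\<close>

definition perturbed :: "real \<Rightarrow> (nat \<Rightarrow> 'a \<times> ('t \<Rightarrow> 'a \<times> 'b)) \<Rightarrow> 'a \<Rightarrow> 't \<Rightarrow> 'a \<times> 'b \<Rightarrow> ennreal" where
  "perturbed d Z x t w = penalized x t w + perturbation d (\<lambda>n. snd (Z n) t) w"

definition perturbed_objective :: "real \<Rightarrow> (nat \<Rightarrow> 'a \<times> ('t \<Rightarrow> 'a \<times> 'b)) \<Rightarrow> 'a \<times> ('t \<Rightarrow> 'a \<times> 'b) \<Rightarrow> ennreal" where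
  "perturbed_objective d Z u =
     (\<integral>\<^sup>+t. perturbed d Z (fst u) t (snd u t) \<partial>M) + perturbation d (\<lambda>n. fst (Z n)) (fst u)"

lemma feasible_measurable: "z \<in> feasible \<Longrightarrow> snd z \<in> borel_measurable M"
  unfolding feasible_def by auto

lemma perturbed_measurable [measurable (raw)]:
  assumes Z: "\<And>n. snd (Z n) \<in> borel_measurable M" and [measurable]: "g \<in> N \<rightarrow>\<^sub>M M" "h \<in> borel_measurable N"
  shows "(\<lambda>s. perturbed d Z x (g s) (h s)) \<in> borel_measurable N"
proof -
  have [measurable]: "(\<lambda>s. snd (Z n) (g s)) \<in> borel_measurable N" for n
    by (rule measurable_compose[OF assms(2) Z])
  show ?thesis unfolding perturbed_def by measurable
qed

lemma perturbed_objective_eq: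
  assumes "0 \<le> d" "\<And>n. Z n \<in> feasible" "u \<in> feasible"
  shows "objective u + (\<Sum>n. ennreal (d * (1 / 2) ^ n) * gauge u (Z n)) = perturbed_objective d Z u"
proof -
  note [measurable] = feasible_measurable[OF assms(2)] feasible_measurable[OF assms(3)]
  let ?w = "\<lambda>n. d * (1 / 2 :: real) ^ n"
  have "ennreal (?w n) * gauge u (Z n) = ennreal (?w n * smooth_norm (fst u - fst (Z n))) +
      (\<integral>\<^sup>+t. ennreal (?w n * smooth_norm (snd u t - snd (Z n) t)) \<partial>M)" for n
    unfolding gauge_def using assms(1)
    by (simp add: distrib_left ennreal_mult nn_integral_cmult)
  then have "(\<Sum>n. ennreal (?w n) * gauge u (Z n)) = perturbation d (\<lambda>n. fst (Z n)) (fst u) +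
      (\<Sum>n. \<integral>\<^sup>+t. ennreal (?w n * smooth_norm (snd u t - snd (Z n) t)) \<partial>M)"
    unfolding perturbation_def by (simp add: suminf_add[symmetric])
  also have "(\<Sum>n. \<integral>\<^sup>+t. ennreal (?w n * smooth_norm (snd u t - snd (Z n) t)) \<partial>M)
      = (\<integral>\<^sup>+t. perturbation d (\<lambda>n. snd (Z n) t) (snd u t) \<partial>M)"
    unfolding perturbation_def by (rule nn_integral_suminf[symmetric]) measurable
  finally show ?thesis
    unfolding perturbed_objective_def perturbed_def objective_def
    by (simp add: nn_integral_add ac_simps)
qed

lemma perturbed_minimizer:
  assumes z0: "z0 \<in> feasible" "objective z0 < \<infinity>" "\<And>u. u \<in> feasible \<Longrightarrow> objective z0 \<le> objective u + ennreal e"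
    and d: "0 < d" and e: "0 < e"
  obtains Z z where "\<And>n. Z n \<in> feasible" "z \<in> feasible" "gauge z z0 \<le> ennreal (e / d)"
    "perturbed_objective d Z z \<le> objective z0"
    "\<And>u. u \<in> feasible \<Longrightarrow> perturbed_objective d Z z \<le> perturbed_objective d Z u"
proof -
  let ?\<delta> = "\<lambda>n. d * (1 / 2 :: real) ^ n" and ?\<eta> = "\<lambda>n. e * (1 / 16 :: real) ^ n"
  obtain Z z where Z: "\<And>n. Z n \<in> feasible" "z \<in> feasible"
      "objective z + (\<Sum>n. ennreal (?\<delta> n) * gauge z (Z n)) \<le> objective z0"
      "ennreal (?\<delta> 0) * gauge z z0 \<le> ennreal (?\<eta> 0)"
      "\<And>u. u \<in> feasible \<Longrightarrow> objective z + (\<Sum>n. ennreal (?\<delta> n) * gauge z (Z n))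
         \<le> objective u + (\<Sum>n. ennreal (?\<delta> n) * gauge u (Z n))"
  proof (rule variational_principle[of z0 feasible objective ?\<eta> gauge ?\<delta>])
    show "z0 \<in> feasible" "objective z0 < \<infinity>" by fact+
    show "objective z0 \<le> objective u + ennreal (?\<eta> 0)" if "u \<in> feasible" for u using z0(3)[OF that] by simp
    show "0 < ?\<eta> n" for n using e by simp
    show "?\<eta> \<longlonglongrightarrow> 0" by (intro tendsto_mult_right_zero LIMSEQ_realpow_zero) auto
    show "gauge z z = 0" for z unfolding gauge_def by simp
  next
    fix Z assume Z: "\<And>n. Z n \<in> feasible"
      and cauchy: "\<And>m n. n \<le> m \<Longrightarrow> ennreal (?\<delta> n) * gauge (Z m) (Z n) \<le> ennreal (?\<eta> n)"
    have "gauge (Z (Suc n)) (Z n) \<le> ennreal (e / d * (1 / 8) ^ n)" for n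
    proof -
      have "gauge (Z (Suc n)) (Z n) \<le> ennreal (?\<eta> n / ?\<delta> n)"
        using cauchy[of n "Suc n"] d by (intro ennreal_mult_leD) auto
      also have "?\<eta> n / ?\<delta> n = e / d * ((1 / 16) ^ n / (1 / 2) ^ n)" by simp
      also have "(1 / 16 :: real) ^ n / (1 / 2) ^ n = (1 / 8) ^ n" by (simp flip: power_divide)
      finally show ?thesis .
    qed
    then show "\<exists>z\<in>feasible. objective z \<le> liminf (\<lambda>n. objective (Z n)) \<and>
         (\<forall>i. gauge z (Z i) \<le> liminf (\<lambda>n. gauge (Z n) (Z i)))"
      using d e by (intro feasible_complete[OF Z, where c = "e / d"]) auto
  qed (rule that)
  note eq = perturbed_objective_eq[OF less_imp_le[OF d] Z(1)]
  show thesis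
  proof (rule that[OF Z(1,2)])
    show "gauge z z0 \<le> ennreal (e / d)" using Z(4) d by (intro ennreal_mult_leD) auto
    show "perturbed_objective d Z z \<le> objective z0" using Z(3) unfolding eq[OF Z(2)] .
    show "perturbed_objective d Z z \<le> perturbed_objective d Z u" if "u \<in> feasible" for u
      using Z(5)[OF that] unfolding eq[OF Z(2)] eq[OF that] .
  qed
qed

text \<open>
If better points within distance \<open>\<rho>\<close> existed on a set of positive measure, a measurable selection of them would yield a
better function, and the assumption on \<open>\<rho>\<close> keeps that function feasible.
\<close>

lemma AE_pointwise_local_minimizer:
  assumes Z: "\<And>n. Z n \<in> feasible" and z: "(x, Y) \<in> feasible"
    and fin: "perturbed_objective d Z (x, Y) < \<infinity>"
    and min: "\<And>u. u \<in> feasible \<Longrightarrow> perturbed_objective d Z (x, Y) \<le> perturbed_objective d Z u"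
    and \<rho>: "0 \<le> \<rho>" "(\<integral>\<^sup>+t. ennreal (norm (snd (Y t) - ybar t)) \<partial>M) + ennreal \<rho> * emeasure M (space M) \<le> ennreal r"
  shows "AE t in M. \<forall>v. norm v \<le> \<rho> \<longrightarrow> perturbed d Z x t (Y t) \<le> perturbed d Z x t (Y t + v)"
proof -
  note [measurable] = feasible_measurable[OF Z]
  have [measurable]: "Y \<in> borel_measurable M" using feasible_measurable[OF z] by simp
  define S where "S = {s \<in> space (M \<Otimes>\<^sub>M borel). norm (snd s) \<le> \<rho> \<and>
      perturbed d Z x (fst s) (Y (fst s) + snd s) < perturbed d Z x (fst s) (Y (fst s))}"
  have "AE t in M. \<forall>v. (t, v) \<notin> S"
  proof (rule AE_no_section_if_no_selection)
    show "finite_measure M" by unfold_locales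
    show "S \<in> sets (M \<Otimes>\<^sub>M borel)" unfolding S_def by measurable
    show "S \<subseteq> space M \<times> cball 0 \<rho>" unfolding S_def by (auto simp: space_pair_measure)
    show "compact (cball (0 :: 'a \<times> 'b) \<rho>)" by simp
  next
    fix A u assume A: "A \<in> sets M" and [measurable]: "u \<in> borel_measurable M"
      and sel: "\<And>t. t \<in> A \<Longrightarrow> (t, u t) \<in> S"
    note [measurable] = A
    define Y' where "Y' t = (if t \<in> A then Y t + u t else Y t)" for t
    have Y'_m [measurable]: "Y' \<in> borel_measurable M" unfolding Y'_def by measurable
    have "(\<integral>\<^sup>+t. ennreal (norm (snd (Y' t) - ybar t)) \<partial>M)
        \<le> (\<integral>\<^sup>+t. ennreal (norm (snd (Y t) - ybar t)) + ennreal \<rho> \<partial>M)"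
    proof (rule nn_integral_mono)
      fix t
      have "norm (snd (Y' t) - ybar t) \<le> norm (snd (Y t) - ybar t) + \<rho>"
      proof (cases "t \<in> A")
        case True
        have "norm (snd (u t)) \<le> norm (u t)" using norm_snd_le[of "snd (u t)" "fst (u t)"] by simp
        also have "\<dots> \<le> \<rho>" using sel[OF True] unfolding S_def by simp
        finally show ?thesis
          using True norm_triangle_ineq[of "snd (Y t) - ybar t" "snd (u t)"] unfolding Y'_def
          by (simp add: algebra_simps)
      qed (use \<rho> in \<open>simp add: Y'_def\<close>)
      then show "ennreal (norm (snd (Y' t) - ybar t)) \<le> ennreal (norm (snd (Y t) - ybar t)) + ennreal \<rho>"
        using \<rho>(1) by (simp flip: ennreal_plus)
    qed
    also have "\<dots> = (\<integral>\<^sup>+t. ennreal (norm (snd (Y t) - ybar t)) \<partial>M) + ennreal \<rho> * emeasure M (space M)"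
      by (subst nn_integral_add) auto
    also note \<rho>(2)
    finally have "(x, Y') \<in> feasible" using z unfolding feasible_def by simp
    from min[OF this] fin
    have le: "(\<integral>\<^sup>+t. perturbed d Z x t (Y t) \<partial>M) \<le> (\<integral>\<^sup>+t. perturbed d Z x t (Y' t) \<partial>M)"
      unfolding perturbed_objective_def by (auto simp: add.commute[of _ "perturbation d _ _"] ennreal_add_left_cancel_le)
    have less: "perturbed d Z x t (Y' t) < perturbed d Z x t (Y t)" if "t \<in> A" for t
      using sel[OF that] that unfolding S_def Y'_def by simp
    have AE_le: "AE t in M. perturbed d Z x t (Y' t) \<le> perturbed d Z x t (Y t)"
      by (rule AE_I2) (metis Y'_def less less_imp_le order_refl)
    have "(\<integral>\<^sup>+t. perturbed d Z x t (Y' t) \<partial>M) \<noteq> \<infinity>"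
      using nn_integral_mono_AE[OF AE_le] fin unfolding perturbed_objective_def
      by (auto simp: top_unique)
    then have "AE t in M. perturbed d Z x t (Y t) \<le> perturbed d Z x t (Y' t)"
      using nn_integral_less[OF _ _ _ AE_le] le by (auto simp: not_less[symmetric])
    then have "AE t in M. t \<notin> A" by eventually_elim (use less in force)
    then show "emeasure M A = 0" using A AE_iff_measurable[of A M "\<lambda>t. t \<notin> A"] sets.sets_into_space[OF A] by auto
  qed
  then show ?thesis
  proof (rule AE_mp[OF _ AE_I2], intro impI allI)
    fix t and v :: "'a \<times> 'b" assume t: "t \<in> space M" "\<forall>v. (t, v) \<notin> S" "norm v \<le> \<rho>"
    then have "(t, v) \<notin> S" by blast
    then show "perturbed d Z x t (Y t) \<le> perturbed d Z x t (Y t + v)"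
      using t(1,3) unfolding S_def by (simp add: space_pair_measure not_less)
  qed
qed

text \<open>
The constant \<open>c\<close> undoes the shift that makes the integrand nonnegative.
\<close>

lemma subdifferential_at_pointwise_local_minimizer:
  assumes d: "0 \<le> d" and \<rho>: "0 < \<rho>"
    and min: "\<And>v. norm v \<le> \<rho> \<Longrightarrow> perturbed d Z x t w \<le> perturbed d Z x t (w + v)"
    and fin: "perturbed d Z x t w < \<infinity>"
  shows "- ((K *\<^sub>R norm_powr_grad p (fst w - x), 0) + perturbation_grad d (\<lambda>n. snd (Z n) t) w)
      \<in> regular_subdifferential (\<lambda>w. enn2ereal (f t w) - ereal c) w"
proof -
  define e where "e = perturbation_grad d (\<lambda>n. snd (Z n) t) w"
  define U where "U = fst w - x"
  define \<theta> where "\<theta> v = K * (norm (U + fst v) powr p - norm U powr p) + e \<bullet> v + d * (norm v)\<^sup>2" for v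
  have "f t w < top" "perturbation d (\<lambda>n. snd (Z n) t) w < top"
    using fin unfolding perturbed_def penalized_def by (simp_all add: less_top)
  then obtain a s where a: "0 \<le> a" "f t w = ennreal a" and s: "0 \<le> s" "perturbation d (\<lambda>n. snd (Z n) t) w = ennreal s"
    using less_top_ennreal by metis
  note quad = perturbation_quadratic_bound[OF d s(2,1), folded e_def]
  have supp: "enn2ereal (f t w) - ereal c \<le> enn2ereal (f t (w + v)) - ereal c + ereal (\<theta> v)"
    if v: "norm v \<le> \<rho>" for v
  proof (cases "f t (w + v) = top")
    case True
    then show ?thesis by (simp add: top_ereal_def)
  next
    case False
    then obtain b where b: "0 \<le> b" "f t (w + v) = ennreal b"
      using less_top_ennreal[of "f t (w + v)"] less_top by blast
    define A where "A = K * norm U powr p"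
    define B where "B = K * norm (U + fst v) powr p"
    define q where "q = s + e \<bullet> v + d * (norm v)\<^sup>2"
    have AB: "0 \<le> A" "0 \<le> B" unfolding A_def B_def using K by simp_all
    have q: "0 \<le> q" "perturbation d (\<lambda>n. snd (Z n) t) (w + v) \<le> ennreal q" using quad[of v] unfolding q_def by simp_all
    have arg: "fst (w + v) - x = U + fst v" unfolding U_def by simp
    have "ennreal (a + A + s) = perturbed d Z x t w"
      unfolding perturbed_def penalized_def a(2) s(2) U_def[symmetric] A_def[symmetric]
      using a(1) AB(1) s(1) by simp
    also have "\<dots> \<le> perturbed d Z x t (w + v)" by (rule min[OF v])
    also have "\<dots> \<le> ennreal b + ennreal B + ennreal q"
      unfolding perturbed_def penalized_def b(2) arg B_def[symmetric] by (intro add_left_mono q(2))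
    also have "\<dots> = ennreal (b + B + q)" using b(1) AB(2) q(1) by simp
    finally have "a + A + s \<le> b + B + q" using b(1) AB(2) q(1) by (subst (asm) ennreal_le_iff) simp_all
    then have "a - c \<le> b - c + \<theta> v" unfolding \<theta>_def q_def A_def B_def by (simp add: algebra_simps)
    then show ?thesis unfolding a(2) b(2) using a(1) b(1) by simp
  qed
  have deriv: "(\<theta> has_derivative (\<lambda>v. ((K *\<^sub>R norm_powr_grad p U, 0) + e) \<bullet> v)) (at 0)"
  proof -
    have "((\<lambda>v :: 'a \<times> 'b. U + fst v) has_derivative fst) (at 0)"
      by (auto intro!: derivative_eq_intros)
    moreover have "((\<lambda>u. norm u powr p) has_derivative (\<lambda>h. norm_powr_grad p U \<bullet> h)) (at (U + fst (0 :: 'a \<times> 'b)))"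
      using has_derivative_norm_powr[OF p, of U] by simp
    ultimately have 1: "((\<lambda>v :: 'a \<times> 'b. norm (U + fst v) powr p) has_derivative (\<lambda>v. norm_powr_grad p U \<bullet> fst v)) (at 0)"
      by (rule has_derivative_compose)
    have 2: "((\<lambda>v :: 'a \<times> 'b. (norm v)\<^sup>2) has_derivative (\<lambda>v. 0)) (at 0)"
      unfolding power2_norm_eq_inner by (auto intro!: derivative_eq_intros)
    show ?thesis
      unfolding \<theta>_def
      by (rule has_derivative_eq_rhs, (rule derivative_intros 1 2)+)
        (auto simp: fun_eq_iff inner_prod_def inner_add_left algebra_simps)
  qed
  have "- ((K *\<^sub>R norm_powr_grad p U, 0) + e) \<in> regular_subdifferential (\<lambda>w. enn2ereal (f t w) - ereal c) w"
  proof (rule regular_subdifferential_if_supported[OF _ \<rho> supp _ deriv])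
    show "\<bar>enn2ereal (f t w) - ereal c\<bar> \<noteq> \<infinity>" using a by simp
    show "\<theta> 0 = 0" unfolding \<theta>_def by simp
  qed
  then show ?thesis unfolding e_def U_def .
qed

lemma penalty_integrable:
  fixes Y :: "'t \<Rightarrow> 'a \<times> 'b"
  assumes [measurable]: "Y \<in> borel_measurable M" and "(\<integral>\<^sup>+t. ennreal (K * norm (fst (Y t) - x) powr p) \<partial>M) < \<infinity>"
  shows "integrable M (\<lambda>t. norm (fst (Y t) - x) powr p)"
proof -
  have "integrable M (\<lambda>t. K * norm (fst (Y t) - x) powr p)"
  proof (rule integrableI_bounded)
    show "(\<lambda>t. K * norm (fst (Y t) - x) powr p) \<in> borel_measurable M" by measurable
    show "(\<integral>\<^sup>+t. ennreal (norm (K * norm (fst (Y t) - x) powr p)) \<partial>M) < \<infinity>"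
      using K assms(2) by (simp add: abs_mult)
  qed
  then have "integrable M (\<lambda>t. (1 / K) * (K * norm (fst (Y t) - x) powr p))" by (rule integrable_mult_right)
  then show ?thesis using K by simp
qed

text \<open>
With \<open>Y\<close> frozen, \<open>x\<close> enters only through the penalty and a perturbation that is Lipschitz with
constant \<open>2 * d\<close>. The distance to the boundary of the ball leaves room for variations of \<open>x\<close>.
\<close>

lemma penalty_gradient_bound:
  assumes Z: "\<And>n. Z n \<in> feasible" and z: "(x, Y) \<in> feasible" and d: "0 \<le> d"
    and fin: "perturbed_objective d Z (x, Y) < \<infinity>"
    and min: "\<And>u. u \<in> feasible \<Longrightarrow> perturbed_objective d Z (x, Y) \<le> perturbed_objective d Z u"
    and x: "norm (x - xbar) < r"
  shows "norm (K *\<^sub>R (\<integral>t. norm_powr_grad p (fst (Y t) - x) \<partial>M)) \<le> 2 * d"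
proof -
  note [measurable] = feasible_measurable[OF Z]
  have [measurable]: "Y \<in> borel_measurable M" using feasible_measurable[OF z] by simp
  have [measurable]: "(\<lambda>t. snd (Z n) t) \<in> borel_measurable M" for n by (rule feasible_measurable[OF Z])
  define B where "B = (\<integral>\<^sup>+t. f t (Y t) + perturbation d (\<lambda>n. snd (Z n) t) (Y t) \<partial>M)"
  define P where "P = perturbation d (\<lambda>n. fst (Z n)) x"
  have split: "perturbed_objective d Z (x', Y) =
      B + (\<integral>\<^sup>+t. ennreal (K * norm (fst (Y t) - x') powr p) \<partial>M) + perturbation d (\<lambda>n. fst (Z n)) x'" for x'
  proof -
    have "(\<integral>\<^sup>+t. perturbed d Z x' t (Y t) \<partial>M) =
        (\<integral>\<^sup>+t. (f t (Y t) + perturbation d (\<lambda>n. snd (Z n) t) (Y t)) + ennreal (K * norm (fst (Y t) - x') powr p) \<partial>M)"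
      unfolding perturbed_def penalized_def by (simp add: ac_simps)
    also have "\<dots> = B + (\<integral>\<^sup>+t. ennreal (K * norm (fst (Y t) - x') powr p) \<partial>M)"
      unfolding B_def by (rule nn_integral_add) measurable
    finally show ?thesis unfolding perturbed_objective_def by simp
  qed
  have fins: "B < top" "(\<integral>\<^sup>+t. ennreal (K * norm (fst (Y t) - x) powr p) \<partial>M) < \<infinity>" "P < top"
    using fin unfolding split P_def by (simp_all add: less_top)
  have int: "integrable M (\<lambda>t. norm (fst (Y t) - x) powr p)"
    by (rule penalty_integrable) (use fins in auto)
  show ?thesis
  proof (rule norm_integral_norm_powr_grad_le[where \<rho> = "r - norm (x - xbar)"])
    show "1 < p" "0 < K" by (fact p, fact K)
    show "integrable M (\<lambda>t. norm (fst (Y t) - x) powr p)" by (fact int)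
    show "0 < r - norm (x - xbar)" using x by simp
  next
    fix v :: 'a assume v: "norm v \<le> r - norm (x - xbar)"
    have arg: "fst (Y t) - (x + v) = fst (Y t) - x - v" for t by simp
    have int_v: "integrable M (\<lambda>t. norm (fst (Y t) - x - v) powr p)"
      using integrable_norm_add_powr[of "\<lambda>t. fst (Y t) - x" "\<lambda>_. - v" p] int p by simp
    have nn: "(\<integral>\<^sup>+t. ennreal (K * norm (U t) powr p) \<partial>M) = ennreal (K * (\<integral>t. norm (U t) powr p \<partial>M))"
      if "integrable M (\<lambda>t. norm (U t) powr p)" for U :: "'t \<Rightarrow> 'a"
      using that K by (subst nn_integral_eq_integral) auto
    have "norm (x + v - xbar) \<le> norm (x - xbar) + norm v"
      using norm_triangle_ineq[of "x - xbar" v] by (simp add: algebra_simps)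
    then have "(x + v, Y) \<in> feasible" using z v unfolding feasible_def by simp
    from min[OF this]
    have "B + ennreal (K * (\<integral>t. norm (fst (Y t) - x) powr p \<partial>M)) + P
        \<le> B + ennreal (K * (\<integral>t. norm (fst (Y t) - x - v) powr p \<partial>M)) + perturbation d (\<lambda>n. fst (Z n)) (x + v)"
      unfolding split arg nn[OF int] nn[OF int_v] P_def .
    also have "\<dots> \<le> B + ennreal (K * (\<integral>t. norm (fst (Y t) - x - v) powr p \<partial>M)) + (P + ennreal (2 * d * norm v))"
      unfolding P_def by (intro add_left_mono perturbation_add_le d)
    finally have "(B + P) + ennreal (K * (\<integral>t. norm (fst (Y t) - x) powr p \<partial>M))
        \<le> (B + P) + (ennreal (K * (\<integral>t. norm (fst (Y t) - x - v) powr p \<partial>M)) + ennreal (2 * d * norm v))"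
      by (simp add: ac_simps)
    then have "ennreal (K * (\<integral>t. norm (fst (Y t) - x) powr p \<partial>M))
        \<le> ennreal (K * (\<integral>t. norm (fst (Y t) - x - v) powr p \<partial>M)) + ennreal (2 * d * norm v)"
      using fins(1,3) by (auto simp: ennreal_add_left_cancel_le)
    also have "\<dots> = ennreal (K * (\<integral>t. norm (fst (Y t) - x - v) powr p \<partial>M) + 2 * d * norm v)"
      using K d by (intro ennreal_plus[symmetric]) auto
    finally show "K * (\<integral>t. norm (fst (Y t) - x) powr p \<partial>M)
        \<le> K * (\<integral>t. norm (fst (Y t) - x - v) powr p \<partial>M) + 2 * d * norm v"
      using K d by (subst (asm) ennreal_le_iff) auto
  qed measurable
qed

text \<open>
The variational principle with weight \<open>\<tau>\<close> and error \<open>\<tau> ^ 3\<close>, which leaves a gauge of at most \<open>\<tau>\<^sup>2\<close>. The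
upper bound on \<open>\<tau>\<close> keeps the minimiser in the interior of both balls.
\<close>

lemma penalized_stationary_point:
  fixes \<tau> :: real
  defines "z0 \<equiv> (xbar, \<lambda>t. (xbar, ybar t))"
  assumes \<tau>: "0 < \<tau>" "\<tau>\<^sup>2 + \<tau> + \<tau> / 2 * (1 + measure M (space M)) < r"
    and fin: "(\<integral>\<^sup>+t. f t (xbar, ybar t) \<partial>M) < \<infinity>"
    and near: "\<And>u. u \<in> feasible \<Longrightarrow> (\<integral>\<^sup>+t. f t (xbar, ybar t) \<partial>M) \<le> objective u + ennreal (\<tau> ^ 3)"
  obtains x Y e where "(x, Y) \<in> feasible" "smooth_norm (x - xbar) \<le> \<tau>\<^sup>2"
    "(\<integral>\<^sup>+t. ennreal (smooth_norm (Y t - (xbar, ybar t))) \<partial>M) \<le> ennreal (\<tau>\<^sup>2)"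
    "objective (x, Y) \<le> (\<integral>\<^sup>+t. f t (xbar, ybar t) \<partial>M)"
    "e \<in> borel_measurable M" "\<And>t. norm (e t) \<le> 2 * \<tau>"
    "norm (K *\<^sub>R (\<integral>t. norm_powr_grad p (fst (Y t) - x) \<partial>M)) \<le> 2 * \<tau>"
    "AE t in M. \<forall>c. - ((K *\<^sub>R norm_powr_grad p (fst (Y t) - x), 0) + e t)
      \<in> regular_subdifferential (\<lambda>w. enn2ereal (f t w) - ereal c) (Y t)"
proof -
  define m where "m = measure M (space M)"
  have m: "0 \<le> m" unfolding m_def by simp
  have z0_m [measurable]: "(\<lambda>t. (xbar, ybar t)) \<in> borel_measurable M" by (intro borel_measurable_Pair) auto
  have z0: "z0 \<in> feasible" unfolding feasible_def z0_def using r z0_m by simp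
  have obj0: "objective z0 = (\<integral>\<^sup>+t. f t (xbar, ybar t) \<partial>M)"
    unfolding objective_def z0_def penalized_def by simp
  have \<tau>3: "0 < \<tau> ^ 3" "\<tau> ^ 3 / \<tau> = \<tau>\<^sup>2" using \<tau>(1) by (simp_all add: power2_eq_square power3_eq_cube)
  have near0: "objective z0 \<le> objective u + ennreal (\<tau> ^ 3)" if "u \<in> feasible" for u
    unfolding obj0 by (rule near[OF that])
  have fin0: "objective z0 < \<infinity>" unfolding obj0 by (rule fin)
  obtain Z z where Z: "\<And>n. Z n \<in> feasible" and z: "z \<in> feasible" "gauge z z0 \<le> ennreal (\<tau> ^ 3 / \<tau>)"
    "perturbed_objective \<tau> Z z \<le> objective z0"
    "\<And>u. u \<in> feasible \<Longrightarrow> perturbed_objective \<tau> Z z \<le> perturbed_objective \<tau> Z u"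
    by (rule perturbed_minimizer[OF z0 fin0 near0 \<tau>(1) \<tau>3(1)]) blast+
  have gauge_z: "gauge z z0 \<le> ennreal (\<tau>\<^sup>2)" using z(2) unfolding \<tau>3(2) .
  define x Y where "x = fst z" and "Y = snd z"
  have zx: "z = (x, Y)" unfolding x_def Y_def by simp
  note [measurable] = feasible_measurable[OF Z]
  have [measurable]: "Y \<in> borel_measurable M" using feasible_measurable[OF z(1)] unfolding Y_def .
  have [measurable]: "(\<lambda>t. snd (Z n) t) \<in> borel_measurable M" for n by (rule feasible_measurable[OF Z])
  have finz: "perturbed_objective \<tau> Z (x, Y) < \<infinity>"
    using z(3) fin unfolding zx obj0 by (rule le_less_trans)
  have g: "ennreal (smooth_norm (x - xbar)) \<le> ennreal (\<tau>\<^sup>2)"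
    "(\<integral>\<^sup>+t. ennreal (smooth_norm (Y t - (xbar, ybar t))) \<partial>M) \<le> ennreal (\<tau>\<^sup>2)"
    using gauge_z order_trans[OF _ gauge_z] unfolding gauge_def z0_def zx fst_conv snd_conv
    by (simp_all add: add_increasing add_increasing2)
  have gx: "smooth_norm (x - xbar) \<le> \<tau>\<^sup>2" using g(1) by simp
  have "norm (x - xbar) \<le> (1 + 1 / \<tau>) * smooth_norm (x - xbar) + \<tau> / 2"
    by (rule norm_le_smooth_norm[OF \<tau>(1)])
  also have "\<dots> \<le> (1 + 1 / \<tau>) * \<tau>\<^sup>2 + \<tau> / 2" using \<tau>(1) gx by (intro add_right_mono mult_left_mono) auto
  also have "\<dots> = \<tau>\<^sup>2 + \<tau> + \<tau> / 2" using \<tau>(1) by (simp add: field_simps power2_eq_square)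
  also have "\<dots> \<le> \<tau>\<^sup>2 + \<tau> + \<tau> / 2 * (1 + m)" using \<tau>(1) m by simp
  finally have xr: "norm (x - xbar) < r" using \<tau>(2) unfolding m_def by simp
  define \<rho> where "\<rho> = (r - (\<tau>\<^sup>2 + \<tau> + \<tau> / 2 * (1 + m))) / (1 + m)"
  have \<rho>: "0 < \<rho>" unfolding \<rho>_def using \<tau>(2) m unfolding m_def[symmetric] by simp
  have "\<rho> * (1 + m) = r - (\<tau>\<^sup>2 + \<tau> + \<tau> / 2 * (1 + m))" unfolding \<rho>_def using m by simp
  then have "\<rho> + \<rho> * m = r - (\<tau>\<^sup>2 + \<tau> + (\<tau> / 2 + \<tau> / 2 * m))" by (simp only: distrib_left mult_1_right)
  then have \<rho>m: "\<tau>\<^sup>2 + \<tau> + \<tau> / 2 * m + \<rho> * m \<le> r" using \<rho> \<tau>(1) by linarith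
  have y: "(\<integral>\<^sup>+t. ennreal (norm (snd (Y t) - ybar t)) \<partial>M) \<le> ennreal (\<tau>\<^sup>2 + \<tau> + \<tau> / 2 * m)"
    unfolding m_def by (rule norm_snd_integral_le_smooth_norm[OF _ z0_m \<tau>(1) g(2)]) measurable
  have "(\<integral>\<^sup>+t. ennreal (norm (snd (Y t) - ybar t)) \<partial>M) + ennreal \<rho> * emeasure M (space M)
      \<le> ennreal (\<tau>\<^sup>2 + \<tau> + \<tau> / 2 * m) + ennreal \<rho> * ennreal m"
    unfolding emeasure_eq_measure m_def[symmetric] by (intro add_right_mono y)
  also have "\<dots> = ennreal (\<tau>\<^sup>2 + \<tau> + \<tau> / 2 * m + \<rho> * m)"
  proof -
    have "ennreal \<rho> * ennreal m = ennreal (\<rho> * m)" using \<rho> m by (intro ennreal_mult[symmetric]) auto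
    then show ?thesis using \<rho> \<tau>(1) m by (subst ennreal_plus) auto
  qed
  also have "\<dots> \<le> ennreal r" using \<rho>m by (rule ennreal_leI)
  finally have room: "(\<integral>\<^sup>+t. ennreal (norm (snd (Y t) - ybar t)) \<partial>M) + ennreal \<rho> * emeasure M (space M) \<le> ennreal r" .
  have locmin: "AE t in M. \<forall>v. norm v \<le> \<rho> \<longrightarrow> perturbed \<tau> Z x t (Y t) \<le> perturbed \<tau> Z x t (Y t + v)"
    by (rule AE_pointwise_local_minimizer[OF Z _ finz _ _ room]) (use z zx \<rho> in auto)
  have "(\<integral>\<^sup>+t. perturbed \<tau> Z x t (Y t) \<partial>M) \<noteq> \<infinity>"
    using finz unfolding perturbed_objective_def by auto
  then have "AE t in M. perturbed \<tau> Z x t (Y t) \<noteq> \<infinity>"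
    by (intro nn_integral_PInf_AE) measurable
  with locmin have sub: "AE t in M. \<forall>c. - ((K *\<^sub>R norm_powr_grad p (fst (Y t) - x), 0) + perturbation_grad \<tau> (\<lambda>n. snd (Z n) t) (Y t))
      \<in> regular_subdifferential (\<lambda>w. enn2ereal (f t w) - ereal c) (Y t)"
  proof eventually_elim
    case (elim t)
    show ?case
      by (intro allI subdifferential_at_pointwise_local_minimizer[OF _ \<rho>])
        (use elim \<tau>(1) in \<open>auto simp: less_top\<close>)
  qed
  show thesis
  proof (rule that[where x = x and Y = Y, OF _ gx g(2) _ _ _ _ sub])
    show "(x, Y) \<in> feasible" using z(1) unfolding zx .
    have "objective (x, Y) \<le> perturbed_objective \<tau> Z (x, Y)"
      unfolding objective_def perturbed_objective_def perturbed_def fst_conv snd_conv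
      by (intro add_increasing2 nn_integral_mono) auto
    then show "objective (x, Y) \<le> (\<integral>\<^sup>+t. f t (xbar, ybar t) \<partial>M)"
      using z(3) unfolding zx obj0 by (rule order_trans)
    show "(\<lambda>t. perturbation_grad \<tau> (\<lambda>n. snd (Z n) t) (Y t)) \<in> borel_measurable M" by measurable
    show "norm (perturbation_grad \<tau> (\<lambda>n. snd (Z n) t) (Y t)) \<le> 2 * \<tau>" for t
      using \<tau>(1) by (intro perturbation_grad_sums(2)) simp
    show "norm (K *\<^sub>R (\<integral>t. norm_powr_grad p (fst (Y t) - x) \<partial>M)) \<le> 2 * \<tau>"
      by (rule penalty_gradient_bound[OF Z _ _ finz _ xr]) (use z zx \<tau>(1) in auto)
  qed
qed

end

section \<open>Convergence of points and of values\<close>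

lemma smooth_norm_tendsto_zeroD:
  fixes u :: "'i \<Rightarrow> 'c::real_inner"
  assumes "((\<lambda>n. smooth_norm (u n)) \<longlongrightarrow> 0) F"
  shows "(u \<longlongrightarrow> 0) F"
proof -
  have "norm v = sqrt ((smooth_norm v + 1)\<^sup>2 - 1)" for v :: 'c
    unfolding smooth_norm_def by (simp add: add_nonneg_nonneg)
  moreover have "((\<lambda>n. sqrt ((smooth_norm (u n) + 1)\<^sup>2 - 1)) \<longlongrightarrow> sqrt ((0 + 1)\<^sup>2 - 1)) F"
    by (intro tendsto_intros assms)
  ultimately have "((\<lambda>n. norm (u n)) \<longlongrightarrow> 0) F" by simp
  then show ?thesis by (rule tendsto_norm_zero_cancel)
qed

lemma AE_tendsto_if_smooth_norm_summable:
  fixes Y :: "nat \<Rightarrow> 't \<Rightarrow> 'c::euclidean_space"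
  assumes [measurable]: "\<And>n. Y n \<in> borel_measurable M" "Y' \<in> borel_measurable M"
    and le: "\<And>n. (\<integral>\<^sup>+t. ennreal (smooth_norm (Y n t - Y' t)) \<partial>M) \<le> ennreal (b n)"
    and b: "\<And>n. 0 \<le> b n" "summable b"
  shows "AE t in M. (\<lambda>n. Y n t) \<longlonglongrightarrow> Y' t"
proof -
  have "(\<integral>\<^sup>+t. (\<Sum>n. ennreal (smooth_norm (Y n t - Y' t))) \<partial>M)
      = (\<Sum>n. \<integral>\<^sup>+t. ennreal (smooth_norm (Y n t - Y' t)) \<partial>M)"
    by (intro nn_integral_suminf) measurable
  also have "\<dots> \<le> (\<Sum>n. ennreal (b n))" by (intro suminf_le le) auto
  also have "\<dots> = ennreal (\<Sum>n. b n)" using b by (intro suminf_ennreal2) auto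
  finally have "(\<integral>\<^sup>+t. (\<Sum>n. ennreal (smooth_norm (Y n t - Y' t))) \<partial>M) \<noteq> \<infinity>"
    by (auto simp: top_unique)
  then have "AE t in M. (\<Sum>n. ennreal (smooth_norm (Y n t - Y' t))) \<noteq> \<infinity>"
    by (intro nn_integral_PInf_AE) measurable
  then show ?thesis
  proof eventually_elim
    case (elim t)
    then have "summable (\<lambda>n. smooth_norm (Y n t - Y' t))"
      by (intro summable_suminf_not_top) auto
    then have "(\<lambda>n. Y n t - Y' t) \<longlonglongrightarrow> 0"
      by (rule smooth_norm_tendsto_zeroD[OF summable_LIMSEQ_zero])
    then show ?case by (simp add: LIM_zero_iff)
  qed
qed

lemma ennreal_diff_tendsto_zero:
  fixes b :: ennreal
  assumes "b \<le> liminf a" "b < top"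
  shows "(\<lambda>k. b - a k) \<longlonglongrightarrow> 0"
proof (rule order_tendstoI)
  fix e :: ennreal assume e: "0 < e"
  show "\<forall>\<^sub>F k in sequentially. b - a k < e"
  proof (cases "b = 0")
    case True
    then show ?thesis using e by simp
  next
    case False
    show ?thesis
    proof (cases "e \<le> b")
      case True
      obtain \<beta> where \<beta>: "b = ennreal \<beta>" "0 \<le> \<beta>" using less_top_ennreal[of b] assms(2) by auto
      obtain \<epsilon> where \<epsilon>: "e = ennreal \<epsilon>" "0 \<le> \<epsilon>"
        using less_top_ennreal[of e] le_less_trans[OF True assms(2)] by auto
      have \<epsilon>\<beta>: "0 < \<epsilon>" "\<epsilon> \<le> \<beta>" using e True \<beta> \<epsilon> by simp_all
      then have "b - e < b" unfolding \<beta>(1) \<epsilon>(1) by (simp add: ennreal_minus ennreal_less_iff)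
      then have "b - e < liminf a" using assms(1) by (rule less_le_trans)
      then have "\<forall>\<^sub>F k in sequentially. b - e < a k" using le_Liminf_iff[of "liminf a" sequentially a] by blast
      then show ?thesis
      proof eventually_elim
        case (elim k)
        show ?case
        proof (cases "a k < top")
          case True
          then obtain \<alpha> where \<alpha>: "a k = ennreal \<alpha>" "0 \<le> \<alpha>" using less_top_ennreal[of "a k"] by auto
          have "\<beta> - \<epsilon> < \<alpha>"
            using elim \<epsilon>\<beta> unfolding \<beta>(1) \<epsilon>(1) \<alpha>(1) by (simp add: ennreal_minus ennreal_less_iff)
          then show ?thesis unfolding \<beta>(1) \<epsilon>(1) \<alpha>(1) using \<alpha>(2) \<epsilon>\<beta>(1)
            by (simp add: ennreal_minus ennreal_lessI)
        next
          case False
          then have "a k = top" using less_top[of "a k"] by blast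
          then have "b - a k = 0" using assms(2) by (simp add: diff_eq_0_ennreal)
          then show ?thesis using e by simp
        qed
      qed
    next
      case False
      then have "b < e" by simp
      then have "b - a k < e" for k by (rule le_less_trans[rotated]) (rule diff_le_self_ennreal)
      then show ?thesis by simp
    qed
  qed
qed simp

text \<open>
A one-sided version of Scheffe's lemma. The parts \<open>g - f k\<close> are dominated by \<open>g\<close>, so their
integrals vanish in the limit; comparing total integrals bounds the parts \<open>f k - g\<close> by them. Subtraction
is truncated, hence the sum of both differences is the absolute difference.
\<close>

lemma nn_integral_abs_diff_tendsto_zero:
  fixes f :: "nat \<Rightarrow> 't \<Rightarrow> ennreal"
  assumes [measurable]: "\<And>k. f k \<in> borel_measurable M" "g \<in> borel_measurable M"
    and fin: "(\<integral>\<^sup>+t. g t \<partial>M) < \<infinity>"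
    and le: "\<And>k. (\<integral>\<^sup>+t. f k t \<partial>M) \<le> (\<integral>\<^sup>+t. g t \<partial>M)"
    and lsc: "AE t in M. g t \<le> liminf (\<lambda>k. f k t)"
  shows "(\<lambda>k. \<integral>\<^sup>+t. (f k t - g t) + (g t - f k t) \<partial>M) \<longlonglongrightarrow> 0"
proof -
  have finite_g: "AE t in M. g t \<noteq> \<infinity>" using fin by (intro nn_integral_PInf_AE) auto
  have lim: "(\<lambda>k. \<integral>\<^sup>+t. g t - f k t \<partial>M) \<longlonglongrightarrow> (\<integral>\<^sup>+t. 0 \<partial>M)"
  proof (rule nn_integral_dominated_convergence[where w = g])
    show "AE t in M. (\<lambda>k. g t - f k t) \<longlonglongrightarrow> 0"
      using lsc finite_g by eventually_elim (rule ennreal_diff_tendsto_zero, auto simp: less_top)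
    show "AE t in M. g t - f k t \<le> g t" for k by (rule AE_I2) (rule diff_le_self_ennreal)
  qed (use fin in auto)
  have diff_le: "(\<integral>\<^sup>+t. f k t - g t \<partial>M) \<le> (\<integral>\<^sup>+t. g t - f k t \<partial>M)" for k
  proof -
    have max: "g t + (f k t - g t) = f k t + (g t - f k t)" for t
    proof (cases "f k t = top \<or> g t = top")
      case False
      then obtain \<alpha> \<beta> where \<alpha>\<beta>: "f k t = ennreal \<alpha>" "0 \<le> \<alpha>" "g t = ennreal \<beta>" "0 \<le> \<beta>"
        using less_top_ennreal[of "f k t"] less_top_ennreal[of "g t"] less_top by blast
      show ?thesis
        unfolding \<alpha>\<beta>(1,3) using \<alpha>\<beta>(2,4)
        by (cases "\<alpha> \<le> \<beta>") (simp_all add: ennreal_minus ennreal_neg flip: ennreal_plus)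
    qed auto
    have "(\<integral>\<^sup>+t. g t \<partial>M) + (\<integral>\<^sup>+t. f k t - g t \<partial>M) = (\<integral>\<^sup>+t. f k t \<partial>M) + (\<integral>\<^sup>+t. g t - f k t \<partial>M)"
      by (subst (1 2) nn_integral_add[symmetric]) (auto simp: max)
    also have "\<dots> \<le> (\<integral>\<^sup>+t. g t \<partial>M) + (\<integral>\<^sup>+t. g t - f k t \<partial>M)" by (intro add_right_mono le)
    finally show ?thesis using fin by (auto simp: ennreal_add_left_cancel_le)
  qed
  have "(\<lambda>k. (\<integral>\<^sup>+t. g t - f k t \<partial>M) + (\<integral>\<^sup>+t. g t - f k t \<partial>M)) \<longlonglongrightarrow> 0 + 0"
    using lim by (intro tendsto_add) auto
  then have lim2: "(\<lambda>k. (\<integral>\<^sup>+t. g t - f k t \<partial>M) + (\<integral>\<^sup>+t. g t - f k t \<partial>M)) \<longlonglongrightarrow> 0" by simp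
  show ?thesis
  proof (rule tendsto_sandwich[OF _ _ tendsto_const lim2])
    show "\<forall>\<^sub>F k in sequentially. (\<integral>\<^sup>+t. (f k t - g t) + (g t - f k t) \<partial>M)
        \<le> (\<integral>\<^sup>+t. g t - f k t \<partial>M) + (\<integral>\<^sup>+t. g t - f k t \<partial>M)"
      by (intro always_eventually allI) (simp add: nn_integral_add diff_le add_right_mono)
  qed simp
qed

lemma Linf_space_bounded:
  fixes g :: "'t \<Rightarrow> 'c::euclidean_space"
  assumes [measurable]: "g \<in> borel_measurable M" and c: "\<And>t. norm (g t) \<le> c" "0 \<le> c"
  shows "g \<in> Linf_space M" "0 \<le> Linf_norm M g" "Linf_norm M g \<le> c"
proof -
  have m: "(\<lambda>t. ereal (norm (g t))) \<in> borel_measurable M" by measurable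
  have le: "esssup M (\<lambda>t. ereal (norm (g t))) \<le> ereal c"
    using c(1) by (intro esssup_I[OF m]) auto
  then show "g \<in> Linf_space M" unfolding Linf_space_def by (auto intro: le_less_trans)
  have "esssup M (\<lambda>t. ereal (norm (g t))) = -\<infinity> \<or> 0 \<le> esssup M (\<lambda>t. ereal (norm (g t)))"
  proof (cases "emeasure M (space M) = 0")
    case True
    then show ?thesis using esssup_zero_space[OF _ m] by simp
  next
    case False
    have "esssup M (\<lambda>t. ereal 0) \<le> esssup M (\<lambda>t. ereal (norm (g t)))" by (rule esssup_mono) auto
    then show ?thesis using esssup_const[OF False, of "ereal 0"] by (simp add: zero_ereal_def)
  qed
  then show "0 \<le> Linf_norm M g" "Linf_norm M g \<le> c"
    using le c(2) unfolding Linf_norm_def by (cases "esssup M (\<lambda>t. ereal (norm (g t)))"; auto)+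
qed

lemma L1_cball_iff:
  fixes y :: "'t \<Rightarrow> 'c::euclidean_space"
  assumes y: "y \<in> Lp_space 1 M" and [measurable]: "z \<in> borel_measurable M" and r: "0 \<le> r"
    and le: "(\<integral>\<^sup>+t. ennreal (norm (z t - y t)) \<partial>M) \<le> ennreal r"
  shows "z \<in> Lp_space 1 M" "Lp_norm 1 M (\<lambda>t. z t - y t) \<le> r"
proof -
  have [measurable]: "y \<in> borel_measurable M" and inty: "integrable M (\<lambda>t. norm (y t))"
    using y unfolding Lp_space_def by auto
  have int: "integrable M (\<lambda>t. norm (z t - y t))"
    using le by (intro integrableI_bounded) (auto intro: le_less_trans)
  have "integrable M (\<lambda>t. norm (z t))"
  proof (rule Bochner_Integration.integrable_bound[OF Bochner_Integration.integrable_add[OF int inty]])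
    show "AE t in M. norm (norm (z t)) \<le> norm (norm (z t - y t) + norm (y t))"
      by (rule AE_I2) (use norm_triangle_ineq[of "z t - y t" "y t" for t] in simp)
  qed measurable
  then show "z \<in> Lp_space 1 M" unfolding Lp_space_def by simp
  have "ennreal (\<integral>t. norm (z t - y t) \<partial>M) = (\<integral>\<^sup>+t. ennreal (norm (z t - y t)) \<partial>M)"
    using int by (intro nn_integral_eq_integral[symmetric]) auto
  also note le
  finally have "(\<integral>t. norm (z t - y t) \<partial>M) \<le> r" using r by (simp add: ennreal_le_iff)
  then show "Lp_norm 1 M (\<lambda>t. z t - y t) \<le> r" unfolding Lp_norm_def by (simp add: integral_nonneg_AE)
qed

section \<open>Robust minimisers of integral functionals\<close>

locale bounded_below_integrand = finite_measure M for M :: "'t measure" +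
  fixes \<phi> :: "'t \<Rightarrow> 'a::euclidean_space \<times> 'b::euclidean_space \<Rightarrow> ereal" and \<nu> :: "'t \<Rightarrow> real"
  assumes normal: "normal_integrand M \<phi>" and \<nu>: "integrable M \<nu>" "\<And>t. t \<in> space M \<Longrightarrow> 0 \<le> \<nu> t"
    and bounded_below: "\<And>t w. t \<in> space M \<Longrightarrow> - ereal (\<nu> t) \<le> \<phi> t w"
begin

definition shifted :: "'t \<Rightarrow> 'a \<times> 'b \<Rightarrow> ennreal" where
  "shifted t w = e2ennreal (\<phi> t w + ereal (\<nu> t))"

abbreviation shifted_integral :: "('t \<Rightarrow> 'a \<times> 'b) \<Rightarrow> ennreal" where
  "shifted_integral Y \<equiv> \<integral>\<^sup>+t. shifted t (Y t) \<partial>M"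

lemma shifted_measurable: "(\<lambda>(t, w). shifted t w) \<in> borel_measurable (M \<Otimes>\<^sub>M borel)"
proof -
  have [measurable]: "\<nu> \<in> borel_measurable M" using \<nu>(1) by simp
  have 1: "(\<lambda>s. \<phi> (fst s) (snd s)) \<in> borel_measurable (M \<Otimes>\<^sub>M borel)"
    using normal unfolding normal_integrand_def by (simp add: case_prod_beta')
  have 2: "(\<lambda>s. ereal (\<nu> (fst s))) \<in> borel_measurable (M \<Otimes>\<^sub>M (borel :: ('a \<times> 'b) measure))" by measurable
  have "(\<lambda>s. e2ennreal (\<phi> (fst s) (snd s) + ereal (\<nu> (fst s)))) \<in> borel_measurable (M \<Otimes>\<^sub>M borel)"
    by (intro measurable_compose[OF borel_measurable_ereal_add[OF 1 2] measurable_e2ennreal])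
  then show ?thesis unfolding shifted_def by (simp add: case_prod_beta')
qed

lemma \<phi>_eq_shifted: "t \<in> space M \<Longrightarrow> \<phi> t w = enn2ereal (shifted t w) - ereal (\<nu> t)"
proof -
  assume t: "t \<in> space M"
  have "0 \<le> \<phi> t w + ereal (\<nu> t)"
    using bounded_below[OF t, of w] by (cases "\<phi> t w") auto
  then have "enn2ereal (shifted t w) = \<phi> t w + ereal (\<nu> t)" unfolding shifted_def by (rule enn2ereal_e2ennreal)
  then show ?thesis by (cases "\<phi> t w") auto
qed

lemma shifted_lsc:
  assumes t: "t \<in> space M" and W: "W \<longlonglongrightarrow> w"
  shows "shifted t w \<le> liminf (\<lambda>n. shifted t (W n))"
  unfolding le_Liminf_iff
proof (intro allI impI)
  fix y assume y: "y < shifted t w"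
  then obtain c where c: "0 \<le> c" "y = ennreal c" using less_top_ennreal[of y] by (metis less_le_trans top_greatest)
  have less: "y < shifted t u \<longleftrightarrow> ereal (c - \<nu> t) < \<phi> t u" for u
  proof -
    have "y < shifted t u \<longleftrightarrow> ereal c < enn2ereal (shifted t u)"
      unfolding c(2) less_ennreal.rep_eq using c(1) by simp
    then show ?thesis unfolding \<phi>_eq_shifted[OF t] by (cases "enn2ereal (shifted t u)") auto
  qed
  have "\<phi> t w \<le> liminf (\<lambda>n. \<phi> t (W n))"
    using normal t unfolding normal_integrand_def by (intro lower_semicontinuous_liminf W) auto
  then have "\<forall>\<^sub>F n in sequentially. ereal (c - \<nu> t) < \<phi> t (W n)"
    using y[unfolded less] unfolding le_Liminf_iff by blast
  then show "\<forall>\<^sub>F n in sequentially. y < shifted t (W n)" unfolding less .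
qed

lemma shifted_comp_measurable:
  assumes "Y \<in> borel_measurable M" shows "(\<lambda>t. shifted t (Y t)) \<in> borel_measurable M"
  using measurable_compose[OF measurable_Pair[OF measurable_ident_sets[OF refl] assms] shifted_measurable] by simp

text \<open>
Integrals of the extended-valued integrand become nonnegative integrals up to the
finite constant \<open>\<integral> \<nu>\<close>.
\<close>

lemma ext_integral_eq:
  assumes Y: "Y \<in> borel_measurable M"
  shows "ext_integral M (\<lambda>t. \<phi> t (Y t)) = enn2ereal (shifted_integral Y) - ereal (\<integral>t. \<nu> t \<partial>M)"
proof -
  have [measurable]: "\<nu> \<in> borel_measurable M" using \<nu>(1) by simp
  note [measurable] = shifted_comp_measurable[OF Y]
  have eq: "\<phi> t (Y t) = enn2ereal (shifted t (Y t)) - ereal (\<nu> t)" if "t \<in> space M" for t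
    using that by (rule \<phi>_eq_shifted)
  have [measurable]: "(\<lambda>t. \<phi> t (Y t)) \<in> borel_measurable M"
    by (subst measurable_cong[OF eq]) measurable
  define P where "P = (\<integral>\<^sup>+t. e2ennreal (\<phi> t (Y t)) \<partial>M)"
  define N where "N = (\<integral>\<^sup>+t. e2ennreal (- \<phi> t (Y t)) \<partial>M)"
  define F where "F = shifted_integral Y"
  have \<nu>_int: "(\<integral>\<^sup>+t. ennreal (\<nu> t) \<partial>M) = ennreal (\<integral>t. \<nu> t \<partial>M)"
    using \<nu> by (intro nn_integral_eq_integral) (auto intro: AE_I2)
  have \<nu>_nonneg: "0 \<le> (\<integral>t. \<nu> t \<partial>M)" using \<nu>(2) by (intro integral_nonneg_AE AE_I2)
  have "N \<le> (\<integral>\<^sup>+t. ennreal (\<nu> t) \<partial>M)" unfolding N_def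
  proof (rule nn_integral_mono)
    fix t assume "t \<in> space M"
    then have "- \<phi> t (Y t) \<le> ereal (\<nu> t)" using bounded_below[of t "Y t"] by (simp add: ereal_uminus_le_reorder)
    then show "e2ennreal (- \<phi> t (Y t)) \<le> ennreal (\<nu> t)" using e2ennreal_mono by fastforce
  qed
  then have N: "N < top" unfolding \<nu>_int by (rule le_less_trans) simp
  have "F + N = P + ennreal (\<integral>t. \<nu> t \<partial>M)"
    unfolding F_def N_def P_def \<nu>_int[symmetric]
  proof (subst (1 2) nn_integral_add[symmetric])
    show "(\<integral>\<^sup>+t. shifted t (Y t) + e2ennreal (- \<phi> t (Y t)) \<partial>M) = (\<integral>\<^sup>+t. e2ennreal (\<phi> t (Y t)) + ennreal (\<nu> t) \<partial>M)"
    proof (rule nn_integral_cong)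
      fix t assume t: "t \<in> space M"
      show "shifted t (Y t) + e2ennreal (- \<phi> t (Y t)) = e2ennreal (\<phi> t (Y t)) + ennreal (\<nu> t)"
        unfolding shifted_def using bounded_below[OF t, of "Y t"] \<nu>(2)[OF t]
        by (cases "\<phi> t (Y t)"; cases "\<phi> t (Y t) \<ge> 0")
          (auto simp: e2ennreal_neg ennreal_plus[symmetric] ennreal_neg simp del: ennreal_plus)
    qed
  qed measurable
  then show ?thesis
    unfolding ext_integral_def P_def[symmetric] N_def[symmetric] F_def[symmetric]
    using N \<nu>_nonneg
    by (cases F; cases P; cases N) (auto simp: ennreal_plus[symmetric] simp del: ennreal_plus)
qed

text \<open>
Robustness as exact penalisation up to \<open>\<eta>\<close>. It provides some \<open>\<epsilon>\<close> such that the bound holds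
without penalty as long as \<open>\<integral> \<parallel>\<xi> - x\<parallel>\<^sup>p \<le> \<epsilon>\<close>; otherwise the penalty alone exceeds the minimum,
because \<open>L * \<epsilon>\<close> does.
\<close>

lemma robust_lower_bound:
  assumes rob: "robust_minimizer p M \<phi> (cball xbar r) (L1_cball M ybar r) xbar ybar"
    and p: "1 < p" and r: "0 < r" and ybar: "ybar \<in> Lp_space 1 M"
    and fin: "integral_functional M \<phi> xbar ybar < \<infinity>" and \<eta>: "0 < \<eta>"
  shows "shifted_integral (\<lambda>t. (xbar, ybar t)) < \<infinity>"
    and "\<exists>L\<ge>1. \<forall>x Y. norm (x - xbar) \<le> r \<longrightarrow> Y \<in> borel_measurable M \<longrightarrow>
      (\<integral>\<^sup>+t. ennreal (norm (snd (Y t) - ybar t)) \<partial>M) \<le> ennreal r \<longrightarrow>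
      shifted_integral (\<lambda>t. (xbar, ybar t)) \<le> shifted_integral Y
         + (\<integral>\<^sup>+t. ennreal (L * norm (fst (Y t) - x) powr p) \<partial>M) + ennreal \<eta>"
proof -
  define Nbar where "Nbar = shifted_integral (\<lambda>t. (xbar, ybar t))"
  define c where "c = (\<integral>t. \<nu> t \<partial>M)"
  have ym [measurable]: "ybar \<in> borel_measurable M" using ybar unfolding Lp_space_def by simp
  have V: "integral_functional M \<phi> xbar ybar = enn2ereal Nbar - ereal c"
    unfolding integral_functional_def Nbar_def c_def by (rule ext_integral_eq) (intro borel_measurable_Pair, auto)
  show Nfin: "shifted_integral (\<lambda>t. (xbar, ybar t)) < \<infinity>"
    using fin V unfolding Nbar_def[symmetric] by (cases Nbar) auto
  then obtain n where n: "0 \<le> n" "Nbar = ennreal n" using less_top_ennreal[of Nbar] unfolding Nbar_def by auto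
  have inf_eq: "(INF (x, y)\<in>cball xbar r \<times> L1_cball M ybar r. integral_functional M \<phi> x y) = integral_functional M \<phi> xbar ybar"
  proof (rule antisym)
    show "(INF (x, y)\<in>cball xbar r \<times> L1_cball M ybar r. integral_functional M \<phi> x y) \<le> integral_functional M \<phi> xbar ybar"
      using rob unfolding robust_minimizer_def by (intro INF_lower2[of "(xbar, ybar)"]) auto
    show "integral_functional M \<phi> xbar ybar \<le> (INF (x, y)\<in>cball xbar r \<times> L1_cball M ybar r. integral_functional M \<phi> x y)"
      using rob unfolding robust_minimizer_def by (intro INF_greatest) auto
  qed
  have "ereal (n - c - \<eta>) < stabilized_infimum p M \<phi> (cball xbar r) (L1_cball M ybar r)"
    using rob \<eta> n unfolding robust_minimizer_def robust_infimum_def inf_eq V by auto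
  then obtain \<epsilon> where \<epsilon>: "0 < \<epsilon>" "ereal (n - c - \<eta>) < Inf {ext_integral M (\<lambda>t. \<phi> t (\<xi> t, y t)) | x y \<xi>.
      x \<in> cball xbar r \<and> y \<in> L1_cball M ybar r \<and> \<xi> \<in> Lp_space p M \<and> (\<integral>t. norm (\<xi> t - x) powr p \<partial>M) \<le> \<epsilon>}"
    unfolding stabilized_infimum_def less_SUP_iff by auto
  define L where "L = n / \<epsilon> + 1"
  have L: "0 < L" "n \<le> L * \<epsilon>" "1 \<le> L" unfolding L_def using n \<epsilon>(1) by (simp_all add: add_nonneg_pos field_simps)
  show "\<exists>L\<ge>1. \<forall>x Y. norm (x - xbar) \<le> r \<longrightarrow> Y \<in> borel_measurable M \<longrightarrow>
      (\<integral>\<^sup>+t. ennreal (norm (snd (Y t) - ybar t)) \<partial>M) \<le> ennreal r \<longrightarrow>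
      shifted_integral (\<lambda>t. (xbar, ybar t)) \<le> shifted_integral Y
         + (\<integral>\<^sup>+t. ennreal (L * norm (fst (Y t) - x) powr p) \<partial>M) + ennreal \<eta>"
  proof (intro exI[of _ L] conjI L(3) allI impI)
    fix x and Y :: "'t \<Rightarrow> 'a \<times> 'b"
    assume x: "norm (x - xbar) \<le> r" and [measurable]: "Y \<in> borel_measurable M"
      and y: "(\<integral>\<^sup>+t. ennreal (norm (snd (Y t) - ybar t)) \<partial>M) \<le> ennreal r"
    define A where "A = (\<integral>\<^sup>+t. ennreal (norm (fst (Y t) - x) powr p) \<partial>M)"
    have LA: "(\<integral>\<^sup>+t. ennreal (L * norm (fst (Y t) - x) powr p) \<partial>M) = ennreal L * A"
      unfolding A_def using L(1) by (simp add: ennreal_mult nn_integral_cmult)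
    have "Nbar \<le> shifted_integral Y + ennreal L * A + ennreal \<eta>"
    proof (cases "A \<le> ennreal \<epsilon>")
      case True
      have int: "integrable M (\<lambda>t. norm (fst (Y t) - x) powr p)"
        using True unfolding A_def by (intro integrableI_bounded) (auto intro: le_less_trans)
      have "A = ennreal (\<integral>t. norm (fst (Y t) - x) powr p \<partial>M)"
        unfolding A_def using int by (intro nn_integral_eq_integral) auto
      then have le: "(\<integral>t. norm (fst (Y t) - x) powr p \<partial>M) \<le> \<epsilon>" using True \<epsilon>(1) by simp
      have "integrable M (\<lambda>t. norm (fst (Y t)) powr p)"
        using integrable_norm_add_powr[of "\<lambda>t. fst (Y t) - x" "\<lambda>_. x" p] int p by simp
      then have \<xi>: "(\<lambda>t. fst (Y t)) \<in> Lp_space p M" unfolding Lp_space_def by simp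
      have "(\<lambda>t. snd (Y t)) \<in> L1_cball M ybar r"
        using L1_cball_iff[OF ybar _ _ y] r unfolding L1_cball_def by simp
      moreover have "x \<in> cball xbar r" using x by (simp add: dist_norm norm_minus_commute)
      ultimately have "ext_integral M (\<lambda>t. \<phi> t (fst (Y t), snd (Y t))) \<in> {ext_integral M (\<lambda>t. \<phi> t (\<xi> t, y t)) | x y \<xi>.
        x \<in> cball xbar r \<and> y \<in> L1_cball M ybar r \<and> \<xi> \<in> Lp_space p M \<and> (\<integral>t. norm (\<xi> t - x) powr p \<partial>M) \<le> \<epsilon>}"
        using le \<xi> by (intro CollectI exI[of _ x] exI[of _ "\<lambda>t. snd (Y t)"] exI[of _ "\<lambda>t. fst (Y t)"]) simp
      from less_le_trans[OF \<epsilon>(2) Inf_lower[OF this]]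
      have "ereal (n - c - \<eta>) < enn2ereal (shifted_integral Y) - ereal c"
        using ext_integral_eq[of Y] unfolding c_def by simp
      then have "Nbar \<le> shifted_integral Y + ennreal \<eta>"
        unfolding n(2) using \<eta>
        by (cases "shifted_integral Y") (auto simp: ennreal_plus[symmetric] ennreal_leI simp del: ennreal_plus)
      also have "\<dots> \<le> shifted_integral Y + ennreal L * A + ennreal \<eta>"
        by (intro add_right_mono add_increasing2) auto
      finally show ?thesis .
    next
      case False
      have "Nbar \<le> ennreal (L * \<epsilon>)" unfolding n(2) using L(2) by (rule ennreal_leI)
      also have "\<dots> = ennreal L * ennreal \<epsilon>" using L(1) \<epsilon>(1) by (intro ennreal_mult) auto
      also have "\<dots> \<le> ennreal L * A" using False by (intro mult_left_mono) auto
      also have "\<dots> \<le> shifted_integral Y + ennreal L * A + ennreal \<eta>"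
        by (simp add: add_increasing add_increasing2)
      finally show ?thesis .
    qed
    then show "shifted_integral (\<lambda>t. (xbar, ybar t)) \<le> shifted_integral Y
         + (\<integral>\<^sup>+t. ennreal (L * norm (fst (Y t) - x) powr p) \<partial>M) + ennreal \<eta>"
      unfolding LA Nbar_def .
  qed
qed

text \<open>
A crude bound for \<open>\<parallel>\<xi>'\<parallel>\<^sub>q \<parallel>\<xi> - x\<parallel>\<^sub>p\<close> per unit of \<open>2 * \<tau>\<close>: the factor \<open>2 powr q\<close> stems from the \<open>q\<close>-th power
of a sum of two terms, the penalty gradient and the perturbation gradient, and the two summands from
these terms.
\<close>

definition product_const :: "real \<Rightarrow> real \<Rightarrow> real" where
  "product_const p q = (2 powr q * (p powr q + measure M (space M) * 2 powr (q / p))) powr (1 / q)"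

text \<open>
One member of the sequences of the theorem, with explicit errors in terms of \<open>\<tau>\<close>. The convergence of the
values has no explicit rate; it follows from the bound on the integrals of \<open>shifted\<close>.
\<close>

definition stationary_within ::
  "real \<Rightarrow> real \<Rightarrow> 'a \<Rightarrow> ('t \<Rightarrow> 'b) \<Rightarrow> real \<Rightarrow> 'a \<Rightarrow> ('t \<Rightarrow> 'a \<times> 'b) \<Rightarrow> ('t \<Rightarrow> 'a) \<Rightarrow> ('t \<Rightarrow> 'b) \<Rightarrow> bool" where
  "stationary_within p q xbar ybar \<tau> x Y \<xi>' y' \<longleftrightarrow>
     Y \<in> borel_measurable M \<and> \<xi>' \<in> Lp_space q M \<and> y' \<in> borel_measurable M \<and>
     smooth_norm (x - xbar) \<le> \<tau>\<^sup>2 \<and>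
     (\<integral>\<^sup>+t. ennreal (smooth_norm (Y t - (xbar, ybar t))) \<partial>M) \<le> ennreal (\<tau>\<^sup>2) \<and>
     integrable M (\<lambda>t. norm (fst (Y t) - x) powr p) \<and>
     (\<integral>t. norm (fst (Y t) - x) powr p \<partial>M) \<le> 2 * \<tau> \<and>
     shifted_integral Y \<le> shifted_integral (\<lambda>t. (xbar, ybar t)) \<and>
     norm (\<integral>t. \<xi>' t \<partial>M) \<le> 2 * \<tau> * (1 + measure M (space M)) \<and>
     (\<forall>t. norm (y' t) \<le> 2 * \<tau>) \<and>
     Lp_norm q M \<xi>' * Lp_norm p M (\<lambda>t. fst (Y t) - x)
       \<le> product_const p q * (2 * \<tau>) \<and>
     (AE t in M. (\<xi>' t, y' t) \<in> regular_subdifferential (\<phi> t) (Y t))"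

text \<open>
The penalty constant is twice the constant \<open>L\<close> of \<open>robust_lower_bound\<close>. The minimiser has a penalised value
of at most the unperturbed minimum, and the lower bound with \<open>L\<close> shows that half of the penalty is at
most \<open>\<tau> ^ 3\<close>.
\<close>

lemma stationary_within_exists:
  assumes rob: "robust_minimizer p M \<phi> (cball xbar r) (L1_cball M ybar r) xbar ybar"
    and p: "1 < p" and q: "1 < q" and pq: "1 / p + 1 / q = 1"
    and r: "0 < r" and ybar: "ybar \<in> Lp_space 1 M"
    and fin: "integral_functional M \<phi> xbar ybar < \<infinity>"
    and \<tau>: "0 < \<tau>" "\<tau> \<le> 1" "\<tau>\<^sup>2 + \<tau> + \<tau> / 2 * (1 + measure M (space M)) < r"
  shows "\<exists>x Y \<xi>' y'. stationary_within p q xbar ybar \<tau> x Y \<xi>' y'"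
proof -
  define m where "m = measure M (space M)"
  have m: "0 \<le> m" unfolding m_def by simp
  have ym [measurable]: "ybar \<in> borel_measurable M" using ybar unfolding Lp_space_def by simp
  define Nbar where "Nbar = shifted_integral (\<lambda>t. (xbar, ybar t))"
  have \<tau>3: "0 < \<tau> ^ 3" "\<tau> ^ 3 \<le> \<tau>" using \<tau> by (simp_all add: power_le_one power3_eq_cube mult_le_one mult_left_le)
  note rlb = robust_lower_bound[OF rob p r ybar fin \<tau>3(1), folded Nbar_def]
  from rlb(2) obtain L where L: "1 \<le> L" and low: "\<And>x Y. norm (x - xbar) \<le> r \<Longrightarrow> Y \<in> borel_measurable M \<Longrightarrow>
      (\<integral>\<^sup>+t. ennreal (norm (snd (Y t) - ybar t)) \<partial>M) \<le> ennreal r \<Longrightarrow>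
      Nbar \<le> shifted_integral Y + (\<integral>\<^sup>+t. ennreal (L * norm (fst (Y t) - x) powr p) \<partial>M) + ennreal (\<tau> ^ 3)"
    by (elim exE conjE) (rule that, auto)
  interpret pen: penalized_problem M shifted p "2 * L" r xbar ybar
    using shifted_measurable shifted_lsc p L r ym by unfold_locales auto
  have obj: "pen.objective (x, Y) = shifted_integral Y + (\<integral>\<^sup>+t. ennreal (2 * L * norm (fst (Y t) - x) powr p) \<partial>M)"
    if [measurable]: "Y \<in> borel_measurable M" for x Y
    unfolding pen.objective_def pen.penalized_def fst_conv snd_conv
    by (rule nn_integral_add) (use shifted_comp_measurable[OF that] in measurable)
  have near: "Nbar \<le> pen.objective u + ennreal (\<tau> ^ 3)" if u: "u \<in> pen.feasible" for u
  proof -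
    obtain x Y where xz: "u = (x, Y)" by fastforce
    have f: "norm (x - xbar) \<le> r" "Y \<in> borel_measurable M" "(\<integral>\<^sup>+t. ennreal (norm (snd (Y t) - ybar t)) \<partial>M) \<le> ennreal r"
      using u unfolding xz pen.feasible_def by simp_all
    note low[OF f]
    also have "shifted_integral Y + (\<integral>\<^sup>+t. ennreal (L * norm (fst (Y t) - x) powr p) \<partial>M) + ennreal (\<tau> ^ 3)
        \<le> pen.objective u + ennreal (\<tau> ^ 3)"
      unfolding xz obj[OF f(2)]
      by (intro add_mono order_refl nn_integral_mono ennreal_leI mult_right_mono) (use L in auto)
    finally show ?thesis .
  qed
  obtain x Y e where feas: "(x, Y) \<in> pen.feasible" and gx: "smooth_norm (x - xbar) \<le> \<tau>\<^sup>2"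
    and gz: "(\<integral>\<^sup>+t. ennreal (smooth_norm (Y t - (xbar, ybar t))) \<partial>M) \<le> ennreal (\<tau>\<^sup>2)"
    and up: "pen.objective (x, Y) \<le> Nbar"
    and e [measurable]: "e \<in> borel_measurable M" and e_le: "\<And>t. norm (e t) \<le> 2 * \<tau>"
    and grad: "norm ((2 * L) *\<^sub>R (\<integral>t. norm_powr_grad p (fst (Y t) - x) \<partial>M)) \<le> 2 * \<tau>"
    and sub: "AE t in M. \<forall>c. - (((2 * L) *\<^sub>R norm_powr_grad p (fst (Y t) - x), 0) + e t)
      \<in> regular_subdifferential (\<lambda>w. enn2ereal (shifted t w) - ereal c) (Y t)"
    using pen.penalized_stationary_point[OF \<tau>(1,3) rlb(1)[unfolded Nbar_def] near[unfolded Nbar_def]]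
    unfolding Nbar_def by blast
  have [measurable]: "Y \<in> borel_measurable M" using pen.feasible_measurable[OF feas] by simp
  have f: "norm (x - xbar) \<le> r" "(\<integral>\<^sup>+t. ennreal (norm (snd (Y t) - ybar t)) \<partial>M) \<le> ennreal r"
    using feas unfolding pen.feasible_def by simp_all
  define U where "U t = fst (Y t) - x" for t
  have [measurable]: "U \<in> borel_measurable M" unfolding U_def by measurable
  define A where "A = (\<integral>t. norm (U t) powr p \<partial>M)"
  have up': "shifted_integral Y + (\<integral>\<^sup>+t. ennreal (2 * L * norm (U t) powr p) \<partial>M) \<le> Nbar"
    using up unfolding obj[OF \<open>Y \<in> borel_measurable M\<close>] U_def .
  have Nfin: "Nbar < top" using rlb(1) by simp
  have "(\<integral>\<^sup>+t. ennreal (2 * L * norm (U t) powr p) \<partial>M) \<le> Nbar"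
    using up' by (rule order_trans[rotated]) simp
  then have "(\<integral>\<^sup>+t. ennreal (2 * L * norm (U t) powr p) \<partial>M) < \<infinity>" using Nfin by (simp add: le_less_trans)
  then have int: "integrable M (\<lambda>t. norm (U t) powr p)"
    unfolding U_def by (intro pen.penalty_integrable) auto
  have A0: "0 \<le> A" unfolding A_def by (intro integral_nonneg_AE) auto
  have nnA: "(\<integral>\<^sup>+t. ennreal (k * norm (U t) powr p) \<partial>M) = ennreal (k * A)" if "0 \<le> k" for k
    unfolding A_def using int that by (subst nn_integral_eq_integral) auto
  have NS: "shifted_integral Y \<le> Nbar" using up' by (rule order_trans[rotated]) simp
  then obtain s where s: "0 \<le> s" "shifted_integral Y = ennreal s"
    using less_top_ennreal[of "shifted_integral Y"] Nfin le_less_trans[OF NS Nfin] by auto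
  have "ennreal s + ennreal (2 * L * A) \<le> ennreal s + ennreal (L * A) + ennreal (\<tau> ^ 3)"
    using order_trans[OF up' low[OF f(1) _ f(2), folded U_def]] nnA[of "2 * L"] nnA[of L] L s(2) by simp
  then have "s + 2 * L * A \<le> s + L * A + \<tau> ^ 3"
    using s(1) L A0 \<tau>3 by (simp flip: ennreal_plus)
  then have LA: "2 * L * A \<le> 2 * \<tau> ^ 3" by (simp add: algebra_simps)
  have "A \<le> L * A" using mult_right_mono[OF L A0] by simp
  then have A_le: "A \<le> 2 * \<tau>" "A \<le> 2" using LA \<tau>3(2) \<tau>(1,2) by linarith+
  define \<xi>' where "\<xi>' t = - ((2 * L) *\<^sub>R norm_powr_grad p (U t) + fst (e t))" for t
  define y' where "y' t = - snd (e t)" for t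
  have [measurable]: "\<xi>' \<in> borel_measurable M" "y' \<in> borel_measurable M" unfolding \<xi>'_def y'_def by measurable
  have fst_e: "norm (fst (e t)) \<le> 2 * \<tau>" "norm (y' t) \<le> 2 * \<tau>" for t
    using e_le[of t] norm_fst_le[of "fst (e t)" "snd (e t)"] norm_snd_le[of "snd (e t)" "fst (e t)"]
    unfolding y'_def by simp_all
  have int_fst_e: "integrable M (\<lambda>t. fst (e t))"
    by (rule integrable_const_bound[where B = "2 * \<tau>"]) (use fst_e in \<open>auto intro!: AE_I2\<close>)
  have int_g: "integrable M (\<lambda>t. norm_powr_grad p (U t))" by (rule integrable_norm_powr_grad[OF _ p int]) measurable
  have integral_\<xi>': "norm (\<integral>t. \<xi>' t \<partial>M) \<le> 2 * \<tau> * (1 + m)"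
  proof -
    have "(\<integral>t. \<xi>' t \<partial>M) = - ((2 * L) *\<^sub>R (\<integral>t. norm_powr_grad p (U t) \<partial>M) + (\<integral>t. fst (e t) \<partial>M))"
      unfolding \<xi>'_def using int_fst_e int_g by simp
    then have "norm (\<integral>t. \<xi>' t \<partial>M) \<le> norm ((2 * L) *\<^sub>R (\<integral>t. norm_powr_grad p (U t) \<partial>M)) + norm (\<integral>t. fst (e t) \<partial>M)"
      by (metis norm_minus_cancel norm_triangle_ineq)
    also have "norm (\<integral>t. fst (e t) \<partial>M) \<le> (\<integral>t. norm (fst (e t)) \<partial>M)" by (rule integral_norm_bound)
    also have "\<dots> \<le> (\<integral>t. 2 * \<tau> \<partial>M)" using int_fst_e fst_e by (intro integral_mono) auto
    also have "\<dots> = 2 * \<tau> * m" unfolding m_def by simp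
    finally show ?thesis using grad unfolding U_def by (simp add: algebra_simps)
  qed
  \<comment> \<open>These identities turn the \<open>q\<close>-th power of the penalty gradient into a multiple of \<open>norm (U t) powr p\<close>
    and the product of the norms into a power of \<open>2 * L * A\<close>.\<close>
  have qp: "(p - 1) * q = p" "1 + q / p = q"
    using pq p q by (simp_all add: field_simps)
  have \<xi>'_le: "norm (\<xi>' t) powr q \<le> 2 powr q * ((2 * L) powr q * p powr q * norm (U t) powr p + (2 * \<tau>) powr q)" for t
  proof -
    have "norm (\<xi>' t) powr q = norm ((2 * L) *\<^sub>R norm_powr_grad p (U t) + fst (e t)) powr q"
      unfolding \<xi>'_def by (simp only: norm_minus_cancel)
    also have "\<dots> \<le> 2 powr q * (norm ((2 * L) *\<^sub>R norm_powr_grad p (U t)) powr q + norm (fst (e t)) powr q)"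
      using q by (intro norm_add_powr_le) simp
    also have "\<dots> \<le> 2 powr q * ((2 * L) powr q * p powr q * norm (U t) powr p + (2 * \<tau>) powr q)"
    proof (intro mult_left_mono add_mono)
      have "norm ((2 * L) *\<^sub>R norm_powr_grad p (U t)) = 2 * L * (p * norm (U t) powr (p - 1))"
        using L norm_norm_powr_grad[OF p, of "U t"] by simp
      then have "norm ((2 * L) *\<^sub>R norm_powr_grad p (U t)) powr q = (2 * L) powr q * (p powr q * (norm (U t) powr (p - 1)) powr q)"
        using L p by (simp only: powr_mult)
      also have "(norm (U t) powr (p - 1)) powr q = norm (U t) powr p" by (simp only: powr_powr qp(1))
      finally show "norm ((2 * L) *\<^sub>R norm_powr_grad p (U t)) powr q \<le> (2 * L) powr q * p powr q * norm (U t) powr p" by simp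
      show "norm (fst (e t)) powr q \<le> (2 * \<tau>) powr q" using fst_e q by (intro powr_mono2) auto
    qed simp
    finally show ?thesis .
  qed
  have int_bound: "integrable M (\<lambda>t. 2 powr q * ((2 * L) powr q * p powr q * norm (U t) powr p + (2 * \<tau>) powr q))"
    using int by simp
  have int_\<xi>': "integrable M (\<lambda>t. norm (\<xi>' t) powr q)"
    by (rule Bochner_Integration.integrable_bound[OF int_bound]) (use \<xi>'_le in \<open>auto intro!: AE_I2 order_trans[OF _ abs_ge_self]\<close>)
  have \<xi>'_Lq: "\<xi>' \<in> Lp_space q M" unfolding Lp_space_def using int_\<xi>' by simp
  define B where "B = (\<integral>t. norm (\<xi>' t) powr q \<partial>M)"
  have B0: "0 \<le> B" unfolding B_def by (intro integral_nonneg_AE) auto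
  have B_le: "B \<le> 2 powr q * ((2 * L) powr q * p powr q * A + (2 * \<tau>) powr q * m)"
  proof -
    have "B \<le> (\<integral>t. 2 powr q * ((2 * L) powr q * p powr q * norm (U t) powr p + (2 * \<tau>) powr q) \<partial>M)"
      unfolding B_def using int_\<xi>' int_bound \<xi>'_le by (intro integral_mono) auto
    also have "\<dots> = 2 powr q * ((2 * L) powr q * p powr q * A + (2 * \<tau>) powr q * m)"
      unfolding A_def m_def using int by (simp add: mult.commute)
    finally show ?thesis .
  qed
  have BA: "B * A powr (q / p) \<le> 2 powr q * (p powr q + m * 2 powr (q / p)) * (2 * \<tau>) powr q"
  proof -
    have "(2 * L) powr q * (A * A powr (q / p)) = (2 * L * A) powr q"
    proof -
      have "A * A powr (q / p) = A powr (1 + q / p)" using A0 by (simp add: powr_add)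
      then show ?thesis using L A0 by (simp add: qp(2) powr_mult)
    qed
    also have "\<dots> \<le> (2 * \<tau>) powr q"
      using LA L A0 \<tau>3 q by (intro powr_mono2) auto
    finally have 1: "(2 * L) powr q * (A * A powr (q / p)) \<le> (2 * \<tau>) powr q" .
    have 2: "A powr (q / p) \<le> 2 powr (q / p)" using A0 A_le p q by (intro powr_mono2) auto
    have "B * A powr (q / p) \<le> 2 powr q * ((2 * L) powr q * p powr q * A + (2 * \<tau>) powr q * m) * A powr (q / p)"
      by (intro mult_right_mono B_le) simp
    also have "\<dots> = 2 powr q * (p powr q * ((2 * L) powr q * (A * A powr (q / p))) + (2 * \<tau>) powr q * m * A powr (q / p))"
      by (simp add: algebra_simps)
    also have "\<dots> \<le> 2 powr q * (p powr q * (2 * \<tau>) powr q + (2 * \<tau>) powr q * m * 2 powr (q / p))"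
      using m by (intro mult_left_mono add_mono 1 2) auto
    also have "\<dots> = 2 powr q * (p powr q + m * 2 powr (q / p)) * (2 * \<tau>) powr q" by (simp add: algebra_simps)
    finally show ?thesis .
  qed
  have prod: "Lp_norm q M \<xi>' * Lp_norm p M U \<le> product_const p q * (2 * \<tau>)"
  proof -
    have "Lp_norm q M \<xi>' * Lp_norm p M U = B powr (1 / q) * (A powr (q / p)) powr (1 / q)"
      unfolding Lp_norm_def B_def A_def using q by (simp add: powr_powr)
    also have "\<dots> = (B * A powr (q / p)) powr (1 / q)" using B0 by (simp add: powr_mult)
    also have "\<dots> \<le> (2 powr q * (p powr q + m * 2 powr (q / p)) * (2 * \<tau>) powr q) powr (1 / q)"
      using BA B0 q by (intro powr_mono2) auto
    also have "\<dots> = (2 powr q * (p powr q + m * 2 powr (q / p))) powr (1 / q) * ((2 * \<tau>) powr q) powr (1 / q)"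
      by (rule powr_mult)
    also have "((2 * \<tau>) powr q) powr (1 / q) = 2 * \<tau>" using \<tau>(1) q by (simp add: powr_powr)
    finally show ?thesis unfolding product_const_def m_def .
  qed
  have sub': "AE t in M. (\<xi>' t, y' t) \<in> regular_subdifferential (\<phi> t) (Y t)"
    using sub AE_space
  proof eventually_elim
    case (elim t)
    have "(\<xi>' t, y' t) = - (((2 * L) *\<^sub>R norm_powr_grad p (fst (Y t) - x), 0) + e t)"
      unfolding \<xi>'_def y'_def U_def by (simp add: prod_eq_iff)
    moreover have "\<phi> t = (\<lambda>w. enn2ereal (shifted t w) - ereal (\<nu> t))"
      using \<phi>_eq_shifted[OF elim(2)] by (simp add: fun_eq_iff)
    ultimately show ?case using elim(1) by simp
  qed
  have "stationary_within p q xbar ybar \<tau> x Y \<xi>' y'"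
    unfolding stationary_within_def
    using gx gz int A_le(1) NS integral_\<xi>' fst_e(2) prod sub' \<xi>'_Lq
    unfolding m_def Nbar_def A_def U_def by (intro conjI allI) simp_all
  then show ?thesis by (intro exI)
qed

lemma ext_integral_abs_diff_eq:
  assumes [measurable]: "Y \<in> borel_measurable M" "Y' \<in> borel_measurable M"
    and fin: "shifted_integral Y < \<infinity>" "shifted_integral Y' < \<infinity>"
  shows "ext_integral M (\<lambda>t. \<bar>\<phi> t (Y t) - \<phi> t (Y' t)\<bar>) =
    enn2ereal (\<integral>\<^sup>+t. (shifted t (Y t) - shifted t (Y' t)) + (shifted t (Y' t) - shifted t (Y t)) \<partial>M)"
proof -
  note [measurable] = shifted_comp_measurable[OF assms(1)] shifted_comp_measurable[OF assms(2)]
  have "AE t in M. shifted t (Y t) \<noteq> \<infinity>" "AE t in M. shifted t (Y' t) \<noteq> \<infinity>"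
    using fin by (intro nn_integral_PInf_AE shifted_comp_measurable assms(1,2); simp)+
  with AE_space have "AE t in M. e2ennreal \<bar>\<phi> t (Y t) - \<phi> t (Y' t)\<bar>
      = (shifted t (Y t) - shifted t (Y' t)) + (shifted t (Y' t) - shifted t (Y t))"
  proof eventually_elim
    case (elim t)
    obtain a b where ab: "0 \<le> a" "shifted t (Y t) = ennreal a" "0 \<le> b" "shifted t (Y' t) = ennreal b"
      using elim(2,3) less_top_ennreal[of "shifted t (Y t)"] less_top_ennreal[of "shifted t (Y' t)"]
        less_top infinity_ennreal_def by metis
    show ?case
      unfolding \<phi>_eq_shifted[OF elim(1)] ab(2,4) using ab(1,3)
      by (cases "a \<le> b") (simp_all add: ennreal_minus ennreal_neg)
  qed
  then have "(\<integral>\<^sup>+t. e2ennreal \<bar>\<phi> t (Y t) - \<phi> t (Y' t)\<bar> \<partial>M)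
      = (\<integral>\<^sup>+t. (shifted t (Y t) - shifted t (Y' t)) + (shifted t (Y' t) - shifted t (Y t)) \<partial>M)"
    by (rule nn_integral_cong_AE)
  moreover have "e2ennreal (- \<bar>\<phi> t (Y t) - \<phi> t (Y' t)\<bar>) = 0" for t
    by (intro e2ennreal_neg) simp
  ultimately show ?thesis unfolding ext_integral_def by (simp add: zero_ennreal.rep_eq)
qed

end

lemma powr_tendsto_zero:
  fixes b :: "nat \<Rightarrow> real"
  assumes "b \<longlonglongrightarrow> 0" "\<And>k. 0 \<le> b k" "0 < s"
  shows "(\<lambda>k. b k powr s) \<longlonglongrightarrow> 0"
  using tendsto_powr2[OF assms(1) tendsto_const, of s] assms(2,3) by simp

theorem theorem4p5:
  fixes M :: "'t measure"
    and \<phi> :: "'t \<Rightarrow> (real ^ 'n) \<times> (real ^ 'm) \<Rightarrow> ereal"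
    and \<nu> :: "'t \<Rightarrow> real"
    and p q :: real
    and xbar :: "real ^ 'n" and ybar :: "'t \<Rightarrow> real ^ 'm"
  assumes "finite_measure M" and "complete_measure M"
    and "normal_integrand M \<phi>"
    and "integrable M \<nu>" and "\<forall>t\<in>space M. 0 \<le> \<nu> t"
    and "\<forall>t\<in>space M. \<forall>v w. - ereal (\<nu> t) \<le> \<phi> t (v, w)"
    and "1 < p" and "1 < q" and "1 / p + 1 / q = 1"
    and "robust_local_minimizer p M \<phi> xbar ybar"
  shows "\<exists>(x :: nat \<Rightarrow> real ^ 'n) (\<xi> :: nat \<Rightarrow> 't \<Rightarrow> real ^ 'n) (\<xi>' :: nat \<Rightarrow> 't \<Rightarrow> real ^ 'n)
            (y :: nat \<Rightarrow> 't \<Rightarrow> real ^ 'm) (y' :: nat \<Rightarrow> 't \<Rightarrow> real ^ 'm).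
    (\<forall>k. \<xi> k \<in> Lp_space p M \<and> \<xi>' k \<in> Lp_space q M \<and>
         y k \<in> Lp_space 1 M \<and> y' k \<in> Linf_space M) \<and>
    (\<forall>k. AE t in M. (\<xi>' k t, y' k t) \<in> regular_subdifferential (\<phi> t) (\<xi> k t, y k t)) \<and>
    (\<lambda>k. norm (xbar - x k)) \<longlonglongrightarrow> 0 \<and>
    (\<lambda>k. Lp_norm p M (\<lambda>t. xbar - \<xi> k t)) \<longlonglongrightarrow> 0 \<and>
    (\<lambda>k. Lp_norm 1 M (\<lambda>t. ybar t - y k t)) \<longlonglongrightarrow> 0 \<and>
    (\<lambda>k. norm (\<integral>t. \<xi>' k t \<partial>M)) \<longlonglongrightarrow> 0 \<and>
    (\<lambda>k. Linf_norm M (y' k)) \<longlonglongrightarrow> 0 \<and>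
    (\<lambda>k. Lp_norm q M (\<xi>' k) * Lp_norm p M (\<lambda>t. \<xi> k t - x k)) \<longlonglongrightarrow> 0 \<and>
    (\<lambda>k. ext_integral M (\<lambda>t. \<bar>\<phi> t (\<xi> k t, y k t) - \<phi> t (xbar, ybar t)\<bar>)) \<longlonglongrightarrow> 0"
proof -
  interpret bounded_below_integrand M \<phi> \<nu>
    using assms(1,3-6) by (intro bounded_below_integrand.intro bounded_below_integrand_axioms.intro) auto
  note p = \<open>1 < p\<close> and q = \<open>1 < q\<close>
  obtain r where ybar: "ybar \<in> Lp_space 1 M" and fin: "integral_functional M \<phi> xbar ybar < \<infinity>" and r: "0 < r"
    and rob: "robust_minimizer p M \<phi> (cball xbar r) (L1_cball M ybar r) xbar ybar"
    using assms(10) unfolding robust_local_minimizer_def by blast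
  have ym [measurable]: "ybar \<in> borel_measurable M" using ybar unfolding Lp_space_def by simp
  have z0m: "(\<lambda>t. (xbar, ybar t)) \<in> borel_measurable M" by (intro borel_measurable_Pair) auto
  define m where "m = measure M (space M)"
  have m: "0 \<le> m" unfolding m_def by simp
  \<comment> \<open>All members of the geometric sequence \<open>\<tau>\<close> meet the smallness condition because \<open>c \<le> 1\<close> and \<open>c * (3 + m) < r\<close>.\<close>
  define c where "c = min 1 (r / (2 * (3 + m)))"
  have c: "0 < c" "c \<le> 1" "c * (3 + m) < r"
  proof -
    show "0 < c" "c \<le> 1" unfolding c_def using r m by simp_all
    have cancel: "r / (2 * w) * w = r / 2" if "0 < w" for w :: real using that by simp
    have half: "r / (2 * (3 + m)) * (3 + m) = r / 2" by (rule cancel) (use m in simp)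
    have "c * (3 + m) \<le> r / (2 * (3 + m)) * (3 + m)" unfolding c_def using m by (intro mult_right_mono) auto
    also have "\<dots> = r / 2" by (rule half)
    also have "\<dots> < r" using r by simp
    finally show "c * (3 + m) < r" .
  qed
  define \<tau> where "\<tau> k = c * (1 / 2) ^ k" for k :: nat
  have \<tau>: "0 < \<tau> k" "\<tau> k \<le> 1" "(\<tau> k)\<^sup>2 + \<tau> k + \<tau> k / 2 * (1 + m) < r" for k
  proof -
    show pos: "0 < \<tau> k" unfolding \<tau>_def using c by simp
    have le: "\<tau> k \<le> c" unfolding \<tau>_def using c by (simp add: mult_left_le power_le_one)
    then show "\<tau> k \<le> 1" using c(2) by simp
    have "(\<tau> k)\<^sup>2 \<le> c" using mult_mono[OF le \<open>\<tau> k \<le> 1\<close>] pos c(1) by (simp add: power2_eq_square)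
    moreover have "\<tau> k / 2 * (1 + m) \<le> c * (1 + m)" using le pos m by (intro mult_right_mono) auto
    ultimately have "(\<tau> k)\<^sup>2 + \<tau> k + \<tau> k / 2 * (1 + m) \<le> c + c + c * (1 + m)" using le by linarith
    also have "\<dots> = c * (3 + m)" by (simp add: algebra_simps)
    finally show "(\<tau> k)\<^sup>2 + \<tau> k + \<tau> k / 2 * (1 + m) < r" using c(3) by simp
  qed
  have \<tau>0: "\<tau> \<longlonglongrightarrow> 0" unfolding \<tau>_def by (intro tendsto_mult_right_zero LIMSEQ_realpow_zero) auto
  have "\<exists>s. stationary_within p q xbar ybar (\<tau> k) (fst s) (fst (snd s)) (fst (snd (snd s))) (snd (snd (snd s)))" for k
  proof -
    obtain x Y \<xi>' y' where "stationary_within p q xbar ybar (\<tau> k) x Y \<xi>' y'"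
      using stationary_within_exists[OF rob p q assms(9) r ybar fin \<tau>(1,2) \<tau>(3)[unfolded m_def]] by blast
    then show ?thesis by (intro exI[of _ "(x, Y, \<xi>', y')"]) simp
  qed
  from choice[OF allI, OF this] obtain s where s: "\<forall>k. stationary_within p q xbar ybar (\<tau> k)
      (fst (s k)) (fst (snd (s k))) (fst (snd (snd (s k)))) (snd (snd (snd (s k))))" ..
  define x Y \<xi>' y' where "x k = fst (s k)" and "Y k = fst (snd (s k))"
    and "\<xi>' k = fst (snd (snd (s k)))" and "y' k = snd (snd (snd (s k)))" for k
  have st: "stationary_within p q xbar ybar (\<tau> k) (x k) (Y k) (\<xi>' k) (y' k)" for k
    using s unfolding x_def Y_def \<xi>'_def y'_def by simp
  have meas [measurable]: "Y k \<in> borel_measurable M" and \<xi>'_Lq: "\<xi>' k \<in> Lp_space q M"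
    and [measurable]: "y' k \<in> borel_measurable M"
    and gx: "smooth_norm (x k - xbar) \<le> (\<tau> k)\<^sup>2"
    and gz: "(\<integral>\<^sup>+t. ennreal (smooth_norm (Y k t - (xbar, ybar t))) \<partial>M) \<le> ennreal ((\<tau> k)\<^sup>2)"
    and int: "integrable M (\<lambda>t. norm (fst (Y k t) - x k) powr p)"
    and A_le: "(\<integral>t. norm (fst (Y k t) - x k) powr p \<partial>M) \<le> 2 * \<tau> k"
    and val: "shifted_integral (Y k) \<le> shifted_integral (\<lambda>t. (xbar, ybar t))"
    and int_\<xi>': "norm (\<integral>t. \<xi>' k t \<partial>M) \<le> 2 * \<tau> k * (1 + m)"
    and y'_le: "norm (y' k t) \<le> 2 * \<tau> k"
    and prod: "Lp_norm q M (\<xi>' k) * Lp_norm p M (\<lambda>t. fst (Y k t) - x k)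
       \<le> product_const p q * (2 * \<tau> k)"
    and sub: "AE t in M. (\<xi>' k t, y' k t) \<in> regular_subdifferential (\<phi> t) (Y k t)" for k t
    using st[of k] unfolding stationary_within_def m_def[symmetric] by simp_all
  have z0fin: "shifted_integral (\<lambda>t. (xbar, ybar t)) < \<infinity>"
    by (rule robust_lower_bound(1)[OF rob p r ybar fin zero_less_one])

  have x_lim: "x \<longlonglongrightarrow> xbar"
  proof -
    have "(\<lambda>k. smooth_norm (x k - xbar)) \<longlonglongrightarrow> 0"
      by (rule tendsto_sandwich[OF _ _ tendsto_const tendsto_null_power[OF \<tau>0, of 2]]) (use gx in auto)
    then have "(\<lambda>k. x k - xbar) \<longlonglongrightarrow> 0" by (rule smooth_norm_tendsto_zeroD)
    then show ?thesis by (simp add: LIM_zero_iff)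
  qed
  have \<xi>_Lp: "(\<lambda>t. fst (Y k t)) \<in> Lp_space p M" for k
    using integrable_norm_add_powr[of "\<lambda>t. fst (Y k t) - x k" "\<lambda>_. x k" p] int[of k] p
    unfolding Lp_space_def by simp
  have \<xi>_lim: "(\<lambda>k. Lp_norm p M (\<lambda>t. xbar - fst (Y k t))) \<longlonglongrightarrow> 0"
  proof -
    let ?I = "\<lambda>k. \<integral>t. norm (xbar - fst (Y k t)) powr p \<partial>M"
    let ?b = "\<lambda>k. 2 powr p * (m * norm (xbar - x k) powr p + 2 * \<tau> k)"
    have I_le: "?I k \<le> ?b k" for k
    proof -
      have "?I k \<le> (\<integral>t. 2 powr p * (norm (xbar - x k) powr p + norm (fst (Y k t) - x k) powr p) \<partial>M)"
      proof (rule integral_mono)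
        show "integrable M (\<lambda>t. norm (xbar - fst (Y k t)) powr p)"
          using integrable_norm_add_powr[of "\<lambda>t. fst (Y k t) - x k" "\<lambda>_. x k - xbar" p] int[of k] p
          by (simp add: norm_minus_commute)
        show "integrable M (\<lambda>t. 2 powr p * (norm (xbar - x k) powr p + norm (fst (Y k t) - x k) powr p))"
          using int[of k] by simp
        show "norm (xbar - fst (Y k t)) powr p
            \<le> 2 powr p * (norm (xbar - x k) powr p + norm (fst (Y k t) - x k) powr p)" for t
          using norm_add_powr_le[of p "xbar - x k" "x k - fst (Y k t)"] p by (simp add: norm_minus_commute)
      qed
      also have "\<dots> = 2 powr p * (m * norm (xbar - x k) powr p + (\<integral>t. norm (fst (Y k t) - x k) powr p \<partial>M))"
        using int[of k] unfolding m_def by simp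
      also have "\<dots> \<le> ?b k" using A_le[of k] by (intro mult_left_mono add_left_mono) auto
      finally show ?thesis .
    qed
    have b_lim: "?b \<longlonglongrightarrow> 2 powr p * (m * 0 + 2 * 0)"
    proof (intro tendsto_mult tendsto_add tendsto_const \<tau>0)
      have "(\<lambda>k. norm (xbar - x k)) \<longlonglongrightarrow> norm (xbar - xbar)" by (intro tendsto_intros x_lim)
      then show "(\<lambda>k. norm (xbar - x k) powr p) \<longlonglongrightarrow> 0" using p by (intro powr_tendsto_zero) auto
    qed
    have "?I \<longlonglongrightarrow> 0"
    proof (rule tendsto_sandwich[OF _ _ tendsto_const])
      show "\<forall>\<^sub>F k in sequentially. ?I k \<le> ?b k" using I_le by simp
      show "?b \<longlonglongrightarrow> 0" using b_lim by simp
    qed (simp add: integral_nonneg_AE)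
    then show ?thesis unfolding Lp_norm_def using p by (intro powr_tendsto_zero) (auto intro!: integral_nonneg_AE)
  qed
  have y: "(\<lambda>t. snd (Y k t)) \<in> Lp_space 1 M"
     "Lp_norm 1 M (\<lambda>t. snd (Y k t) - ybar t) \<le> (\<tau> k)\<^sup>2 + \<tau> k + \<tau> k / 2 * m" for k
  proof -
    have le: "(\<integral>\<^sup>+t. ennreal (norm (snd (Y k t) - ybar t)) \<partial>M) \<le> ennreal ((\<tau> k)\<^sup>2 + \<tau> k + \<tau> k / 2 * m)"
      unfolding m_def by (rule norm_snd_integral_le_smooth_norm[OF meas z0m \<tau>(1) gz])
    have "0 \<le> (\<tau> k)\<^sup>2 + \<tau> k + \<tau> k / 2 * m" using \<tau>(1)[of k] m by simp
    from L1_cball_iff[OF ybar _ this le]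
    show "(\<lambda>t. snd (Y k t)) \<in> Lp_space 1 M"
      "Lp_norm 1 M (\<lambda>t. snd (Y k t) - ybar t) \<le> (\<tau> k)\<^sup>2 + \<tau> k + \<tau> k / 2 * m" by simp_all
  qed
  have y_lim: "(\<lambda>k. Lp_norm 1 M (\<lambda>t. ybar t - snd (Y k t))) \<longlonglongrightarrow> 0"
  proof (rule tendsto_sandwich[OF _ _ tendsto_const])
    show "\<forall>\<^sub>F k in sequentially. Lp_norm 1 M (\<lambda>t. ybar t - snd (Y k t)) \<le> (\<tau> k)\<^sup>2 + \<tau> k + \<tau> k / 2 * m"
      using y(2) unfolding Lp_norm_def by (simp add: norm_minus_commute)
    have "(\<lambda>k. (\<tau> k)\<^sup>2 + \<tau> k + \<tau> k / 2 * m) \<longlonglongrightarrow> 0\<^sup>2 + 0 + 0 / 2 * m" by (intro tendsto_intros \<tau>0) auto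
    then show "(\<lambda>k. (\<tau> k)\<^sup>2 + \<tau> k + \<tau> k / 2 * m) \<longlonglongrightarrow> 0" by simp
  qed (simp add: Lp_norm_def)
  have y'_inf: "y' k \<in> Linf_space M" "0 \<le> Linf_norm M (y' k)" "Linf_norm M (y' k) \<le> 2 * \<tau> k" for k
    using Linf_space_bounded[of "y' k" M "2 * \<tau> k"] y'_le[of k] \<tau>(1)[of k] by simp_all
  have mult_lim: "(\<lambda>k. C * (2 * \<tau> k)) \<longlonglongrightarrow> 0" for C
    by (intro tendsto_mult_right_zero \<tau>0)
  have int_lim: "(\<lambda>k. norm (\<integral>t. \<xi>' k t \<partial>M)) \<longlonglongrightarrow> 0"
    by (rule tendsto_sandwich[OF _ _ tendsto_const mult_lim[of "1 + m"]]) (use int_\<xi>' in \<open>simp_all add: mult.commute\<close>)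
  have y'_lim: "(\<lambda>k. Linf_norm M (y' k)) \<longlonglongrightarrow> 0"
    by (rule tendsto_sandwich[OF _ _ tendsto_const mult_lim[of 1]]) (use y'_inf in simp_all)
  have prod_lim: "(\<lambda>k. Lp_norm q M (\<xi>' k) * Lp_norm p M (\<lambda>t. fst (Y k t) - x k)) \<longlonglongrightarrow> 0"
    by (rule tendsto_sandwich[OF _ _ tendsto_const
          mult_lim[of "product_const p q"]])
      (use prod in \<open>simp_all add: Lp_norm_def\<close>)
  have val_lim: "(\<lambda>k. ext_integral M (\<lambda>t. \<bar>\<phi> t (Y k t) - \<phi> t (xbar, ybar t)\<bar>)) \<longlonglongrightarrow> 0"
  proof -
    \<comment> \<open>Summability of the gauges upgrades convergence in mean to convergence almost everywhere.\<close>
    have summ: "summable (\<lambda>k. (\<tau> k)\<^sup>2)"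
    proof -
      have "(\<tau> k)\<^sup>2 = c\<^sup>2 * (1 / 4) ^ k" for k
        unfolding \<tau>_def by (simp add: power_mult_distrib power2_eq_square flip: power_mult_distrib)
      then show ?thesis by (simp add: summable_geometric summable_mult)
    qed
    have AE_lim: "AE t in M. (\<lambda>k. Y k t) \<longlonglongrightarrow> (xbar, ybar t)"
      by (rule AE_tendsto_if_smooth_norm_summable[OF meas z0m gz zero_le_power2 summ])
    let ?gap = "\<lambda>k. \<integral>\<^sup>+t. (shifted t (Y k t) - shifted t (xbar, ybar t)) + (shifted t (xbar, ybar t) - shifted t (Y k t)) \<partial>M"
    have "?gap \<longlonglongrightarrow> 0"
    proof (rule nn_integral_abs_diff_tendsto_zero)
      show "AE t in M. shifted t (xbar, ybar t) \<le> liminf (\<lambda>k. shifted t (Y k t))"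
        using AE_lim AE_space by eventually_elim (rule shifted_lsc)
    qed (use shifted_comp_measurable meas z0m z0fin val in auto)
    then have "(\<lambda>k. enn2ereal (?gap k)) \<longlonglongrightarrow> enn2ereal 0"
      by (rule tendsto_enn2erealI)
    moreover have "ext_integral M (\<lambda>t. \<bar>\<phi> t (Y k t) - \<phi> t (xbar, ybar t)\<bar>) =
        enn2ereal (?gap k)" for k
      by (rule ext_integral_abs_diff_eq[OF meas z0m le_less_trans[OF val z0fin] z0fin])
    ultimately show ?thesis by (simp add: zero_ennreal.rep_eq)
  qed
  have "(\<lambda>k. norm (xbar - x k)) \<longlonglongrightarrow> norm (xbar - xbar)" by (intro tendsto_intros x_lim)
  then show ?thesis
    using \<xi>_Lp \<xi>'_Lq y(1) y'_inf(1) sub \<xi>_lim y_lim int_lim y'_lim prod_lim val_lim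
    by (intro exI[of _ x] exI[of _ "\<lambda>k t. fst (Y k t)"] exI[of _ \<xi>'] exI[of _ "\<lambda>k t. snd (Y k t)"] exI[of _ y'])
      simp
qed

end
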